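(* Let $\mathbb{I}$ be the icosian ring and $K=\mathbb{Q}(\tau)=\mathbb{Q}(\sqrt5)$, $\tau=(1+\sqrt5)/2$. The possible indices of similarity submodules (SSMs) of $\mathbb{I}$ are precisely the squares of nonzero rational integers that can be represented by the quadratic form $x^2+xy-y^2$ with $x,y\in\mathbb{Z}$. The number of SSMs of $\mathbb{I}$ of given index is a multiplicative arithmetic function of the index, and its Dirichlet series generating function $F_{\mathbb{I}}(s)=\sum_{m\ge1}|\{M : M\text{ is an SSM of }\mathbb{I},\ [\mathbb{I}:M]=m\}|\;m^{-s}$ is $$F_{\mathbb{I}}(s)=\frac{(\zeta_{\mathbb{I}}(s))^2}{\zeta_{K}(4s)}=\frac{(\zeta_{K}(2s)\,\zeta_{K}(2s-1))^2}{\zeta_{K}(4s)}.$$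
   Context: $\mathbb{R}^4$ is identified with the real quaternions $\mathbb{H}(\mathbb{R})$ via the standard basis $1,i,j,k$ ($i^2=j^2=k^2=ijk=-1$). Let $I$ be the group of 120 quaternions obtained from $(1,0,0,0)$, $\tfrac12(1,1,1,1)$, $\tfrac12(\tau,1,-1/\tau,0)$ by all even permutations of coordinates and arbitrary sign flips (the binary icosahedral group). The icosian ring $\mathbb{I}$ is the $\mathbb{Z}$-span of $I$; it is a free $\mathbb{Z}[\tau]$-module of rank 4 and a maximal order in the quaternion algebra $\mathbb{H}(\mathbb{Q}(\sqrt5))$. Similarity submodule: for a $\mathbb{Z}$-module $L\subset\mathbb{R}^4$ that spans $\mathbb{R}^4$, a subset $M\subset L$ is a similarity submodule (SSM) of $L$ if there are $\alpha\in\mathbb{R}\setminus\{0\}$ and $R\in\mathrm{O}(4)$ with $M=\alpha R(L)\subset L$. Its index is the group index $[L:M]$. SSMs are counted as subsets. $\zeta_K$ is the Dedekind zeta function of $K$. $\zeta_{\mathbb{I}}(s)=\sum_{\mathfrak{a}}[\mathbb{I}:\mathfrak{a}]^{-s}$, where $\mathfrak{a}$ runs over the non-zero left ideals of $\mathbb{I}$. A function $f$ on positive integers is multiplicative if $f(1)=1$ and $f(mn)=f(m)f(n)$ for coprime $m,n$. *)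

theory Defs
  imports
    "HOL-Analysis.Analysis"
    "HOL-Algebra.Ideal"
    "HOL-Combinatorics.Permutations"
    "HOL-Computational_Algebra.Polynomial"
begin

(* The quaternion a + bi + cj + dk is the vector (a,b,c,d). The type "real ^ 4" already
   carries componentwise multiplication as its "*", so the quaternion product is separate. *)

definition qmult :: "real ^ 4 \<Rightarrow> real ^ 4 \<Rightarrow> real ^ 4" where
  "qmult x y = vector
     [x$1 * y$1 - x$2 * y$2 - x$3 * y$3 - x$4 * y$4,
      x$1 * y$2 + x$2 * y$1 + x$3 * y$4 - x$4 * y$3,
      x$1 * y$3 - x$2 * y$4 + x$3 * y$1 + x$4 * y$2,
      x$1 * y$4 + x$2 * y$3 - x$3 * y$2 + x$4 * y$1]"

lemma vector_4 [simp]: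
  "(vector [a, b, c, d] :: 'a::zero ^ 4) $ 1 = a"
  "(vector [a, b, c, d] :: 'a::zero ^ 4) $ 2 = b"
  "(vector [a, b, c, d] :: 'a::zero ^ 4) $ 3 = c"
  "(vector [a, b, c, d] :: 'a::zero ^ 4) $ 4 = d"
  unfolding vector_def by simp_all

definition tau :: real where
  "tau = (1 + sqrt 5) / 2"

definition icosian_group :: "(real ^ 4) set" where
  "icosian_group =
     {\<chi> i. \<epsilon> i * v $ p i | \<epsilon> v p.
        v \<in> {vector [1, 0, 0, 0],
             (1/2) *\<^sub>R vector [1, 1, 1, 1],
             (1/2) *\<^sub>R vector [tau, 1, - 1 / tau, 0]} \<and>
        p permutes UNIV \<and> evenperm p \<and> (\<forall>i. \<epsilon> i = 1 \<or> \<epsilon> i = - 1)}"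

definition int_span :: "'a::real_vector set \<Rightarrow> 'a set" where
  "int_span S = {\<Sum>x\<in>T. of_int (c x) *\<^sub>R x | (T :: 'a set) (c :: 'a \<Rightarrow> int). finite T \<and> T \<subseteq> S}"

definition icosian_ring :: "(real ^ 4) ring" where
  "icosian_ring = \<lparr>carrier = int_span icosian_group, mult = qmult,
     one = vector [1, 0, 0, 0], zero = 0, add = (+)\<rparr>"

(* The group index [R : A] of additive groups; it is 0 if there are infinitely many cosets. *)
definition add_index :: "('a, 'b) ring_scheme \<Rightarrow> 'a set \<Rightarrow> nat" where
  "add_index R A = card (a_rcosets\<^bsub>R\<^esub> A)"

definition SSM :: "(real ^ 4) set \<Rightarrow> (real ^ 4) set \<Rightarrow> bool" where
  "SSM L M \<longleftrightarrow> (\<exists>\<alpha> R. \<alpha> \<noteq> 0 \<and> orthogonal_transformation R \<and>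
     M = (\<lambda>x. \<alpha> *\<^sub>R R x) ` L \<and> M \<subseteq> L)"

definition icosian_SSMs :: "nat \<Rightarrow> (real ^ 4) set set" where
  "icosian_SSMs m = {M. SSM (carrier icosian_ring) M \<and> add_index icosian_ring M = m}"

definition multiplicative :: "(nat \<Rightarrow> nat) \<Rightarrow> bool" where
  "multiplicative f \<longleftrightarrow>
     f 1 = 1 \<and> (\<forall>m>0. \<forall>n>0. coprime m n \<longrightarrow> f (m * n) = f m * f n)"

definition left_ideal :: "'a set \<Rightarrow> ('a, 'b) ring_scheme \<Rightarrow> bool" where
  "left_ideal J R \<longleftrightarrow>
     additive_subgroup J R \<and> (\<forall>r\<in>carrier R. \<forall>x\<in>J. r \<otimes>\<^bsub>R\<^esub> x \<in> J)"

(* K is a number field, given as a subfield of the type 'a. *)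
definition ring_of_integers :: "'a::field_char_0 set \<Rightarrow> 'a ring" where
  "ring_of_integers K = \<lparr>carrier = {x \<in> K. algebraic_int x}, mult = (*),
     one = 1, zero = 0, add = (+)\<rparr>"

(* The zeta functions below are given by their series, i.e. without analytic continuation,
   hence are meaningful only where the series converge (Re s > 1 in both cases used). *)

definition dedekind_zeta :: "'a::field_char_0 set \<Rightarrow> complex \<Rightarrow> complex" where
  "dedekind_zeta K s =
     (\<Sum>\<^sub>\<infinity> J \<in> {J. ideal J (ring_of_integers K) \<and> J \<noteq> {0}}.
        of_nat (add_index (ring_of_integers K) J) powr (- s))"

definition icosian_zeta :: "complex \<Rightarrow> complex" where
  "icosian_zeta s =
     (\<Sum>\<^sub>\<infinity> J \<in> {J. left_ideal J icosian_ring \<and> J \<noteq> {0}}.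
        of_nat (add_index icosian_ring J) powr (- s))"

definition Q_sqrt5 :: "real set" where
  "Q_sqrt5 = {of_rat a + of_rat b * sqrt 5 | a b. True}"

definition icosian_SSM_term :: "complex \<Rightarrow> nat \<Rightarrow> complex" where
  "icosian_SSM_term s m = of_nat (card (icosian_SSMs m)) * of_nat m powr (- s)"

definition icosian_SSM_series :: "complex \<Rightarrow> complex" where
  "icosian_SSM_series s = (\<Sum>\<^sub>\<infinity> m \<in> {1..}. icosian_SSM_term s m)"

end

(* SSMs of the icosian ring I are the sets \<alpha> p I q with \<alpha> in Z[\<tau>] up to units and pI, Iq primitive one-sided ideals.
   Indeed a similarity of the quadratic space that maps I into itself is, after a Skolem-Noether argument and up to
   conjugation, x |-> p x q / m.  The triple is recovered from M = \<alpha> p I q: M I = \<alpha> p I, I M = \<alpha> I q, and M lies in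
   \<delta> I iff \<delta> divides \<alpha>, since \<pi> I is a prime ideal for every prime \<pi> of the centre Z[\<tau>].
   The icosians are norm-Euclidean, because the E8 lattice has small covering radius, so one-sided ideals are principal;
   the index of I a is N(nr a)^2.  Hence the SSM series is \<zeta>_K(4s) Z(s)^2, where Z(s) counts primitive left
   ideals and \<zeta>_I(s) = \<zeta>_K(4s) Z(s).  If \<sigma>(n) is the sum of N(d) over the divisors d of n, then there are \<sigma>(n)
   left ideals of norm n: for a prime \<pi> with q = N(\<pi>), counting the pairs J <= B of left ideals of norms \<pi> n and \<pi>
   shows that both counts f satisfy f(\<pi> n) + q f(n / \<pi>) = (q + 1) f(n).  This gives
   \<zeta>_I(s) = \<zeta>_K(2s) \<zeta>_K(2s - 1). *)

theory Submission
  imports Defs "HOL-Computational_Algebra.Computational_Algebra"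
begin

section \<open>The ring of golden integers\<close>

text \<open>The ring is never identified with 2 x 2 matrices modulo a prime \<pi>. Self-duality
  replaces this: the dual basis for the trace form consists of icosians, and the Casimir sum of b_k
  x d_k over dual bases equals tr(x). Divisibility of traces then detects divisibility of elements,
  which gives the primeness of \<pi> I and recovers the factors of a product. An element of norm
  \<pi> up to units is obtained from a zero divisor modulo \<pi>, and this from a solution of 1 +
  x^2 + y^2 = 0 modulo a rational prime. The q + 1 left ideals of norm \<pi> are counted through
  their intersections with one fixed right ideal. Multiplicativity does not come from an Euler
  product. The SSMs are parametrised by a product of three families, each realised by subgroups and
  closed under J + k I and under intersections of coprime index; multiplicative counting functions
  are closed under Dirichlet convolution. The arithmetic takes place in abstract types for Z[\<tau>]
  and for the icosians. The group of 120 units and the orthogonal maps are reached only at the end,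
  through an embedding.\<close>

datatype zt = ZT (zre: int) (zim: int)

lemma zt_eq_iff: "x = y \<longleftrightarrow> zre x = zre y \<and> zim x = zim y"
  by (cases x; cases y) auto

text \<open>\<open>ZT a b\<close> stands for a + b \<tau>, and the product encodes \<tau>^2 = \<tau>
  + 1. A type of its own, instead of a subset of the reals, gives access to the classes of Euclidean
  rings and of rings with gcd.\<close>

instantiation zt :: comm_ring_1
begin
definition "0 = ZT 0 0"
definition "1 = ZT 1 0"
definition "x + y = ZT (zre x + zre y) (zim x + zim y)"
definition "x - y = ZT (zre x - zre y) (zim x - zim y)"
definition "- x = ZT (- zre x) (- zim x)"
definition "x * y = ZT (zre x * zre y + zim x * zim y)
  (zre x * zim y + zim x * zre y + zim x * zim y)"
instance
  by standard (auto simp: zt_eq_iff zero_zt_def one_zt_def plus_zt_def minus_zt_def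
    uminus_zt_def times_zt_def algebra_simps)
end

lemma zt_sel [simp]:
  "zre 0 = 0" "zim 0 = 0" "zre 1 = 1" "zim 1 = 0"
  "zre (x + y) = zre x + zre y" "zim (x + y) = zim x + zim y"
  "zre (x - y) = zre x - zre y" "zim (x - y) = zim x - zim y"
  "zre (- x) = - zre x" "zim (- x) = - zim x"
  "zre (x * y) = zre x * zre y + zim x * zim y"
  "zim (x * y) = zre x * zim y + zim x * zre y + zim x * zim y"
  by (simp_all add: zero_zt_def one_zt_def plus_zt_def minus_zt_def uminus_zt_def times_zt_def)

lemma zt_of_nat [simp]: "zre (of_nat n) = int n" "zim (of_nat n) = 0"
  by (induction n) auto

lemma zt_of_int [simp]: "zre (of_int n) = n" "zim (of_int n) = 0"
  by (cases n; simp)+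

lemma zt_numeral [simp]: "zre (numeral n) = numeral n" "zim (numeral n) = 0"
  using zt_of_nat[of "numeral n"] by simp_all

text \<open>The Galois conjugation, which sends \<tau> to 1 - \<tau>.\<close>

definition zconj :: "zt \<Rightarrow> zt" where
  "zconj x = ZT (zre x + zim x) (- zim x)"

text \<open>The field norm of a + b \<tau> is the quadratic form of the theorem.\<close>

definition znorm :: "zt \<Rightarrow> int" where
  "znorm x = (zre x)\<^sup>2 + zre x * zim x - (zim x)\<^sup>2"

definition ztau :: zt where "ztau = ZT 0 1"

lemma ztau_sel [simp]: "zre ztau = 0" "zim ztau = 1"
  by (simp_all add: ztau_def)

lemma zconj_sel [simp]: "zre (zconj x) = zre x + zim x" "zim (zconj x) = - zim x"
  by (simp_all add: zconj_def)

lemma zconj_simps: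
  "zconj (x + y) = zconj x + zconj y" "zconj (x - y) = zconj x - zconj y"
  "zconj (x * y) = zconj x * zconj y" "zconj (zconj x) = x"
  "zconj 0 = 0" "zconj 1 = 1" "zconj (of_int k) = of_int k"
  by (auto simp: zt_eq_iff algebra_simps)

lemma mult_zconj: "x * zconj x = of_int (znorm x)"
  by (simp add: zt_eq_iff znorm_def power2_eq_square algebra_simps)

lemma znorm_mult: "znorm (x * y) = znorm x * znorm y"
  by (simp add: znorm_def power2_eq_square algebra_simps)

lemma znorm_simps [simp]: "znorm 0 = 0" "znorm 1 = 1" "znorm (of_int k) = k\<^sup>2" "znorm (zconj x) = znorm x"
  by (simp_all add: znorm_def power2_eq_square algebra_simps)

lemma znorm_power: "znorm (x ^ n) = znorm x ^ n"
  by (induction n) (auto simp: znorm_mult)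

text \<open>Irrationality of sqrt 5 in disguise: 4 N(a + b \<tau>) = (2 a + b)^2 - 5 b^2, and c^2 =
  5 b^2 with b nonzero is impossible because the multiplicities of 5 on the two sides have different
  parity.\<close>

lemma znorm_eq_0_iff [simp]: "znorm x = 0 \<longleftrightarrow> x = 0"
proof
  assume *: "znorm x = 0"
  have "(2 * zre x + zim x)\<^sup>2 = 5 * (zim x)\<^sup>2"
    using * by (simp add: znorm_def power2_eq_square algebra_simps)
  moreover have "zim x = 0" if "c\<^sup>2 = 5 * (zim x)\<^sup>2" for c :: int
  proof (rule ccontr)
    assume b: "zim x \<noteq> 0"
    hence "c \<noteq> 0" using that by auto
    moreover have p: "prime_elem (5::int)" by (simp add: prime_imp_prime_elem)
    ultimately have "2 * multiplicity 5 c = Suc (2 * multiplicity 5 (zim x))"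
      using b arg_cong[OF that, of "multiplicity 5"]
      by (simp add: prime_elem_multiplicity_power_distrib prime_elem_multiplicity_mult_distrib)
    thus False by presburger
  qed
  ultimately have "zim x = 0" by blast
  with * show "x = 0" by (simp add: znorm_def zt_eq_iff)
qed simp

instance zt :: idom
proof
  fix a b :: zt
  assume "a \<noteq> 0" "b \<noteq> 0"
  hence "znorm a * znorm b \<noteq> 0" by simp
  thus "a * b \<noteq> 0" by (metis znorm_mult znorm_eq_0_iff)
qed

instance zt :: ring_char_0
  by standard (auto simp: inj_def zt_eq_iff)

section \<open>Euclidean division in Z[\<tau>], by rounding to nearest integers\<close>

definition round_div :: "int \<Rightarrow> int \<Rightarrow> int" where
  "round_div a b = (2 * a + b) div (2 * b)"

lemma round_div_bound:
  assumes "b > 0"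
  shows "2 * \<bar>a - b * round_div a b\<bar> \<le> b"
proof -
  have "2 * b * round_div a b + (2 * a + b) mod (2 * b) = 2 * a + b"
    unfolding round_div_def by (metis mult_div_mod_eq)
  moreover have "0 \<le> (2 * a + b) mod (2 * b)" "(2 * a + b) mod (2 * b) < 2 * b"
    using assms by simp_all
  ultimately show ?thesis by (auto simp: abs_if algebra_simps)
qed

text \<open>With n = |N(y)| the quotient x / y becomes z / n. Rounding both coordinates leaves an
  error whose coordinates a, b are at most n/2 in absolute value, hence |a^2 + a b - b^2| is at most
  n^2 / 2.\<close>

lemma znorm_div_rem:
  assumes "y \<noteq> 0"
  shows "\<exists>q. \<bar>znorm (x - q * y)\<bar> < \<bar>znorm y\<bar>"
proof -
  define n where "n = \<bar>znorm y\<bar>"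
  have n: "n > 0" using assms by (simp add: n_def)
  define z where "z = x * zconj y * of_int (sgn (znorm y))"
  define q where "q = ZT (round_div (zre z) n) (round_div (zim z) n)"
  define e where "e = z - q * of_int n"
  define a b where "a = zre e" and "b = zim e"
  have ab: "2 * \<bar>a\<bar> \<le> n" "2 * \<bar>b\<bar> \<le> n"
    using round_div_bound[OF n, of "zre z"] round_div_bound[OF n, of "zim z"]
    by (simp_all add: a_def b_def e_def q_def algebra_simps)
  have "4 * a\<^sup>2 \<le> n\<^sup>2" "4 * b\<^sup>2 \<le> n\<^sup>2" "4 * \<bar>a * b\<bar> \<le> n\<^sup>2"
    using mult_mono[OF ab(1) ab(1)] mult_mono[OF ab(2) ab(2)] mult_mono[OF ab] n
    by (simp_all add: power2_eq_square abs_mult)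
  moreover have "0 \<le> a\<^sup>2" "0 \<le> b\<^sup>2" "n\<^sup>2 > 0" using n by simp_all
  ultimately have "\<bar>a\<^sup>2 + a * b - b\<^sup>2\<bar> < n\<^sup>2" by linarith
  hence 1: "\<bar>znorm e\<bar> < n * n" by (simp add: znorm_def a_def b_def power2_eq_square)
  have "of_int n = y * zconj y * of_int (sgn (znorm y))"
    by (simp add: mult_zconj n_def abs_sgn flip: of_int_mult)
  hence "e = (x - q * y) * (zconj y * of_int (sgn (znorm y)))"
    by (simp add: e_def z_def algebra_simps)
  hence "\<bar>znorm e\<bar> = \<bar>znorm (x - q * y)\<bar> * n"
    using assms by (auto simp: znorm_mult abs_mult n_def power2_eq_square sgn_if)
  with 1 n show ?thesis unfolding n_def by (metis mult_less_cancel_right_pos)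
qed

instantiation zt :: idom_modulo
begin
text \<open>A small remainder does not force the exact quotient, which \<open>idom_modulo\<close>
  demands when y divides x; hence the separate middle case.\<close>

definition divide_zt :: "zt \<Rightarrow> zt \<Rightarrow> zt" where
  "x div y = (if y = 0 then 0 else if y dvd x then (THE z. x = z * y)
     else (SOME q. \<bar>znorm (x - q * y)\<bar> < \<bar>znorm y\<bar>))"
definition modulo_zt :: "zt \<Rightarrow> zt \<Rightarrow> zt" where
  "modulo_zt x y = x - x div y * y"
instance
proof
  fix a b :: zt
  show "a * b div b = a" if "b \<noteq> 0"
    using that by (auto simp: divide_zt_def)
qed (auto simp: divide_zt_def modulo_zt_def)
end

instantiation zt :: euclidean_ring
begin
definition euclidean_size_zt :: "zt \<Rightarrow> nat" where
  "euclidean_size_zt x = nat \<bar>znorm x\<bar>"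
instance
proof
  fix a b :: zt
  assume b: "b \<noteq> 0"
  show "euclidean_size (a mod b) < euclidean_size b"
  proof (cases "b dvd a")
    case True
    hence "a mod b = 0" by (simp add: dvd_imp_mod_0)
    thus ?thesis using b by (simp add: euclidean_size_zt_def)
  next
    case False
    have "a div b = (SOME q. \<bar>znorm (a - q * b)\<bar> < \<bar>znorm b\<bar>)"
      using False b by (simp add: divide_zt_def)
    hence "\<bar>znorm (a - a div b * b)\<bar> < \<bar>znorm b\<bar>"
      using someI_ex[OF znorm_div_rem[OF b, of a]] by simp
    thus ?thesis using b by (simp add: euclidean_size_zt_def modulo_zt_def)
  qed
  have "znorm b \<noteq> 0" using b by simp
  hence "1 \<le> \<bar>znorm b\<bar>" by linarith
  hence "\<bar>znorm a\<bar> * 1 \<le> \<bar>znorm a\<bar> * \<bar>znorm b\<bar>"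
    by (intro mult_left_mono) auto
  thus "euclidean_size a \<le> euclidean_size (a * b)"
    by (simp add: euclidean_size_zt_def znorm_mult abs_mult nat_le_eq_zle)
qed (simp add: euclidean_size_zt_def)
end

text \<open>The unit group is infinite, so representatives of the classes of associates are chosen
  by \<^const>\<open>Eps\<close>; representing units by 1 is required by \<^class>\<open>normalization_semidom\<close>.\<close>

definition zt_class_rep :: "zt \<Rightarrow> zt" where
  "zt_class_rep x = (if x dvd 1 then 1 else SOME y. y dvd x \<and> x dvd y)"

lemma zt_class_rep_assoc: "zt_class_rep x dvd x" "x dvd zt_class_rep x"
proof -
  have "(SOME y. y dvd x \<and> x dvd y) dvd x \<and> x dvd (SOME y. y dvd x \<and> x dvd y)"
    by (rule someI[of "\<lambda>y. y dvd x \<and> x dvd y" x]) auto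
  thus "zt_class_rep x dvd x" "x dvd zt_class_rep x"
    by (auto simp: zt_class_rep_def)
qed

lemma zt_class_rep_cong:
  assumes "x dvd y" "y dvd x"
  shows "zt_class_rep x = zt_class_rep y"
proof -
  have "(\<lambda>z. z dvd x \<and> x dvd z) = (\<lambda>z. z dvd y \<and> y dvd z)"
    using assms dvd_trans by blast
  moreover have "x dvd 1 \<longleftrightarrow> y dvd 1" using assms dvd_trans by blast
  ultimately show ?thesis by (simp add: zt_class_rep_def)
qed

instantiation zt :: normalization_euclidean_semiring
begin
definition normalize_zt :: "zt \<Rightarrow> zt" where "normalize x = zt_class_rep x"
definition unit_factor_zt :: "zt \<Rightarrow> zt" where "unit_factor x = x div zt_class_rep x"
instance
proof
  fix a b :: zt
  show nz: "normalize (0::zt) = 0"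
    using zt_class_rep_assoc(2)[of 0] by (simp add: normalize_zt_def)
  show "unit_factor (0::zt) = 0" by (simp add: unit_factor_zt_def)
  show *: "unit_factor x * normalize x = x" for x :: zt
    using zt_class_rep_assoc(1)[of x] by (simp add: unit_factor_zt_def normalize_zt_def)
  show "a dvd 1 \<Longrightarrow> unit_factor a = a"
    by (simp add: unit_factor_zt_def zt_class_rep_def)
  show **: "x \<noteq> 0 \<Longrightarrow> unit_factor x dvd 1" for x :: zt
  proof -
    assume x: "x \<noteq> 0"
    obtain c where c: "normalize x = x * c"
      using zt_class_rep_assoc(2)[of x] by (auto simp: normalize_zt_def)
    have "unit_factor x * c * x = 1 * x" using *[of x] c by (simp add: algebra_simps)
    hence "unit_factor x * c = 1" using x by (simp only: mult_cancel_right) simp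
    thus ?thesis by (metis dvd_triv_left)
  qed
  show "unit_factor (a * b) = a * unit_factor b" if a: "a dvd 1"
  proof (cases "b = 0")
    case False
    have "zt_class_rep (a * b) = zt_class_rep b"
      using a by (intro zt_class_rep_cong) auto
    hence "unit_factor (a * b) * normalize b = a * unit_factor b * normalize b"
      using *[of b] *[of "a * b"] by (simp add: normalize_zt_def mult.assoc)
    moreover have "normalize b \<noteq> 0" using *[of b] False by auto
    ultimately show ?thesis by simp
  qed (simp add: unit_factor_zt_def)
qed
end

instantiation zt :: euclidean_ring_gcd
begin
definition gcd_zt :: "zt \<Rightarrow> zt \<Rightarrow> zt" where "gcd_zt = Euclidean_Algorithm.gcd"
definition lcm_zt :: "zt \<Rightarrow> zt \<Rightarrow> zt" where "lcm_zt = Euclidean_Algorithm.lcm"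
definition Gcd_zt :: "zt set \<Rightarrow> zt" where "Gcd_zt = Euclidean_Algorithm.Gcd"
definition Lcm_zt :: "zt set \<Rightarrow> zt" where "Lcm_zt = Euclidean_Algorithm.Lcm"
instance by standard (simp_all add: gcd_zt_def lcm_zt_def Gcd_zt_def Lcm_zt_def)
end

lemma zt_is_unit_iff: "x dvd 1 \<longleftrightarrow> \<bar>znorm x\<bar> = 1" for x :: zt
proof
  assume "x dvd 1"
  then obtain y where "1 = x * y" by blast
  hence "znorm x * znorm y = 1" by (metis znorm_mult znorm_simps(2))
  thus "\<bar>znorm x\<bar> = 1" by (auto simp: zmult_eq_1_iff)
next
  assume "\<bar>znorm x\<bar> = 1"
  hence "x * (zconj x * of_int (znorm x)) = 1"
    by (simp add: mult_zconj abs_if split: if_splits flip: mult.assoc of_int_mult)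
  thus "x dvd 1" by (metis dvd_triv_left)
qed

lemma abs_znorm_cong: "normalize x = normalize y \<Longrightarrow> \<bar>znorm x\<bar> = \<bar>znorm y\<bar>" for x y :: zt
proof -
  assume "normalize x = normalize y"
  then obtain u where "u dvd 1" "x = u * y"
    by (metis associated_iff_dvd associatedE1)
  thus ?thesis by (simp add: znorm_mult abs_mult zt_is_unit_iff)
qed

lemma abs_znorm_normalize [simp]: "\<bar>znorm (normalize x)\<bar> = \<bar>znorm x\<bar>" for x :: zt
  by (rule abs_znorm_cong) simp

section \<open>The icosian ring as a type\<close>

text \<open>\<open>Ico a b c d\<close> stands for \<open>a + b i + c h + d i h\<close> where \<open>h = ((\<tau> - 1) + \<tau> i + j) / 2\<close>;
  the icosians are the free \<open>\<int>[\<tau>]\<close>-module on \<open>1, i, h, i h\<close>, and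
  \<open>h i = -\<tau> + (\<tau> - 1) i - i h\<close>, \<open>h\<^sup>2 = (\<tau> - 1) h - 1\<close>.\<close>

datatype ico = Ico (ca: zt) (cb: zt) (cc: zt) (cd: zt)

lemma ico_eq_iff: "x = y \<longleftrightarrow> ca x = ca y \<and> cb x = cb y \<and> cc x = cc y \<and> cd x = cd y"
  by (cases x; cases y) auto

lemma ztau_reduce: "ztau * ztau = ztau + 1" "ztau * (ztau * x) = ztau * x + x"
  by (simp_all add: zt_eq_iff)

instantiation ico :: ring_1
begin
definition "0 = Ico 0 0 0 0"
definition "1 = Ico 1 0 0 0"
definition "x + y = Ico (ca x + ca y) (cb x + cb y) (cc x + cc y) (cd x + cd y)"
definition "x - y = Ico (ca x - ca y) (cb x - cb y) (cc x - cc y) (cd x - cd y)"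
definition "- x = Ico (- ca x) (- cb x) (- cc x) (- cd x)"
definition "x * y = Ico
  (ca x * ca y - cb x * cb y - ztau * (cc x * cb y) - cc x * cc y + (1 - ztau) * (cd x * cb y) - cd x * cd y)
  (ca x * cb y + cb x * ca y + (ztau - 1) * (cc x * cb y) + cc x * cd y - ztau * (cd x * cb y) - cd x * cc y)
  (ca x * cc y - cb x * cd y + cc x * ca y + (ztau - 1) * (cc x * cc y) - ztau * (cc x * cd y) + cd x * cb y)
  (ca x * cd y + cb x * cc y - cc x * cb y + cd x * ca y + (ztau - 1) * (cd x * cc y) - ztau * (cd x * cd y))"
instance
proof
  fix x y z :: ico
  show "x * y * z = x * (y * z)"
    by (simp add: ico_eq_iff times_ico_def algebra_simps ztau_reduce)
qed (simp_all add: ico_eq_iff zero_ico_def one_ico_def plus_ico_def minus_ico_def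
      uminus_ico_def times_ico_def algebra_simps)
end

lemma ico_sel [simp]:
  "ca 0 = 0" "cb 0 = 0" "cc 0 = 0" "cd 0 = 0"
  "ca 1 = 1" "cb 1 = 0" "cc 1 = 0" "cd 1 = 0"
  "ca (x + y) = ca x + ca y" "cb (x + y) = cb x + cb y"
  "cc (x + y) = cc x + cc y" "cd (x + y) = cd x + cd y"
  "ca (x - y) = ca x - ca y" "cb (x - y) = cb x - cb y"
  "cc (x - y) = cc x - cc y" "cd (x - y) = cd x - cd y"
  "ca (- x) = - ca x" "cb (- x) = - cb x" "cc (- x) = - cc x" "cd (- x) = - cd x"
  by (simp_all add: zero_ico_def one_ico_def plus_ico_def minus_ico_def uminus_ico_def)

definition zi :: "zt \<Rightarrow> ico" where "zi n = Ico n 0 0 0"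

lemma zi_sel [simp]: "ca (zi n) = n" "cb (zi n) = 0" "cc (zi n) = 0" "cd (zi n) = 0"
  by (simp_all add: zi_def)

lemma zi_simps: "zi 0 = 0" "zi 1 = 1" "zi (m + n) = zi m + zi n" "zi (m - n) = zi m - zi n"
  "zi (- m) = - zi m" "zi (m * n) = zi m * zi n"
  by (auto simp: ico_eq_iff times_ico_def)

lemma zi_eq_iff [simp]: "zi m = zi n \<longleftrightarrow> m = n"
  by (auto simp: ico_eq_iff)

lemma zi_mult_sel [simp]: "ca (zi n * x) = n * ca x" "cb (zi n * x) = n * cb x"
  "cc (zi n * x) = n * cc x" "cd (zi n * x) = n * cd x"
  by (simp_all add: times_ico_def)

lemma zi_commute: "x * zi n = zi n * x"
  by (simp add: ico_eq_iff) (simp add: times_ico_def algebra_simps)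

lemma zi_left_commute: "x * (zi n * y) = zi n * (x * y)"
  by (metis zi_commute mult.assoc)

lemma zi_of_int: "zi (of_int k) = of_int k"
  by (induction k rule: int_induct[where k = 0]) (auto simp: zi_simps)

section \<open>Conjugation, reduced trace and reduced norm of icosians\<close>

definition cj :: "ico \<Rightarrow> ico" where
  "cj x = Ico (ca x + (ztau - 1) * cc x - ztau * cd x) (- cb x) (- cc x) (- cd x)"

text \<open>The traces of h and i h are \<tau> - 1 and -\<tau>; they cause the terms off the
  diagonal here, in \<open>cj\<close> and in \<open>nr\<close>.\<close>

definition itr :: "ico \<Rightarrow> zt" where
  "itr x = 2 * ca x + (ztau - 1) * cc x - ztau * cd x"

definition nr :: "ico \<Rightarrow> zt" where
  "nr x = (ca x)\<^sup>2 + (cb x)\<^sup>2 + (cc x)\<^sup>2 + (cd x)\<^sup>2 + (ztau - 1) * (ca x * cc x)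
    - ztau * (ca x * cd x) + ztau * (cb x * cc x) + (ztau - 1) * (cb x * cd x)"

lemma cj_sel [simp]: "ca (cj x) = ca x + (ztau - 1) * cc x - ztau * cd x"
  "cb (cj x) = - cb x" "cc (cj x) = - cc x" "cd (cj x) = - cd x"
  by (simp_all add: cj_def)

lemma cj_simps: "cj (x + y) = cj x + cj y" "cj (x - y) = cj x - cj y" "cj (- x) = - cj x"
  "cj 0 = 0" "cj 1 = 1" "cj (zi n) = zi n" "cj (cj x) = x"
  by (simp_all add: ico_eq_iff algebra_simps)

lemma cj_mult: "cj (x * y) = cj y * cj x"
  by (simp add: ico_eq_iff times_ico_def algebra_simps ztau_reduce)

lemma mult_cj: "x * cj x = zi (nr x)"
  by (simp add: ico_eq_iff times_ico_def nr_def power2_eq_square algebra_simps ztau_reduce)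

lemma add_cj: "x + cj x = zi (itr x)"
  by (simp add: ico_eq_iff itr_def algebra_simps)

lemma cj_eq: "cj x = zi (itr x) - x"
  using add_cj[of x] by (simp add: algebra_simps)

lemma nr_cj [simp]: "nr (cj x) = nr x"
  by (simp add: nr_def power2_eq_square algebra_simps ztau_reduce)

lemma cj_mult_self: "cj x * x = zi (nr x)"
  using mult_cj[of "cj x"] by (simp add: cj_simps)

lemma nr_zi [simp]: "nr (zi n) = n\<^sup>2"
  by (simp add: nr_def)

lemma nr_simps [simp]: "nr 0 = 0" "nr 1 = 1" "nr (- x) = nr x"
  by (simp_all add: nr_def algebra_simps)

lemma nr_mult: "nr (x * y) = nr x * nr y"
proof -
  have "zi (nr (x * y)) = x * (y * cj y) * cj x"
    by (simp add: cj_mult mult.assoc flip: mult_cj)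
  also have "\<dots> = x * (zi (nr y) * cj x)"
    by (simp only: mult_cj mult.assoc)
  also have "\<dots> = zi (nr y * nr x)"
    by (simp only: zi_left_commute mult_cj zi_simps)
  finally show ?thesis by (simp only: zi_eq_iff mult.commute)
qed

lemma itr_simps: "itr (x + y) = itr x + itr y" "itr (x - y) = itr x - itr y"
  "itr (zi n * x) = n * itr x" "itr (zi n) = 2 * n" "itr 0 = 0" "itr (- x) = - itr x"
  by (simp_all add: itr_def algebra_simps)

lemma itr_cj [simp]: "itr (cj x) = itr x"
  by (simp add: itr_def algebra_simps)

lemma nr_add: "nr (x + y) = nr x + nr y + itr (x * cj y)"
proof -
  have "zi (nr (x + y)) = x * cj x + y * cj y + (x * cj y + cj (x * cj y))"
    by (simp add: cj_simps cj_mult algebra_simps flip: mult_cj)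
  also have "\<dots> = zi (nr x + nr y + itr (x * cj y))"
    by (simp add: mult_cj add_cj zi_simps)
  finally show ?thesis by (simp only: zi_eq_iff)
qed

text \<open>The coordinates of \<open>2 x\<close> with respect to \<open>1, i, j, k\<close>.\<close>

definition qa :: "ico \<Rightarrow> zt" where "qa x = 2 * ca x + (ztau - 1) * cc x - ztau * cd x"
definition qb :: "ico \<Rightarrow> zt" where "qb x = 2 * cb x + ztau * cc x + (ztau - 1) * cd x"

lemma four_nr: "4 * nr x = (qa x)\<^sup>2 + (qb x)\<^sup>2 + (cc x)\<^sup>2 + (cd x)\<^sup>2"
  by (simp add: nr_def qa_def qb_def power2_eq_square algebra_simps ztau_reduce)

section \<open>Real embeddings and total positivity of reduced norms\<close>

definition of_zt :: "zt \<Rightarrow> real" where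
  "of_zt x = of_int (zre x) + of_int (zim x) * tau"

lemma tau_square: "tau * tau = tau + 1"
  by (simp add: tau_def field_simps)

lemma tau_bounds: "1 < tau" "tau < 2"
proof -
  have "sqrt 1 < sqrt 5" "sqrt 5 < sqrt 9" by (subst real_sqrt_less_iff; simp)+
  thus "1 < tau" "tau < 2" by (auto simp: tau_def)
qed

lemma of_zt_simps [simp]: "of_zt (x + y) = of_zt x + of_zt y" "of_zt (x - y) = of_zt x - of_zt y"
  "of_zt (- x) = - of_zt x" "of_zt 0 = 0" "of_zt 1 = 1" "of_zt (x * y) = of_zt x * of_zt y"
  "of_zt (of_int k) = of_int k" "of_zt ztau = tau" "of_zt (numeral n) = numeral n"
  "of_zt (x ^ m) = of_zt x ^ m"
proof -
  show "of_zt (x * y) = of_zt x * of_zt y" for x y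
    using arg_cong[OF tau_square, of "\<lambda>t. of_int (zim x) * of_int (zim y) * t"]
    by (simp add: of_zt_def algebra_simps)
  thus "of_zt (x ^ m) = of_zt x ^ m"
    by (induction m) (auto simp: of_zt_def)
qed (simp_all add: of_zt_def algebra_simps)

lemma of_zt_zconj_mult: "of_zt x * of_zt (zconj x) = of_int (znorm x)"
  by (simp add: mult_zconj flip: of_zt_simps)

lemma of_zt_eq_0_iff [simp]: "of_zt x = 0 \<longleftrightarrow> x = 0"
  using of_zt_zconj_mult[of x] by auto

lemma of_zt_eq_iff [simp]: "of_zt x = of_zt y \<longleftrightarrow> x = y"
  using of_zt_eq_0_iff[of "x - y"] by (simp del: of_zt_eq_0_iff)

lemma zconj_simps' [simp]: "zconj (numeral n) = numeral n" "zconj (x ^ m) = zconj x ^ m"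
  by (simp add: zt_eq_iff, induction m) (auto simp: zconj_simps)

lemma of_zt_nr: "4 * of_zt (nr x) = (of_zt (qa x))\<^sup>2 + (of_zt (qb x))\<^sup>2 + (of_zt (cc x))\<^sup>2 + (of_zt (cd x))\<^sup>2"
  using arg_cong[OF four_nr[of x], of of_zt] by simp

lemma of_zt_zconj_nr: "4 * of_zt (zconj (nr x)) = (of_zt (zconj (qa x)))\<^sup>2 + (of_zt (zconj (qb x)))\<^sup>2
    + (of_zt (zconj (cc x)))\<^sup>2 + (of_zt (zconj (cd x)))\<^sup>2"
  using arg_cong[OF four_nr[of x], of "of_zt \<circ> zconj"] by (simp add: zconj_simps)

text \<open>Under either real embedding of Z[\<tau>], four times a reduced norm is a sum of four
  squares. Total positivity lets later index formulas use \<open>znorm (nr a)\<close> without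
  absolute value.\<close>

lemma of_zt_nr_nonneg: "of_zt (nr x) \<ge> 0" "of_zt (zconj (nr x)) \<ge> 0"
proof -
  have "0 \<le> 4 * of_zt (nr x)" "0 \<le> 4 * of_zt (zconj (nr x))"
    unfolding of_zt_nr of_zt_zconj_nr by simp_all
  thus "of_zt (nr x) \<ge> 0" "of_zt (zconj (nr x)) \<ge> 0" by simp_all
qed

lemma znorm_nr_nonneg: "znorm (nr x) \<ge> 0"
proof -
  have "real_of_int (znorm (nr x)) \<ge> 0"
    unfolding of_zt_zconj_mult[symmetric] by (intro mult_nonneg_nonneg of_zt_nr_nonneg)
  thus ?thesis by simp
qed

text \<open>A sum of real squares vanishes only termwise. Definiteness is what makes the icosians
  free of zero divisors.\<close>

lemma nr_eq_0_iff [simp]: "nr x = 0 \<longleftrightarrow> x = 0"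
proof
  assume *: "nr x = 0"
  have "(of_zt (qa x))\<^sup>2 + (of_zt (qb x))\<^sup>2 + (of_zt (cc x))\<^sup>2 + (of_zt (cd x))\<^sup>2 = 0"
    using of_zt_nr[of x] * by simp
  hence "qa x = 0" "qb x = 0" "cc x = 0" "cd x = 0"
    by (simp_all add: add_nonneg_eq_0_iff)
  thus "x = 0" by (simp add: qa_def qb_def ico_eq_iff)
qed simp

instance ico :: ring_1_no_zero_divisors
proof
  fix x y :: ico
  assume "x \<noteq> 0" "y \<noteq> 0"
  hence "nr x * nr y \<noteq> 0" by simp
  thus "x * y \<noteq> 0" by (metis nr_mult nr_eq_0_iff)
qed

lemma zi_eq_0_iff [simp]: "zi n = 0 \<longleftrightarrow> n = 0"
  using zi_eq_iff[of n 0] by (simp only: zi_simps)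

lemma cj_eq_0_iff [simp]: "cj x = 0 \<longleftrightarrow> x = 0"
  by (metis cj_simps(4,7))

subsection \<open>Self-duality for the trace form\<close>

definition ibasis :: "ico list" where
  "ibasis = [Ico 1 0 0 0, Ico 0 1 0 0, Ico 0 0 1 0, Ico 0 0 0 1]"

text \<open>The dual basis of \<open>ibasis\<close> for the form tr(x y). That its entries are again
  icosians says that the order has discriminant 1, so that no finite prime of Z[\<tau>]
  ramifies.\<close>

definition idual :: "ico list" where
  "idual = [Ico (-1) 0 (ztau - 1) (- ztau), Ico 0 (-2) ztau (ztau - 1),
     Ico (ztau - 1) ztau (-2) 0, Ico (- ztau) (ztau - 1) 0 (-2)]"

lemma idual_expand: "x = (\<Sum>k<4. zi (itr (x * idual ! k)) * ibasis ! k)"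
  by (simp add: eval_nat_numeral ibasis_def idual_def)
     (simp add: ico_eq_iff itr_def times_ico_def algebra_simps ztau_reduce)

text \<open>The Casimir identity. In a matrix algebra E_ij and E_ji are dual bases for the trace
  form, and the sum of E_ij x E_ji is tr(x) times the identity. It converts two-sided products into
  traces in \<open>itr_mem_iz_prime\<close> and \<open>prim_generates_left\<close>.\<close>

lemma idual_trace: "(\<Sum>k<4. ibasis ! k * x * idual ! k) = zi (itr x)"
  by (simp add: eval_nat_numeral ibasis_def idual_def)
     (simp add: ico_eq_iff itr_def times_ico_def algebra_simps ztau_reduce)

subsection \<open>Euclidean division\<close>

text \<open>r is the integer nearest to w / m and r' its neighbour on the other side of w / m. So
  either parity is available, at the price of an error of up to m instead of m/2.\<close>

lemma round_two:
  fixes w m :: int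
  assumes "m > 0"
  shows "\<exists>r r'. 4 * (w - m * r)\<^sup>2 \<le> m\<^sup>2 \<and> (w - m * r')\<^sup>2 \<le> m\<^sup>2 \<and> odd (r + r')"
proof -
  define r where "r = round_div w m"
  define e where "e = w - m * r"
  define r' where "r' = (if e \<ge> 0 then r + 1 else r - 1)"
  have e: "2 * \<bar>e\<bar> \<le> m" using round_div_bound[OF assms] by (simp add: e_def r_def)
  have "4 * e\<^sup>2 \<le> m\<^sup>2"
    using mult_mono[OF e e] assms by (simp add: power2_eq_square)
  moreover have "\<bar>w - m * r'\<bar> \<le> m"
    using e assms by (auto simp: e_def r'_def abs_if algebra_simps split: if_splits)
  hence "\<bar>w - m * r'\<bar>\<^sup>2 \<le> m\<^sup>2" by (intro power_mono) auto
  hence "(w - m * r')\<^sup>2 \<le> m\<^sup>2" by simp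
  moreover have "odd (r + r')" by (auto simp: r'_def)
  ultimately show ?thesis unfolding e_def by blast
qed

text \<open>In the coordinates \<open>(a + b, b)\<close> of \<open>a + b \<tau>\<close>, the vectors of coordinates of doubled icosians
  are the integral vectors whose reduction mod 2 lies in the extended Hamming code of length 8.
  The code has covering radius 2, so after rounding it suffices to change two coordinates.\<close>

lemma hamming_round:
  fixes m :: int
  assumes m: "m > 0"
  shows "\<exists>z1 z2 z3 z4 z5 z6 z7 z8. even (z1 + z6 + z7 + z8) \<and> even (z2 + z5 + z6 + z7) \<and>
     even (z3 + z5 + z6 + z8) \<and> even (z4 + z5 + z7 + z8) \<and>
     2 * ((w1 - m * z1)\<^sup>2 + (w2 - m * z2)\<^sup>2 + (w3 - m * z3)\<^sup>2 + (w4 - m * z4)\<^sup>2 +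
          (w5 - m * z5)\<^sup>2 + (w6 - m * z6)\<^sup>2 + (w7 - m * z7)\<^sup>2 + (w8 - m * z8)\<^sup>2) \<le> 7 * m\<^sup>2"
proof -
  from round_two[OF m] have "\<forall>w. \<exists>r r'. 4 * (w - m * r)\<^sup>2 \<le> m\<^sup>2 \<and> (w - m * r')\<^sup>2 \<le> m\<^sup>2 \<and> odd (r + r')"
    by blast
  then obtain r r' where r: "\<And>w. 4 * (w - m * r w)\<^sup>2 \<le> m\<^sup>2" "\<And>w. (w - m * r' w)\<^sup>2 \<le> m\<^sup>2"
      "\<And>w. odd (r w + r' w)"
    by metis
  define z where "z w b = (if b then r' w else r w)" for w b
  define M where "M = m\<^sup>2"
  have M0: "M \<ge> 0" by (simp add: M_def)
  define E where "E w b = (w - m * z w b)\<^sup>2" for w b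
  have E: "4 * E w b \<le> M + 3 * (M * of_bool b)" for w b
    using r(1,2)[of w] by (cases b) (auto simp: z_def E_def M_def)
  have par: "even (z w b) \<longleftrightarrow> even (r w) \<noteq> b" for w b
    using r(3)[of w] by (auto simp: z_def)
  define s1 s2 s3 s4 where s:
    "s1 \<longleftrightarrow> odd (r w1 + r w6 + r w7 + r w8)" "s2 \<longleftrightarrow> odd (r w2 + r w5 + r w6 + r w7)"
    "s3 \<longleftrightarrow> odd (r w3 + r w5 + r w6 + r w8)" "s4 \<longleftrightarrow> odd (r w4 + r w5 + r w7 + r w8)"
  let ?Q = "\<lambda>b1 b2 b3 b4 b5 b6 b7 b8.
     (s1 \<longleftrightarrow> b1 \<noteq> (b6 \<noteq> (b7 \<noteq> b8))) \<and> (s2 \<longleftrightarrow> b2 \<noteq> (b5 \<noteq> (b6 \<noteq> b7))) \<and>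
     (s3 \<longleftrightarrow> b3 \<noteq> (b5 \<noteq> (b6 \<noteq> b8))) \<and> (s4 \<longleftrightarrow> b4 \<noteq> (b5 \<noteq> (b7 \<noteq> b8))) \<and>
     of_bool b1 + of_bool b2 + of_bool b3 + of_bool b4 +
       of_bool b5 + of_bool b6 + of_bool b7 + of_bool b8 \<le> (2::int)"
  have "\<exists>b1 b2 b3 b4 b5 b6 b7 b8. ?Q b1 b2 b3 b4 b5 b6 b7 b8"
  proof (intro exI)
    \<comment> \<open>Coset leaders: a syndrome of weight at most 2 is a sum of the unit columns 1
      to 4, a syndrome of weight 3 is one of the columns 5 to 8, and 1111 is column 1 plus column
      5.\<close>
    define b5 b6 b7 b8 where b: "b5 \<longleftrightarrow> s2 \<and> s3 \<and> s4" "b6 \<longleftrightarrow> s1 \<and> s2 \<and> s3 \<and> \<not> s4"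
      "b7 \<longleftrightarrow> s1 \<and> s2 \<and> \<not> s3 \<and> s4" "b8 \<longleftrightarrow> s1 \<and> \<not> s2 \<and> s3 \<and> s4"
    show "?Q (s1 \<noteq> (b6 \<noteq> (b7 \<noteq> b8))) (s2 \<noteq> (b5 \<noteq> (b6 \<noteq> b7))) (s3 \<noteq> (b5 \<noteq> (b6 \<noteq> b8)))
        (s4 \<noteq> (b5 \<noteq> (b7 \<noteq> b8))) b5 b6 b7 b8"
      unfolding b by (cases s1; cases s2; cases s3; cases s4; simp)
  qed
  then obtain b1 b2 b3 b4 b5 b6 b7 b8 where Q: "?Q b1 b2 b3 b4 b5 b6 b7 b8" by blast
  have xor: "even (z v b + z v' b' + z v'' b'' + z u c) \<longleftrightarrow>
      odd (r v + r v' + r v'' + r u) = (b \<noteq> (b' \<noteq> (b'' \<noteq> c)))" for v v' v'' u b b' b'' c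
    by (cases b; cases b'; cases b''; cases c; simp add: par; blast?)
  note q = conjunct1[OF Q] conjunct1[OF conjunct2[OF Q]] conjunct1[OF conjunct2[OF conjunct2[OF Q]]]
    conjunct1[OF conjunct2[OF conjunct2[OF conjunct2[OF Q]]]]
  note weight = conjunct2[OF conjunct2[OF conjunct2[OF conjunct2[OF Q]]]]
  have "even (z w1 b1 + z w6 b6 + z w7 b7 + z w8 b8)" "even (z w2 b2 + z w5 b5 + z w6 b6 + z w7 b7)"
    "even (z w3 b3 + z w5 b5 + z w6 b6 + z w8 b8)" "even (z w4 b4 + z w5 b5 + z w7 b7 + z w8 b8)"
    by (simp_all only: xor q s[symmetric])
  \<comment> \<open>Eight squared errors of at most M/4, of which at most two grow to M, sum to at
    most 7 M / 2.\<close>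
  moreover have "2 * (E w1 b1 + E w2 b2 + E w3 b3 + E w4 b4 + E w5 b5 + E w6 b6 + E w7 b7 + E w8 b8) \<le> 7 * M"
  proof -
    have "M * (of_bool b1 + of_bool b2 + of_bool b3 + of_bool b4 +
       of_bool b5 + of_bool b6 + of_bool b7 + of_bool b8) \<le> M * 2"
      using weight M0 by (intro mult_left_mono)
    thus ?thesis
      unfolding distrib_left
      using E[of w1 b1] E[of w2 b2] E[of w3 b3] E[of w4 b4] E[of w5 b5] E[of w6 b6] E[of w7 b7] E[of w8 b8]
      by linarith
  qed
  ultimately show ?thesis unfolding E_def M_def by blast
qed

text \<open>The coordinate sum of x^2 for x = a + b \<tau>, which is the Euclidean square of the
  pair (a + b, b). Through the functional a + b \<tau> to a + b the reduced norm thus becomes a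
  scaled E8 form, see \<open>four_nr_zsq\<close>.\<close>

definition zsq :: "zt \<Rightarrow> int" where
  "zsq x = (zre x + zim x)\<^sup>2 + (zim x)\<^sup>2"

lemma four_nr_zsq: "4 * (zre (nr x) + zim (nr x)) = zsq (qa x) + zsq (qb x) + zsq (cc x) + zsq (cd x)"
proof -
  have sq: "zre (x\<^sup>2) + zim (x\<^sup>2) = zsq x" for x
    by (simp add: zsq_def power2_eq_square algebra_simps)
  show ?thesis
    using arg_cong[OF four_nr[of x], of "\<lambda>t. zre t + zim t"] by (simp flip: sq)
qed

text \<open>The field norm of p + q \<tau> is controlled by p + q, since 5 (p + q)^2 - 4 N = (p + 3
  q)^2.\<close>

lemma znorm_nr_bound: "64 * znorm (nr x) \<le> 5 * (zsq (qa x) + zsq (qb x) + zsq (cc x) + zsq (cd x))\<^sup>2"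
proof -
  have "5 * (p + q)\<^sup>2 - 4 * (p\<^sup>2 + p * q - q\<^sup>2) = (p + 3 * q)\<^sup>2" for p q :: int
    by (simp add: power2_eq_square algebra_simps)
  from this[of "zre (nr x)" "zim (nr x)"]
  have "4 * znorm (nr x) \<le> 5 * (zre (nr x) + zim (nr x))\<^sup>2"
    unfolding znorm_def by (metis diff_ge_0_iff_ge zero_le_power2)
  moreover have "(4 * t)\<^sup>2 = 16 * t\<^sup>2" for t :: int by (simp add: power_mult_distrib)
  ultimately show ?thesis unfolding four_nr_zsq[symmetric] by presburger
qed

lemma ico_round:
  assumes m: "m > 0"
  shows "\<exists>y. znorm (nr (c - zi (of_int m) * y)) < m ^ 4"
proof -
  obtain z1 z2 z3 z4 z5 z6 z7 z8 where
    ev: "even (z1 + z6 + z7 + z8)" "even (z2 + z5 + z6 + z7)" "even (z3 + z5 + z6 + z8)" "even (z4 + z5 + z7 + z8)"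
    and le: "2 * ((zre (qa c) + zim (qa c) - m * z1)\<^sup>2 + (zim (qa c) - m * z2)\<^sup>2
        + (zre (qb c) + zim (qb c) - m * z3)\<^sup>2 + (zim (qb c) - m * z4)\<^sup>2
        + (zre (cc c) + zim (cc c) - m * z5)\<^sup>2 + (zim (cc c) - m * z6)\<^sup>2
        + (zre (cd c) + zim (cd c) - m * z7)\<^sup>2 + (zim (cd c) - m * z8)\<^sup>2) \<le> 7 * m\<^sup>2"
    using hamming_round[OF m] by metis
  define C D where "C = ZT (z5 - z6) z6" and "D = ZT (z7 - z8) z8"
  define A B where "A = ZT (z1 - z2) z2" and "B = ZT (z3 - z4) z4"
  define half where "half x = ZT (zre x div 2) (zim x div 2)" for x
  have half: "2 * half x = x" if "even (zre x)" "even (zim x)" for x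
    using that by (simp add: half_def zt_eq_iff)
  \<comment> \<open>Solves \<open>qa y = A\<close> and \<open>qb y = B\<close> for the first two
    coordinates; the parity conditions make both halves exact.\<close>
  define y where "y = Ico (half (A - ((ztau - 1) * C - ztau * D))) (half (B - (ztau * C + (ztau - 1) * D))) C D"
  define e where "e = c - zi (of_int m) * y"
  have "2 * ca y = A - ((ztau - 1) * C - ztau * D)"
    unfolding y_def ico.sel by (rule half) (use ev in \<open>auto simp: A_def C_def D_def\<close>)
  hence "qa y = A" by (simp add: qa_def y_def algebra_simps)
  moreover have "2 * cb y = B - (ztau * C + (ztau - 1) * D)"
    unfolding y_def ico.sel by (rule half) (use ev in \<open>auto simp: B_def C_def D_def\<close>)
  hence "qb y = B" by (simp add: qb_def y_def algebra_simps)
  moreover have "qa e = qa c - of_int m * qa y" "qb e = qb c - of_int m * qb y"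
    by (simp_all add: e_def qa_def qb_def algebra_simps)
  moreover have "cc e = cc c - of_int m * C" "cd e = cd c - of_int m * D"
    by (simp_all add: e_def y_def)
  ultimately have coords: "qa e = qa c - of_int m * A" "qb e = qb c - of_int m * B"
      "cc e = cc c - of_int m * C" "cd e = cd c - of_int m * D"
    by simp_all
  have "2 * (zsq (qa e) + zsq (qb e) + zsq (cc e) + zsq (cd e)) \<le> 7 * m\<^sup>2"
    unfolding coords using le by (simp add: A_def B_def C_def D_def zsq_def algebra_simps)
  moreover have "0 \<le> zsq (qa e) + zsq (qb e) + zsq (cc e) + zsq (cd e)"
    by (simp add: zsq_def)
  ultimately have "(2 * (zsq (qa e) + zsq (qb e) + zsq (cc e) + zsq (cd e)))\<^sup>2 \<le> (7 * m\<^sup>2)\<^sup>2"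
    by (intro power_mono) auto
  hence "4 * (zsq (qa e) + zsq (qb e) + zsq (cc e) + zsq (cd e))\<^sup>2 \<le> 49 * m ^ 4"
    unfolding power_mult_distrib by simp
  moreover have "m ^ 4 > 0" using m by simp
  \<comment> \<open>The margin is narrow: 5 (7/2)^2 / 64 = 245/256.\<close>
  ultimately have "znorm (nr e) < m ^ 4"
    using znorm_nr_bound[of e] by linarith
  thus ?thesis unfolding e_def by blast
qed

lemma znorm_nr_pos: "x \<noteq> 0 \<Longrightarrow> znorm (nr x) > 0"
  using znorm_nr_nonneg[of x] by (simp add: le_less)

text \<open>\<open>ico_round\<close> divides by rational integers only. The factor
  \<open>cj b * zi (zconj n)\<close>, of norm m^3, turns b into the rational integer m, so the bound
  m^4 becomes the bound m = N(nr b) for the remainder.\<close>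

theorem ico_euclid:
  assumes "b \<noteq> 0"
  shows "\<exists>y. znorm (nr (a - y * b)) < znorm (nr b)"
proof -
  define n where "n = nr b"
  define m where "m = znorm n"
  have m: "m > 0" using znorm_nr_pos[OF assms] by (simp add: m_def n_def)
  obtain y where y: "znorm (nr (a * (cj b * zi (zconj n)) - zi (of_int m) * y)) < m ^ 4"
    using ico_round[OF m] by blast
  have "y * (b * cj b * zi (zconj n)) = y * zi (n * zconj n)"
    by (simp only: mult_cj n_def zi_simps)
  also have "\<dots> = zi (of_int m) * y"
    by (simp only: mult_zconj m_def zi_commute)
  finally have "a * (cj b * zi (zconj n)) - zi (of_int m) * y = (a - y * b) * (cj b * zi (zconj n))"
    by (simp add: left_diff_distrib mult.assoc)
  hence "znorm (nr (a - y * b)) * m ^ 3 < m * m ^ 3"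
    using y by (simp add: nr_mult znorm_mult znorm_power flip: n_def m_def)
      (simp add: power2_eq_square power3_eq_cube eval_nat_numeral algebra_simps)
  thus ?thesis using m unfolding m_def n_def by (auto dest: mult_less_cancel_right_pos[THEN iffD1, rotated])
qed

section \<open>Indices of additive subgroups\<close>

text \<open>Subgroups are plain sets in a type with group operations, so that all counting is done
  without carriers; \<open>additive_subgroup_iff\<close> and \<open>add_index_image\<close>
  translate to records at the end.\<close>

definition sgrp :: "'a::ab_group_add set \<Rightarrow> bool" where
  "sgrp H \<longleftrightarrow> 0 \<in> H \<and> (\<forall>x\<in>H. \<forall>y\<in>H. x - y \<in> H)"

definition cosets :: "'a::ab_group_add set \<Rightarrow> 'a set \<Rightarrow> 'a set set" where
  "cosets A B = (\<lambda>x. (+) x ` B) ` A"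

text \<open>As with \<open>add_index\<close>, an infinite index is 0.\<close>

definition idx :: "'a::ab_group_add set \<Rightarrow> 'a set \<Rightarrow> nat" where
  "idx A B = card (cosets A B)"

definition ssum :: "'a::ab_group_add set \<Rightarrow> 'a set \<Rightarrow> 'a set" where
  "ssum A B = {a + b | a b. a \<in> A \<and> b \<in> B}"

lemma sgrpD: "sgrp H \<Longrightarrow> 0 \<in> H" "sgrp H \<Longrightarrow> x \<in> H \<Longrightarrow> y \<in> H \<Longrightarrow> x - y \<in> H"
  by (auto simp: sgrp_def)

lemma sgrp_uminus: "sgrp H \<Longrightarrow> x \<in> H \<Longrightarrow> - x \<in> H"
  using sgrpD(2)[of H 0 x] sgrpD(1)[of H] by simp

lemma sgrp_plus: "sgrp H \<Longrightarrow> x \<in> H \<Longrightarrow> y \<in> H \<Longrightarrow> x + y \<in> H"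
  using sgrpD(2)[of H x "- y"] sgrp_uminus[of H y] by simp

lemma sgrp_sum: "sgrp H \<Longrightarrow> (\<And>i. i \<in> S \<Longrightarrow> f i \<in> H) \<Longrightarrow> sum f S \<in> H"
  by (induction S rule: infinite_finite_induct) (auto intro: sgrpD sgrp_plus)

lemma sgrp_diff_commute: "sgrp H \<Longrightarrow> x - y \<in> H \<longleftrightarrow> y - x \<in> H"
  using sgrp_uminus[of H "x - y"] sgrp_uminus[of H "y - x"] by auto

lemma sgrp_UNIV [simp]: "sgrp UNIV"
  by (auto simp: sgrp_def)

lemma sgrp_Int: "sgrp A \<Longrightarrow> sgrp B \<Longrightarrow> sgrp (A \<inter> B)"
  by (auto simp: sgrp_def)

lemma sgrp_ssum:
  assumes A: "sgrp A" and B: "sgrp B"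
  shows "sgrp (ssum A B)"
  unfolding sgrp_def
proof (intro conjI ballI)
  show "0 \<in> ssum A B"
    using A B unfolding ssum_def by (force intro: sgrpD)
  fix x y assume "x \<in> ssum A B" "y \<in> ssum A B"
  then obtain a b a' b' where *: "x = a + b" "y = a' + b'" "a \<in> A" "a' \<in> A" "b \<in> B" "b' \<in> B"
    unfolding ssum_def by blast
  have "x - y = (a - a') + (b - b')" using * by simp
  thus "x - y \<in> ssum A B"
    unfolding ssum_def using * sgrpD(2)[OF A] sgrpD(2)[OF B] by blast
qed

lemma ssum_upper1: "sgrp B \<Longrightarrow> A \<subseteq> ssum A B"
  unfolding ssum_def by (force intro: sgrpD)

lemma ssum_upper2: "sgrp A \<Longrightarrow> B \<subseteq> ssum A B"
  unfolding ssum_def by (force intro: sgrpD)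

lemma ssum_least: "sgrp C \<Longrightarrow> A \<subseteq> C \<Longrightarrow> B \<subseteq> C \<Longrightarrow> ssum A B \<subseteq> C"
  unfolding ssum_def by (auto intro: sgrp_plus)

lemma sgrp_image:
  fixes f :: "'a::ab_group_add \<Rightarrow> 'b::ab_group_add"
  assumes "sgrp A" "\<And>x y. x \<in> A \<Longrightarrow> y \<in> A \<Longrightarrow> f (x - y) = f x - f y"
  shows "sgrp (f ` A)"
  unfolding sgrp_def
proof (intro conjI ballI)
  have "f (0 - 0) = f 0 - f 0" by (intro assms(2) sgrpD(1)[OF assms(1)])
  hence "f 0 = 0" by simp
  thus "0 \<in> f ` A" using sgrpD(1)[OF assms(1)] by force
  fix x y assume "x \<in> f ` A" "y \<in> f ` A"
  then obtain a b where "a \<in> A" "b \<in> A" "x = f a" "y = f b" by blast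
  thus "x - y \<in> f ` A"
    using assms(2)[of a b] sgrpD(2)[OF assms(1), of a b] by (metis imageI)
qed

lemma coset_eq_iff:
  assumes "sgrp B"
  shows "(+) x ` B = (+) y ` B \<longleftrightarrow> x - y \<in> B"
proof
  assume "(+) x ` B = (+) y ` B"
  moreover have "x \<in> (+) x ` B" using sgrpD(1)[OF assms] by force
  ultimately obtain b where "b \<in> B" "x = y + b" by auto
  thus "x - y \<in> B" by simp
next
  have sub: "(+) x ` B \<subseteq> (+) y ` B" if "x - y \<in> B" for x y
  proof
    fix z assume "z \<in> (+) x ` B"
    then obtain b where "b \<in> B" "z = x + b" by auto
    hence "z = y + ((x - y) + b)" "(x - y) + b \<in> B" using sgrp_plus[OF assms that] by simp_all
    thus "z \<in> (+) y ` B" by blast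
  qed
  assume "x - y \<in> B"
  thus "(+) x ` B = (+) y ` B" using sub[of x y] sub[of y x] sgrp_diff_commute[OF assms] by blast
qed

lemma cosets_bij:
  assumes "sgrp B" "\<And>x y. x \<in> A \<Longrightarrow> y \<in> A \<Longrightarrow> g x = g y \<longleftrightarrow> x - y \<in> B"
  shows "\<exists>f. bij_betw f (cosets A B) (g ` A)"
proof -
  define r where "r S = (SOME x. x \<in> A \<and> (+) x ` B = S)" for S
  have r: "r ((+) x ` B) \<in> A \<and> (+) (r ((+) x ` B)) ` B = (+) x ` B" if "x \<in> A" for x
    unfolding r_def by (rule someI[of _ x]) (use that in auto)
  have gr: "g (r ((+) x ` B)) = g x" if "x \<in> A" for x
    using r[OF that] assms that coset_eq_iff[OF assms(1)] by blast
  have "bij_betw (g \<circ> r) (cosets A B) (g ` A)"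
  proof (rule bij_betw_imageI)
    show "inj_on (g \<circ> r) (cosets A B)"
    proof (rule inj_onI)
      fix S T assume "S \<in> cosets A B" "T \<in> cosets A B" and eq: "(g \<circ> r) S = (g \<circ> r) T"
      then obtain x y where *: "x \<in> A" "y \<in> A" "S = (+) x ` B" "T = (+) y ` B"
        by (auto simp: cosets_def)
      with eq gr have "g x = g y" by simp
      thus "S = T" using * assms coset_eq_iff[OF assms(1)] by blast
    qed
    show "(g \<circ> r) ` cosets A B = g ` A"
      unfolding cosets_def image_image using gr by (intro image_cong) auto
  qed
  thus ?thesis by blast
qed

text \<open>A map g whose fibres on A are the cosets of B replaces the quotient; residues or tuples
  of cosets then serve as coordinates on it.\<close>

lemma idx_eqI:
  assumes "sgrp B" "\<And>x y. x \<in> A \<Longrightarrow> y \<in> A \<Longrightarrow> g x = g y \<longleftrightarrow> x - y \<in> B"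
  shows "idx A B = card (g ` A)"
  using cosets_bij[OF assms] bij_betw_same_card unfolding idx_def by blast

lemma idx_pos_iff: "A \<noteq> {} \<Longrightarrow> idx A B > 0 \<longleftrightarrow> finite (cosets A B)"
  by (simp add: idx_def cosets_def card_gt_0_iff)

text \<open>x is sent to its class modulo B, paired with the class modulo C of its difference from a
  chosen representative. The image is the full product of the two coset sets; \<open>card\<close> is
  multiplicative on products of infinite sets too, in agreement with index 0.\<close>

lemma idx_mult:
  assumes "sgrp A" "sgrp B" "sgrp C" "C \<subseteq> B" "B \<subseteq> A"
  shows "idx A C = idx A B * idx B C"
proof -
  define r where "r S = (SOME x. x \<in> A \<and> (+) x ` B = S)" for S
  have r: "r ((+) x ` B) \<in> A \<and> (+) (r ((+) x ` B)) ` B = (+) x ` B" if "x \<in> A" for x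
    unfolding r_def by (rule someI[of _ x]) (use that in auto)
  define g where "g x = ((+) x ` B, (+) (x - r ((+) x ` B)) ` C)" for x
  have "idx A C = card (g ` A)"
  proof (rule idx_eqI[OF assms(3)])
    fix x y assume xy: "x \<in> A" "y \<in> A"
    show "g x = g y \<longleftrightarrow> x - y \<in> C"
    proof
      assume eq: "g x = g y"
      hence "(+) x ` B = (+) y ` B" by (simp add: g_def)
      with eq have "(+) (x - r ((+) y ` B)) ` C = (+) (y - r ((+) y ` B)) ` C" by (simp add: g_def)
      thus "x - y \<in> C" by (simp add: coset_eq_iff[OF assms(3)])
    next
      assume *: "x - y \<in> C"
      hence "(+) x ` B = (+) y ` B" using assms(4) by (auto simp: coset_eq_iff[OF assms(2)])
      thus "g x = g y" using * by (simp add: g_def coset_eq_iff[OF assms(3)])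
    qed
  qed
  also have "g ` A = cosets A B \<times> cosets B C"
  proof
    show "g ` A \<subseteq> cosets A B \<times> cosets B C"
    proof
      fix y assume "y \<in> g ` A"
      then obtain x where x: "x \<in> A" "y = g x" by blast
      have "(+) x ` B = (+) (r ((+) x ` B)) ` B" using r[OF x(1)] by simp
      hence "x - r ((+) x ` B) \<in> B" by (rule coset_eq_iff[OF assms(2), THEN iffD1])
      thus "y \<in> cosets A B \<times> cosets B C" using x by (simp add: g_def cosets_def)
    qed
    show "cosets A B \<times> cosets B C \<subseteq> g ` A"
    proof safe
      fix S T assume "S \<in> cosets A B" "T \<in> cosets B C"
      then obtain x b where *: "x \<in> A" "b \<in> B" "S = (+) x ` B" "T = (+) b ` C"
        by (auto simp: cosets_def)
      define y where "y = r S + b"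
      have y: "y \<in> A" using r[OF *(1)] * assms(5) sgrp_plus[OF assms(1)] by (auto simp: y_def)
      have "(+) y ` B = (+) (r S) ` B" by (simp add: coset_eq_iff[OF assms(2)] y_def *(2))
      hence "(+) y ` B = S" using r[OF *(1)] * by simp
      hence "g y = (S, T)" using * by (simp add: g_def y_def)
      thus "(S, T) \<in> g ` A" using y by force
    qed
  qed
  finally show ?thesis by (simp add: card_cartesian_product idx_def)
qed

lemma idx_self: "sgrp A \<Longrightarrow> idx A A = 1"
  using idx_eqI[of A A "\<lambda>_. ()"] sgrpD by (metis One_nat_def card.empty card_insert_disjoint empty_iff finite.emptyI image_constant)

lemma idx_1_imp_eq:
  assumes "sgrp A" "sgrp B" "B \<subseteq> A" "idx A B = 1"
  shows "B = A"
proof -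
  obtain S where S: "cosets A B = {S}" using assms(4) unfolding idx_def by (auto simp: card_1_singleton_iff)
  have "x \<in> B" if "x \<in> A" for x
  proof -
    have mem: "(+) y ` B \<in> cosets A B" if "y \<in> A" for y
      unfolding cosets_def using that by (rule imageI)
    from mem[OF that] mem[OF sgrpD(1)[OF assms(1)]] have "(+) x ` B = (+) 0 ` B" unfolding S by simp
    thus ?thesis by (simp only: coset_eq_iff[OF assms(2)]) simp
  qed
  thus ?thesis using assms(3) by blast
qed

lemma idx_image:
  assumes "sgrp A" "sgrp B" "B \<subseteq> A" "inj_on f A"
    "\<And>x y. x \<in> A \<Longrightarrow> y \<in> A \<Longrightarrow> f (x - y) = f x - f y"
  shows "idx (f ` A) (f ` B) = idx A B"
proof -
  have B: "sgrp (f ` B)" using assms by (intro sgrp_image) auto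
  have "idx A B = card ((\<lambda>x. (+) (f x) ` (f ` B)) ` A)"
  proof (rule idx_eqI[OF assms(2)])
    fix x y assume xy: "x \<in> A" "y \<in> A"
    have "f x - f y \<in> f ` B \<longleftrightarrow> f (x - y) \<in> f ` B" using assms(5)[OF xy] by simp
    also have "\<dots> \<longleftrightarrow> x - y \<in> B"
      by (rule inj_on_image_mem_iff[OF assms(4) sgrpD(2)[OF assms(1) xy] assms(3)])
    finally have "f x - f y \<in> f ` B \<longleftrightarrow> x - y \<in> B" .
    thus "(+) (f x) ` f ` B = (+) (f y) ` f ` B \<longleftrightarrow> x - y \<in> B"
      by (simp add: coset_eq_iff[OF B])
  qed
  thus ?thesis by (simp add: idx_def cosets_def image_image)
qed

text \<open>Second isomorphism theorem: both sides count the cosets of B that meet A.\<close>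

lemma idx_ssum:
  assumes "sgrp A" "sgrp B"
  shows "idx (ssum A B) B = idx A (A \<inter> B)"
proof -
  have "idx A (A \<inter> B) = card ((\<lambda>x. (+) x ` B) ` A)"
    by (rule idx_eqI) (use assms in \<open>auto simp: sgrp_Int coset_eq_iff sgrpD\<close>)
  also have "(\<lambda>x. (+) x ` B) ` A = cosets (ssum A B) B"
  proof
    show "(\<lambda>x. (+) x ` B) ` A \<subseteq> cosets (ssum A B) B"
      unfolding cosets_def using ssum_upper1[OF assms(2)] by blast
    have "(+) (a + b) ` B = (+) a ` B" if "b \<in> B" for a b
      by (simp add: coset_eq_iff[OF assms(2)] that)
    thus "cosets (ssum A B) B \<subseteq> (\<lambda>x. (+) x ` B) ` A"
      unfolding cosets_def ssum_def by blast
  qed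
  finally show ?thesis by (simp add: idx_def)
qed

text \<open>Lagrange: translation by \<open>x\<close> permutes the cosets, so summing representatives gives \<open>[A : B] x \<in> B\<close>.\<close>

lemma idx_mult_mem:
  fixes A :: "'a::ring_1 set"
  assumes "sgrp A" "sgrp B" "B \<subseteq> A" "x \<in> A"
  shows "of_nat (idx A B) * x \<in> B"
proof (cases "finite (cosets A B)")
  case False
  thus ?thesis using sgrpD(1)[OF assms(2)] by (simp add: idx_def)
next
  case True
  define r where "r S = (SOME x. x \<in> A \<and> (+) x ` B = S)" for S
  have r: "r ((+) x ` B) \<in> A \<and> (+) (r ((+) x ` B)) ` B = (+) x ` B" if "x \<in> A" for x
    unfolding r_def by (rule someI[of _ x]) (use that in auto)
  define t where "t S = (+) x ` S" for S
  have t: "t ((+) y ` B) = (+) (x + y) ` B" for y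
    by (auto simp: t_def image_image add.assoc)
  have "inj_on t (cosets A B)"
    by (auto simp: inj_on_def t_def inj_image_eq_iff)
  moreover have "t ` cosets A B \<subseteq> cosets A B"
    using t assms(4) sgrp_plus[OF assms(1)] by (auto simp: cosets_def)
  ultimately have "bij_betw t (cosets A B) (cosets A B)"
    using True by (metis bij_betw_def endo_inj_surj)
  hence "(\<Sum>S\<in>cosets A B. r (t S)) = (\<Sum>S\<in>cosets A B. r S)"
    by (rule sum.reindex_bij_betw)
  hence "of_nat (idx A B) * x = (\<Sum>S\<in>cosets A B. x + r S - r (t S))"
    by (simp add: sum.distrib sum_subtractf idx_def)
  also have "\<dots> \<in> B"
  proof (rule sgrp_sum[OF assms(2)])
    fix S assume "S \<in> cosets A B"
    then obtain y where y: "y \<in> A" "S = (+) y ` B" by (auto simp: cosets_def)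
    have "(+) (r (t S)) ` B = t S" using r[of "x + y"] sgrp_plus[OF assms(1,4) y(1)] y t by simp
    moreover have "(+) (x + r S) ` B = t S" using r[OF y(1)] y(2) t by (metis image_image add.assoc)
    ultimately show "x + r S - r (t S) \<in> B" by (metis coset_eq_iff[OF assms(2)])
  qed
  finally show ?thesis .
qed

text \<open>A subgroup between K and A is the union of its cosets of K, hence determined by a subset
  of a finite set.\<close>

lemma finite_subgroups_above:
  assumes "sgrp A" "sgrp K" "idx A K > 0"
  shows "finite {J. sgrp J \<and> K \<subseteq> J \<and> J \<subseteq> A}"
proof (rule inj_on_finite)
  show "finite (Pow (cosets A K))"
    using assms sgrpD(1)[OF assms(1)] idx_pos_iff[of A K] by (metis empty_iff finite_Pow_iff)
  show "(\<lambda>J. cosets J K) ` {J. sgrp J \<and> K \<subseteq> J \<and> J \<subseteq> A} \<subseteq> Pow (cosets A K)"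
    by (auto simp: cosets_def)
  have *: "J = \<Union> (cosets J K)" if "sgrp J" "K \<subseteq> J" for J
    unfolding cosets_def using that sgrp_plus[OF that(1)] sgrpD(1)[OF assms(2)] by force
  show "inj_on (\<lambda>J. cosets J K) {J. sgrp J \<and> K \<subseteq> J \<and> J \<subseteq> A}"
    using * by (intro inj_onI) (metis (mono_tags, lifting) mem_Collect_eq)
qed

section \<open>Indices of principal ideals\<close>

lemma sgrp_range:
  fixes f :: "'a::ab_group_add \<Rightarrow> 'b::ab_group_add"
  shows "(\<And>x y. f (x - y) = f x - f y) \<Longrightarrow> sgrp (range f)"
  by (rule sgrp_image) auto

lemma idx_range_comp:
  fixes f :: "'b::ab_group_add \<Rightarrow> 'c::ab_group_add" and g :: "'a::ab_group_add \<Rightarrow> 'b"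
  assumes "\<And>x y. f (x - y) = f x - f y" "\<And>x y. g (x - y) = g x - g y" "inj f"
  shows "idx UNIV (range (\<lambda>x. f (g x))) = idx UNIV (range f) * idx UNIV (range g)"
proof -
  have s: "sgrp (range (\<lambda>x. f (g x)))"
    by (rule sgrp_range) (simp add: assms)
  have "idx UNIV (range (\<lambda>x. f (g x))) = idx UNIV (range f) * idx (range f) (f ` range g)"
    unfolding image_image[symmetric]
    by (rule idx_mult) (use s assms in \<open>auto simp: image_image intro!: sgrp_range\<close>)
  also have "idx (range f) (f ` range g) = idx UNIV (range g)"
    by (rule idx_image) (use assms in \<open>auto intro: sgrp_range\<close>)
  finally show ?thesis .
qed

abbreviation zideal :: "zt \<Rightarrow> zt set" where "zideal n \<equiv> range ((*) n)"

lemma sgrp_zideal: "sgrp (zideal n)"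
  by (rule sgrp_range) (simp add: algebra_simps)

lemma zideal_iff: "x \<in> zideal n \<longleftrightarrow> n dvd x"
  by (auto simp: dvd_def)

lemma idx_zideal_of_int:
  assumes "k > 0"
  shows "idx UNIV (zideal (of_int k)) = nat (k\<^sup>2)"
proof -
  define g where "g x = (zre x mod k, zim x mod k)" for x
  have "idx UNIV (zideal (of_int k)) = card (range g)"
  proof (rule idx_eqI[OF sgrp_zideal])
    fix x y :: zt
    have "of_int k dvd z \<longleftrightarrow> k dvd zre z \<and> k dvd zim z" for z :: zt
      by (auto simp: dvd_def zt_eq_iff) (metis zt.sel)
    thus "g x = g y \<longleftrightarrow> x - y \<in> zideal (of_int k)"
      by (auto simp: g_def zideal_iff mod_eq_dvd_iff)
  qed
  also have "range g = {0..<k} \<times> {0..<k}"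
  proof
    show "range g \<subseteq> {0..<k} \<times> {0..<k}" using assms by (auto simp: g_def)
    show "{0..<k} \<times> {0..<k} \<subseteq> range g"
    proof safe
      fix a b assume "a \<in> {0..<k}" "b \<in> {0..<k}"
      hence "g (ZT a b) = (a, b)" by (simp add: g_def)
      thus "(a, b) \<in> range g" by (metis rangeI)
    qed
  qed
  finally show ?thesis using assms by (simp add: card_cartesian_product power2_eq_square nat_mult_distrib)
qed

text \<open>Conjugation gives n and \<open>zconj n\<close> equal indices, and their product is the
  index N(n)^2 of the ideal of the rational integer |N(n)|.\<close>

lemma idx_zideal:
  assumes "n \<noteq> 0"
  shows "idx UNIV (zideal n) = nat \<bar>znorm n\<bar>"
proof -
  have eq: "zideal (zconj n) = zconj ` zideal n" and U: "UNIV = zconj ` UNIV"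
    using zconj_simps(4) by (auto simp: image_image zconj_simps intro!: image_eqI[of _ _ "zconj _"] )
  have "idx UNIV (zideal (zconj n)) = idx UNIV (zideal n)"
    by (subst U, subst eq, rule idx_image)
      (auto simp: sgrp_zideal zconj_simps intro!: inj_on_inverseI[of _ zconj])
  moreover have "zideal (of_int \<bar>znorm n\<bar>) = range (\<lambda>x. n * (zconj n * x))"
  proof -
    have 1: "of_int \<bar>znorm n\<bar> * x = n * (zconj n * (of_int (sgn (znorm n)) * x))" for x
      by (simp add: abs_sgn mult_zconj flip: mult.assoc)
    have 2: "n * (zconj n * x) = of_int \<bar>znorm n\<bar> * (of_int (sgn (znorm n)) * x)" for x
      using assms by (simp add: mult_zconj sgn_if flip: mult.assoc)
    show ?thesis
    proof (intro equalityI image_subsetI)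
      show "of_int \<bar>znorm n\<bar> * x \<in> range (\<lambda>x. n * (zconj n * x))" for x
        unfolding 1 by blast
      show "n * (zconj n * x) \<in> zideal (of_int \<bar>znorm n\<bar>)" for x
        unfolding 2 by blast
    qed
  qed
  moreover have "idx UNIV (range (\<lambda>x. n * (zconj n * x))) = idx UNIV (zideal n) * idx UNIV (zideal (zconj n))"
    by (rule idx_range_comp) (use assms in \<open>auto simp: algebra_simps inj_def\<close>)
  ultimately have "(idx UNIV (zideal n))\<^sup>2 = nat (\<bar>znorm n\<bar>\<^sup>2)"
    using idx_zideal_of_int[of "\<bar>znorm n\<bar>"] assms by (simp add: power2_eq_square)
  also have "\<dots> = (nat \<bar>znorm n\<bar>)\<^sup>2" by (rule nat_power_eq) simp
  finally show ?thesis by (metis power2_eq_imp_eq le0)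
qed

abbreviation iz :: "zt \<Rightarrow> ico set" where "iz n \<equiv> range ((*) (zi n))"
abbreviation LI :: "ico \<Rightarrow> ico set" where "LI a \<equiv> range (\<lambda>x. x * a)"
abbreviation RI :: "ico \<Rightarrow> ico set" where "RI a \<equiv> range (\<lambda>x. a * x)"

lemma sgrp_principal [simp]: "sgrp (LI a)" "sgrp (RI a)"
  by (auto intro!: sgrp_range simp: algebra_simps)

lemma iz_iff: "x \<in> iz n \<longleftrightarrow> n dvd ca x \<and> n dvd cb x \<and> n dvd cc x \<and> n dvd cd x"
proof
  assume "n dvd ca x \<and> n dvd cb x \<and> n dvd cc x \<and> n dvd cd x"
  then obtain a b c d where "ca x = n * a" "cb x = n * b" "cc x = n * c" "cd x = n * d"
    by (auto simp: dvd_def)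
  hence "x = zi n * Ico a b c d" by (simp add: ico_eq_iff)
  thus "x \<in> iz n" by blast
qed auto

lemma idx_iz:
  assumes "n \<noteq> 0"
  shows "idx UNIV (iz n) = (nat \<bar>znorm n\<bar>) ^ 4"
proof -
  define c where "c x = (+) x ` zideal n" for x
  define g where "g x = (c (ca x), c (cb x), c (cc x), c (cd x))" for x
  have "idx UNIV (iz n) = card (range g)"
  proof (rule idx_eqI)
    fix x y
    show "g x = g y \<longleftrightarrow> x - y \<in> iz n"
      by (simp add: g_def c_def iz_iff coset_eq_iff[OF sgrp_zideal] zideal_iff)
  qed simp
  also have "range g = range c \<times> range c \<times> range c \<times> range c"
  proof
    show "range c \<times> range c \<times> range c \<times> range c \<subseteq> range g"
    proof safe
      fix p q r s
      have "g (Ico p q r s) = (c p, c q, c r, c s)" by (simp add: g_def)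
      thus "(c p, c q, c r, c s) \<in> range g" by (metis rangeI)
    qed
  qed (auto simp: g_def)
  also have "card \<dots> = (idx UNIV (zideal n)) ^ 4"
    by (simp add: card_cartesian_product idx_def cosets_def c_def eval_nat_numeral)
  finally show ?thesis by (simp add: idx_zideal[OF assms])
qed

lemma idx_LI_mult:
  assumes "b \<noteq> 0"
  shows "idx UNIV (LI (a * b)) = idx UNIV (LI a) * idx UNIV (LI b)"
proof -
  have "idx UNIV (range (\<lambda>x. x * a * b)) = idx UNIV (LI b) * idx UNIV (LI a)"
    by (rule idx_range_comp) (use assms in \<open>auto simp: algebra_simps inj_def\<close>)
  thus ?thesis by (simp add: mult.assoc mult.commute)
qed

text \<open>Take for \<open>u\<close> a pure quaternion orthogonal to the pure part of \<open>a\<close>.\<close>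

lemma conjugator_exists: "\<exists>u. u \<noteq> 0 \<and> u * a = cj a * u"
proof -
  \<comment> \<open>This is the unit j = 2 h - (\<tau> - 1) - \<tau> i.\<close>
  define j where "j = Ico (1 - ztau) (- ztau) 2 0"
  define i where "i = Ico 0 1 0 0"
  have i: "i * a - cj a * i = zi (- qb a)"
    by (simp add: i_def qb_def ico_eq_iff times_ico_def algebra_simps ztau_reduce)
  have j: "j * a - cj a * j = zi (- cc a)"
    by (simp add: j_def ico_eq_iff times_ico_def algebra_simps ztau_reduce)
  show ?thesis
  proof (cases "qb a = 0 \<and> cc a = 0")
    case True
    hence "i * a = cj a * i" using i by (simp add: zi_simps)
    moreover have "i \<noteq> 0" by (simp add: i_def ico_eq_iff)
    ultimately show ?thesis by blast
  next
    case False
    define u where "u = zi (cc a) * i - zi (qb a) * j"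
    have "u * a - cj a * u = zi (cc a) * (i * a - cj a * i) - zi (qb a) * (j * a - cj a * j)"
      by (simp add: u_def algebra_simps zi_left_commute)
    also have "\<dots> = 0" by (simp add: i j flip: zi_simps)
    finally have "u * a = cj a * u" by simp
    moreover have "u \<noteq> 0"
      using False by (auto simp: u_def i_def j_def ico_eq_iff)
    ultimately show ?thesis by blast
  qed
qed

text \<open>Conjugation swaps left and right ideals, so unlike in \<open>idx_zideal\<close> it
  cannot compare I a with I cj(a). Taking indices in u a = cj(a) u and cancelling the index of I u
  does; the product of the two equal indices is that of nr(a) I.\<close>

lemma idx_LI:
  assumes "a \<noteq> 0"
  shows "idx UNIV (LI a) = (nat (znorm (nr a)))\<^sup>2"
proof -
  obtain u where u: "u \<noteq> 0" "u * a = cj a * u" using conjugator_exists by blast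
  have iz: "LI (zi n) = iz n" for n by (simp add: zi_commute)
  have "idx UNIV (LI u) * idx UNIV (LI a) = idx UNIV (LI u) * idx UNIV (LI (cj a))"
    using idx_LI_mult[of a u] idx_LI_mult[of u "cj a"] u assms by (metis mult.commute)
  moreover have "idx UNIV (LI u) > 0"
  proof -
    have "idx UNIV (LI u) * idx UNIV (LI (cj u)) = (nat \<bar>znorm (nr u)\<bar>) ^ 4"
      using idx_LI_mult[of "cj u" u] idx_iz[of "nr u"] u(1) by (simp add: mult_cj iz)
    moreover have "(nat \<bar>znorm (nr u)\<bar>) ^ 4 > 0" using znorm_nr_pos[OF u(1)] by simp
    ultimately show ?thesis by (metis gr0I mult_0 less_irrefl)
  qed
  ultimately have "idx UNIV (LI a) = idx UNIV (LI (cj a))" by simp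
  moreover have "idx UNIV (LI a) * idx UNIV (LI (cj a)) = (nat \<bar>znorm (nr a)\<bar>) ^ 4"
    using idx_LI_mult[of "cj a" a] idx_iz[of "nr a"] assms by (simp add: mult_cj iz)
  ultimately have "(idx UNIV (LI a))\<^sup>2 = ((nat (znorm (nr a)))\<^sup>2)\<^sup>2"
    using znorm_nr_nonneg[of a] by (simp add: power2_eq_square eval_nat_numeral)
  thus ?thesis by (metis power2_eq_imp_eq le0)
qed

section \<open>One-sided ideals of the icosian ring\<close>

definition lid :: "ico set \<Rightarrow> bool" where
  "lid J \<longleftrightarrow> sgrp J \<and> (\<forall>r. \<forall>x\<in>J. r * x \<in> J)"

lemma lidD: "lid J \<Longrightarrow> sgrp J" "lid J \<Longrightarrow> x \<in> J \<Longrightarrow> r * x \<in> J"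
  by (auto simp: lid_def)

lemma lid_LI [simp]: "lid (LI a)"
  by (auto simp: lid_def simp flip: mult.assoc)

lemma LI_mem: "a \<in> LI a"
  by (metis mult_1 rangeI)

lemma LI_zi: "LI (zi n) = iz n"
  by (simp add: zi_commute)

lemma lid_iz [simp]: "lid (iz n)"
  using lid_LI[of "zi n"] by (simp only: LI_zi)

lemma sgrp_iz [simp]: "sgrp (iz n)"
  by (rule lidD) simp

lemma iz_mult_right: "x \<in> iz n \<Longrightarrow> x * y \<in> iz n"
  by (auto simp: mult.assoc)

lemma iz_mult_left: "x \<in> iz n \<Longrightarrow> y * x \<in> iz n"
  by (auto simp: zi_left_commute)

lemma lid_ssum: "lid A \<Longrightarrow> lid B \<Longrightarrow> lid (ssum A B)"
  unfolding lid_def by (auto simp: sgrp_ssum) (auto simp: ssum_def distrib_left, blast)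

lemma lid_Int: "lid A \<Longrightarrow> lid B \<Longrightarrow> lid (A \<inter> B)"
  by (auto simp: lid_def sgrp_Int)

lemma LI_subset_lid: "lid J \<Longrightarrow> a \<in> J \<Longrightarrow> LI a \<subseteq> J"
  by (auto intro: lidD)

lemma lid_principal:
  assumes "lid J"
  shows "\<exists>a. J = LI a"
proof (cases "J = {0}")
  case True
  hence "J = LI 0" by auto
  thus ?thesis by blast
next
  case False
  then obtain b where "b \<in> J - {0}" using sgrpD(1)[OF lidD(1)[OF assms]] by blast
  then obtain a where a: "a \<in> J - {0}"
      and min: "\<And>x. x \<in> J - {0} \<Longrightarrow> nat (znorm (nr a)) \<le> nat (znorm (nr x))"
    using ex_has_least_nat[of "\<lambda>x. x \<in> J - {0}" b "\<lambda>x. nat (znorm (nr x))"] by blast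
  have "x \<in> LI a" if x: "x \<in> J" for x
  proof -
    obtain y where y: "znorm (nr (x - y * a)) < znorm (nr a)" using ico_euclid a by blast
    have "x - y * a \<in> J" using x a assms by (auto intro!: lidD sgrpD(2))
    hence "x - y * a = 0" using min[of "x - y * a"] y znorm_nr_nonneg[of "x - y * a"] by fastforce
    thus ?thesis by auto
  qed
  moreover have "LI a \<subseteq> J" using a assms by (intro LI_subset_lid) auto
  ultimately show ?thesis by blast
qed

lemma LI_unit:
  assumes "nr c dvd 1"
  shows "LI (c * b) = LI b"
proof
  show "LI (c * b) \<subseteq> LI b" by (auto simp flip: mult.assoc)
  obtain u where u: "1 = nr c * u" using assms by blast
  have "x * b = (x * zi u * cj c) * (c * b)" for x
  proof -
    have "(x * zi u * cj c) * (c * b) = x * zi u * (cj c * c) * b" by (simp add: mult.assoc)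
    also have "\<dots> = x * zi (u * nr c) * b" by (simp add: cj_mult_self zi_simps mult.assoc)
    finally show ?thesis using u by (simp add: mult.commute[of u] zi_simps del: zi_simps(6))
  qed
  thus "LI b \<subseteq> LI (c * b)" by (metis image_subsetI rangeI)
qed

lemma LI_subset_iff: "LI a \<subseteq> LI b \<longleftrightarrow> (\<exists>c. a = c * b)"
  using LI_mem[of a] LI_subset_lid[OF lid_LI, of a b] by blast

lemma nr_dvd_LI: "LI a \<subseteq> LI b \<Longrightarrow> nr b dvd nr a"
  by (auto simp: LI_subset_iff nr_mult)

lemma LI_eq_normalize: "LI a = LI b \<Longrightarrow> normalize (nr a) = normalize (nr b)"
  by (intro associatedI nr_dvd_LI) auto

lemma LI_eq_if_normalize:
  assumes "LI a \<subseteq> LI b" "normalize (nr a) = normalize (nr b)" "b \<noteq> 0"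
  shows "LI a = LI b"
proof -
  obtain c where c: "a = c * b" using assms(1) by (auto simp: LI_subset_iff)
  have "nr c * nr b dvd 1 * nr b"
    using assms(2) c by (metis associatedD1 mult_1 nr_mult)
  hence "nr c dvd 1" using assms(3) by (subst (asm) dvd_mult_cancel_right) simp
  thus ?thesis using LI_unit c by blast
qed

lemma iz_subset_LI: "nr a dvd n \<Longrightarrow> iz n \<subseteq> LI a"
proof
  fix x assume "nr a dvd n" "x \<in> iz n"
  then obtain m y where "n = nr a * m" "x = zi n * y" by (auto simp: dvd_def)
  hence "x = zi (m * nr a) * y" by (simp only: mult.commute[of "nr a"])
  also have "\<dots> = zi m * (zi (nr a) * y)" by (simp only: zi_simps mult.assoc)
  also have "\<dots> = zi m * (y * (cj a * a))" by (simp only: cj_mult_self zi_commute)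
  finally have "x = (zi m * y * cj a) * a" by (simp only: mult.assoc)
  thus "x \<in> LI a" by blast
qed

lemma idx_RI:
  assumes "a \<noteq> 0"
  shows "idx UNIV (RI a) = (nat (znorm (nr a)))\<^sup>2"
proof -
  have "RI a \<subseteq> cj ` LI (cj a)"
  proof (intro image_subsetI)
    fix x
    have "a * x = cj (cj x * cj a)" by (simp only: cj_mult cj_simps)
    thus "a * x \<in> cj ` LI (cj a)" by blast
  qed
  moreover have "cj ` LI (cj a) \<subseteq> RI a"
    unfolding image_image by (intro image_subsetI) (simp add: cj_mult cj_simps, blast)
  ultimately have eq: "RI a = cj ` LI (cj a)" by blast
  have U: "UNIV = cj ` UNIV" by (metis cj_simps(7) surjI)
  have "idx UNIV (RI a) = idx UNIV (LI (cj a))"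
    by (subst U, subst eq, rule idx_image) (auto simp: cj_simps intro!: inj_on_inverseI[of _ cj])
  thus ?thesis using idx_LI[of "cj a"] assms by simp
qed

subsection \<open>Primes of the centre\<close>

text \<open>By self-duality the coordinates of x are the traces
  \<open>itr (x * idual ! k)\<close>.\<close>

lemma dvd_itr_imp_iz:
  assumes "\<And>y. n dvd itr (x * y)"
  shows "x \<in> iz n"
proof -
  have "(\<Sum>k<4. zi (itr (x * idual ! k)) * ibasis ! k) \<in> iz n"
  proof (rule sgrp_sum[OF sgrp_iz])
    fix k
    obtain m where "itr (x * idual ! k) = n * m" using assms by (auto simp: dvd_def)
    thus "zi (itr (x * idual ! k)) * ibasis ! k \<in> iz n" by (simp add: zi_simps mult.assoc, blast)
  qed
  thus ?thesis by (simp flip: idual_expand)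
qed

lemma zi_mult_mem_iz:
  assumes "coprime n m" "zi m * x \<in> iz n"
  shows "x \<in> iz n"
proof -
  obtain y where y: "zi m * x = zi n * y" using assms by auto
  obtain u v where "u * n + v * m = gcd n m" using bezout_coefficients_fst_snd by blast
  hence "u * n + v * m = 1" using assms(1) by (metis coprime_iff_gcd_eq_1)
  hence "x = zi (u * n + v * m) * x" by (simp add: zi_simps)
  also have "\<dots> = zi u * (zi n * x) + zi v * (zi m * x)"
    by (simp only: zi_simps distrib_right mult.assoc)
  also have "\<dots> = zi n * (zi u * x) + zi n * (zi v * y)"
    unfolding y by (simp only: zi_left_commute[of _ n])
  also have "\<dots> = zi n * (zi u * x + zi v * y)" by (simp only: distrib_left)
  finally show ?thesis by blast
qed

text \<open>The Casimir sum around q y, multiplied by p from the left, equals tr(q y) p, and each of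
  its terms contains a product p b_k q.\<close>

lemma itr_mem_iz_prime:
  assumes "\<And>y. p * y * q \<in> iz n"
  shows "zi (itr (q * y)) * p \<in> iz n"
proof -
  have "(\<Sum>k<4. p * (ibasis ! k) * q * (y * idual ! k)) \<in> iz n"
    by (intro sgrp_sum sgrp_iz iz_mult_right assms)
  also have "(\<Sum>k<4. p * (ibasis ! k) * q * (y * idual ! k)) = p * (\<Sum>k<4. ibasis ! k * (q * y) * idual ! k)"
    by (simp add: sum_distrib_left mult.assoc)
  also have "\<dots> = zi (itr (q * y)) * p" by (simp only: idual_trace zi_commute)
  finally show ?thesis .
qed

text \<open>If q is outside \<pi> I, some trace tr(q y) is prime to \<pi>; as tr(q y) p lies in
  \<pi> I, so does p.\<close>

lemma iz_prime:
  assumes "prime_elem \<pi>" "\<And>y. p * y * q \<in> iz \<pi>"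
  shows "p \<in> iz \<pi> \<or> q \<in> iz \<pi>"
proof (rule disjCI)
  assume q: "q \<notin> iz \<pi>"
  then obtain y where "\<not> \<pi> dvd itr (q * y)" using dvd_itr_imp_iz by blast
  hence "coprime \<pi> (itr (q * y))" using assms(1) prime_elem_imp_coprime by blast
  thus "p \<in> iz \<pi>" using itr_mem_iz_prime[OF assms(2), of y] zi_mult_mem_iz by blast
qed

lemma iz_nr_square: "x \<in> iz n \<Longrightarrow> n\<^sup>2 dvd nr x"
  by (auto simp: nr_mult)

lemma prime_elem_not_square_dvd:
  fixes \<pi> :: zt
  assumes "prime_elem \<pi>" "normalize x = normalize \<pi>"
  shows "\<not> \<pi>\<^sup>2 dvd x"
proof
  assume "\<pi>\<^sup>2 dvd x"
  hence "\<pi>\<^sup>2 dvd \<pi>" using assms(2) by (metis associatedD1 dvd_trans)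
  hence "\<pi> * \<pi> dvd \<pi> * 1" by (simp add: power2_eq_square)
  hence "\<pi> dvd 1" using assms(1) by (subst (asm) dvd_mult_cancel_left) auto
  thus False using assms(1) by auto
qed

lemma prime_square_divisor:
  fixes \<pi> :: zt
  assumes "prime_elem \<pi>" "d dvd \<pi>\<^sup>2"
  shows "d dvd 1 \<or> normalize d = normalize \<pi> \<or> normalize d = normalize (\<pi>\<^sup>2)"
proof (cases "\<pi> dvd d")
  case False
  hence "coprime \<pi> d" using assms(1) prime_elem_imp_coprime by blast
  hence "coprime d (\<pi>\<^sup>2)" by (simp add: coprime_commute)
  thus ?thesis using assms(2) by (metis coprime_common_divisor dvd_refl)
next
  case True
  then obtain e where e: "d = \<pi> * e" by blast
  have \<pi>0: "\<pi> \<noteq> 0" using assms(1) by auto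
  hence "e dvd \<pi>" using assms(2) e by (simp add: power2_eq_square)
  then obtain f where f: "\<pi> = e * f" by blast
  hence "\<pi> dvd e \<or> \<pi> dvd f" using assms(1) by (metis dvd_refl prime_elem_dvd_mult_iff)
  thus ?thesis
  proof
    assume "\<pi> dvd e"
    hence "normalize d = normalize (\<pi>\<^sup>2)"
      using assms(2) e by (intro associatedI) (auto simp: power2_eq_square)
    thus ?thesis by blast
  next
    assume "\<pi> dvd f"
    hence "e * f dvd 1 * f" using f by simp
    hence "e dvd 1" using f \<pi>0 by (subst (asm) dvd_mult_cancel_right) auto
    hence "normalize d = normalize \<pi>"
      using e by (intro associatedI) (auto simp: mult_unit_dvd_iff)
    thus ?thesis by blast
  qed
qed

lemma nr_one_plus: "n dvd nr (1 + zi n * y) - 1"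
proof -
  have "nr (1 + zi n * y) = 1 + n\<^sup>2 * nr y + n * itr (cj y)"
    by (simp add: nr_add nr_mult cj_mult cj_simps zi_commute[of _ n] itr_simps)
  thus ?thesis by (simp add: power2_eq_square)
qed

text \<open>Modulo \<pi>, a is a nonzero singular element, so I a + \<pi> I lies strictly between
  \<pi> I and I. Indeed nr b divides \<pi>^2. A unit would give x a = 1 modulo \<pi>, contradicting
  \<pi> dvd nr a, and \<pi>^2 would put a into \<pi> I.\<close>

lemma prime_LI:
  assumes \<pi>: "prime_elem \<pi>" and a: "a \<notin> iz \<pi>" "\<pi> dvd nr a"
  obtains b where "ssum (LI a) (iz \<pi>) = LI b" "normalize (nr b) = normalize \<pi>"
proof -
  obtain b where b: "ssum (LI a) (iz \<pi>) = LI b"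
    using lid_principal lid_ssum lid_LI lid_iz by metis
  have sub: "LI a \<subseteq> LI b" "iz \<pi> \<subseteq> LI b"
    using b ssum_upper1[of "iz \<pi>" "LI a"] ssum_upper2[of "LI a" "iz \<pi>"] by simp_all
  have "nr b dvd \<pi>\<^sup>2" using nr_dvd_LI[of "zi \<pi>" b] sub(2) by (simp add: LI_zi)
  hence "nr b dvd 1 \<or> normalize (nr b) = normalize \<pi> \<or> normalize (nr b) = normalize (\<pi>\<^sup>2)"
    using prime_square_divisor[OF \<pi>] by blast
  moreover have False if "nr b dvd 1"
  proof -
    have "LI b = UNIV" using LI_unit[OF that, of 1] by simp
    hence "1 \<in> ssum (LI a) (iz \<pi>)" using b by simp
    then obtain x y where xy: "1 = x * a + zi \<pi> * y" by (auto simp: ssum_def)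
    hence "x * a = 1 + zi \<pi> * (- y)" by (simp add: algebra_simps)
    hence "\<pi> dvd nr x * nr a - 1" using nr_one_plus[of \<pi> "- y"] by (metis nr_mult)
    hence "\<pi> dvd 1" using a(2) by (metis dvd_mult dvd_diff_right_iff)
    thus False using \<pi> by auto
  qed
  moreover have False if "normalize (nr b) = normalize (\<pi>\<^sup>2)"
  proof -
    have "LI (zi \<pi>) = LI b"
      by (rule LI_eq_if_normalize) (use that sub \<pi> in \<open>auto simp: LI_zi simp del: nr_zi simp: nr_zi\<close>)
    hence "LI a \<subseteq> iz \<pi>" using sub(1) by (simp only: LI_zi)
    thus False using a(1) LI_mem by blast
  qed
  ultimately show ?thesis using that b by blast
qed

section \<open>Left ideals whose generators have norm n up to units\<close>

definition FI :: "zt \<Rightarrow> ico set set" where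
  "FI n = {LI a | a. normalize (nr a) = normalize n}"

lemma FI_cong: "normalize m = normalize n \<Longrightarrow> FI m = FI n"
  by (simp add: FI_def)

lemma FI_LI: "LI a \<in> FI n \<longleftrightarrow> normalize (nr a) = normalize n"
proof
  assume "LI a \<in> FI n"
  then obtain b where "LI a = LI b" "normalize (nr b) = normalize n" unfolding FI_def by blast
  thus "normalize (nr a) = normalize n" using LI_eq_normalize[of a b] by simp
qed (unfold FI_def, blast)

lemma iz_subset_FI: "J \<in> FI n \<Longrightarrow> iz n \<subseteq> J"
proof -
  assume "J \<in> FI n"
  then obtain a where a: "J = LI a" "normalize (nr a) = normalize n" unfolding FI_def by blast
  thus "iz n \<subseteq> J" using iz_subset_LI[of a n] associatedD1[of "nr a" n] by simp
qed

lemma finite_FI: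
  assumes "n \<noteq> 0"
  shows "finite (FI n)"
proof (rule finite_subset)
  show "FI n \<subseteq> {J. sgrp J \<and> iz n \<subseteq> J \<and> J \<subseteq> UNIV}"
    using iz_subset_FI unfolding FI_def by force
  show "finite {J. sgrp J \<and> iz n \<subseteq> J \<and> J \<subseteq> UNIV}"
    by (rule finite_subgroups_above) (use assms idx_iz[of n] in auto)
qed

text \<open>Modulo \<pi> the ideals of norm \<pi> are minimal left ideals, generated by any of their
  nonzero classes. Hence two different ones share only \<pi> I.\<close>

lemma FI_prime_unique:
  assumes \<pi>: "prime_elem \<pi>" and B: "B \<in> FI \<pi>" and a: "a \<in> B" "a \<notin> iz \<pi>"
  shows "B = ssum (LI a) (iz \<pi>)"
proof -
  obtain b where b: "B = LI b" "normalize (nr b) = normalize \<pi>" using B by (auto simp: FI_def)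
  have "b \<noteq> 0" using b \<pi> by auto
  have "\<pi> dvd nr a" using a b by (auto simp: nr_mult dest: associatedD2)
  then obtain c where c: "ssum (LI a) (iz \<pi>) = LI c" "normalize (nr c) = normalize \<pi>"
    using prime_LI[OF \<pi> a(2)] by blast
  have "LI c \<subseteq> LI b"
    unfolding c(1)[symmetric] using a b iz_subset_FI[OF B]
    by (intro ssum_least) (auto simp flip: mult.assoc)
  thus ?thesis using LI_eq_if_normalize[of c b] b c \<open>b \<noteq> 0\<close> by simp
qed

lemma FI_prime_psubset:
  assumes "prime_elem \<pi>" "B \<in> FI \<pi>"
  shows "\<exists>b. B = LI b \<and> b \<notin> iz \<pi> \<and> b \<noteq> 0 \<and> normalize (nr b) = normalize \<pi>"
proof -
  obtain b where b: "B = LI b" "normalize (nr b) = normalize \<pi>" using assms by (auto simp: FI_def)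
  moreover have "b \<notin> iz \<pi>" using prime_elem_not_square_dvd[OF assms(1) b(2)] iz_nr_square by blast
  moreover have "b \<noteq> 0" using calculation(3) sgrpD(1)[OF sgrp_iz] by auto
  ultimately show ?thesis by blast
qed

subsection \<open>Ideals of prime norm\<close>

text \<open>Pigeonhole: for p = 2 h + 1, the h + 1 squares x^2 and the h + 1 values -1 - y^2 with 0
  \<le> x, y \<le> h cannot all be different modulo p.\<close>

lemma sum_two_squares_plus_one_mod:
  fixes p :: nat
  assumes "prime p"
  shows "\<exists>x y :: int. int p dvd 1 + x\<^sup>2 + y\<^sup>2"
proof (cases "p = 2")
  case True
  hence "int p dvd 1 + 1\<^sup>2 + 0\<^sup>2" by simp
  thus ?thesis by blast
next
  case False
  define P where "P = int p"
  have P: "prime P" using assms by (simp add: P_def)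
  have odd: "odd p" using assms False by (metis prime_odd_nat prime_ge_2_nat le_neq_implies_less)
  define h where "h = (P - 1) div 2"
  have h: "P = 2 * h + 1" using odd by (simp add: h_def P_def)
  have h0: "h \<ge> 0" using h prime_gt_0_int[OF P] by linarith
  have inj: "x = y" if "x \<in> {0..h}" "y \<in> {0..h}" "P dvd x\<^sup>2 - y\<^sup>2" for x y
  proof -
    have "P dvd (x - y) * (x + y)" using that(3) by (simp add: power2_eq_square algebra_simps)
    hence "P dvd x - y \<or> P dvd x + y" using P by (simp add: prime_dvd_mult_iff)
    moreover have "\<bar>x - y\<bar> < P" "\<bar>x + y\<bar> < P" using that h by auto
    moreover have "z = 0" if "P dvd z" "\<bar>z\<bar> < P" for z
      using dvd_imp_le_int[of z P] that by (cases "z = 0") auto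
    ultimately have "x - y = 0 \<or> x + y = 0" by blast
    thus ?thesis using that by auto
  qed
  define A where "A = (\<lambda>x. x\<^sup>2 mod P) ` {0..h}"
  define B where "B = (\<lambda>y. (- 1 - y\<^sup>2) mod P) ` {0..h}"
  have "card A = card {0..h}"
    unfolding A_def by (intro card_image inj_onI inj) (auto simp: mod_eq_dvd_iff)
  moreover have "card B = card {0..h}"
    unfolding B_def
  proof (intro card_image inj_onI inj)
    fix x y assume "x \<in> {0..h}" "y \<in> {0..h}" "(- 1 - x\<^sup>2) mod P = (- 1 - y\<^sup>2) mod P"
    thus "P dvd x\<^sup>2 - y\<^sup>2" by (simp add: mod_eq_dvd_iff dvd_diff_commute)
  qed auto
  ultimately have "card A + card B = nat P + 1" using h h0 by simp
  moreover have "card (A \<union> B) \<le> card {0..<P}"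
    using prime_gt_0_int[OF P] by (intro card_mono) (auto simp: A_def B_def)
  hence "card (A \<union> B) \<le> nat P" by simp
  moreover have "finite A" "finite B" by (simp_all add: A_def B_def)
  ultimately have "A \<inter> B \<noteq> {}" using card_Un_disjoint[of A B] by linarith
  then obtain x y where "x\<^sup>2 mod P = (- 1 - y\<^sup>2) mod P" by (auto simp: A_def B_def)
  hence "P dvd 1 + x\<^sup>2 + y\<^sup>2" by (simp add: mod_eq_dvd_iff algebra_simps)
  thus ?thesis unfolding P_def by blast
qed

text \<open>The least positive integer divisible by \<pi> is prime, because \<pi> divides a factor
  in each of its factorisations.\<close>

lemma prime_elem_divides_rational_prime:
  fixes \<pi> :: zt
  assumes "prime_elem \<pi>"
  shows "\<exists>p. prime p \<and> \<pi> dvd of_nat p"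
proof -
  have "\<pi> dvd of_int (znorm \<pi>)" by (metis mult_zconj dvd_triv_left)
  hence "\<pi> dvd of_int \<bar>znorm \<pi>\<bar>" by (cases "znorm \<pi> \<ge> 0") auto
  hence "\<pi> dvd of_nat (nat \<bar>znorm \<pi>\<bar>)" by simp
  moreover have "nat \<bar>znorm \<pi>\<bar> > 0" using assms by auto
  ultimately have ex: "\<exists>m. m > 0 \<and> \<pi> dvd of_nat m" by blast
  define p where "p = (LEAST m. m > 0 \<and> \<pi> dvd of_nat m)"
  have p: "p > 0" "\<pi> dvd of_nat p" using LeastI_ex[OF ex] by (simp_all add: p_def)
  have min: "p \<le> m" if "m > 0" "\<pi> dvd of_nat m" for m
    unfolding p_def using that by (intro Least_le) auto
  have "p \<noteq> 1" using p(2) assms by auto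
  moreover have "m = 1 \<or> m = p" if m: "m dvd p" for m
  proof -
    obtain k where k: "p = m * k" using m by blast
    hence "\<pi> dvd of_nat m \<or> \<pi> dvd of_nat k"
      using p(2) assms by (simp add: prime_elem_dvd_mult_iff)
    moreover have mk: "m > 0" "k > 0" using k p(1) by simp_all
    ultimately have "p \<le> m \<or> p \<le> k" using min[of m] min[of k] by blast
    hence "m * k \<le> m * 1 \<or> m * k \<le> 1 * k" by (simp only: k mult_1 mult_1_right)
    hence "k \<le> 1 \<or> m \<le> 1" using mk by (metis mult_le_cancel1 mult_le_cancel2)
    thus ?thesis using k mk by (auto simp: le_Suc_eq)
  qed
  ultimately have "prime p" using p(1) by (auto simp: prime_nat_iff)
  thus ?thesis using p(2) by blast
qed

text \<open>In 1 + x i + y j, of norm 1 + x^2 + y^2, the h-coordinate is 2 y. If \<pi> divides y,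
  the first coordinate is 1 modulo \<pi>; otherwise the element can vanish modulo \<pi> only if
  \<pi> divides 2, and then 1 + i of norm 2 takes its place.\<close>

lemma isotropic_exists:
  assumes "prime_elem \<pi>"
  shows "\<exists>z. z \<notin> iz \<pi> \<and> \<pi> dvd nr z"
proof -
  obtain p where p: "prime p" "\<pi> dvd of_nat p"
    using prime_elem_divides_rational_prime[OF assms] by blast
  obtain x y :: int where xy: "int p dvd 1 + x\<^sup>2 + y\<^sup>2"
    using sum_two_squares_plus_one_mod[OF p(1)] by blast
  define X Y where "X = (of_int x :: zt)" and "Y = (of_int y :: zt)"
  have dvd: "\<pi> dvd 1 + X\<^sup>2 + Y\<^sup>2"
  proof -
    obtain k where "1 + x\<^sup>2 + y\<^sup>2 = int p * k" using xy by blast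
    hence "(of_int (1 + x\<^sup>2 + y\<^sup>2) :: zt) = of_int (int p * k)" by (rule arg_cong)
    thus ?thesis using p(2) by (simp add: X_def Y_def)
  qed
  \<comment> \<open>this is \<open>1 + x i + y j\<close>\<close>
  define z where "z = Ico (1 - (ztau - 1) * Y) (X - ztau * Y) (2 * Y) 0"
  have nz: "nr z = 1 + X\<^sup>2 + Y\<^sup>2"
    by (simp add: z_def nr_def power2_eq_square algebra_simps ztau_reduce)
  have "\<not> \<pi> dvd 1" using assms by auto
  show ?thesis
  proof (cases "\<pi> dvd Y")
    case True
    hence "z \<notin> iz \<pi>"
      using \<open>\<not> \<pi> dvd 1\<close> by (auto simp: iz_iff z_def dvd_diff_left_iff)
    thus ?thesis using dvd nz by metis
  next
    case False
    show ?thesis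
    proof (cases "z \<in> iz \<pi>")
      case True
      hence "\<pi> dvd 2" using False assms by (auto simp: iz_iff z_def prime_elem_dvd_mult_iff)
      hence "\<pi> dvd nr (Ico 1 1 0 0)" by (simp add: nr_def)
      moreover have "Ico 1 1 0 0 \<notin> iz \<pi>" using \<open>\<not> \<pi> dvd 1\<close> by (simp add: iz_iff)
      ultimately show ?thesis by blast
    qed (use dvd nz in auto)
  qed
qed

lemma prime_nr_exists:
  assumes "prime_elem \<pi>"
  shows "\<exists>d. normalize (nr d) = normalize \<pi>"
  using isotropic_exists[OF assms] prime_LI[OF assms] by metis

text \<open>Follows from z y = tr(z y) - cj(z y). If \<pi> divides nr z, it makes every z y z a
  scalar multiple of z modulo \<pi>.\<close>

lemma sandwich:
  "z * y * z = zi (itr (z * y)) * z - zi (nr z) * cj y"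
proof -
  have "z * y + cj y * cj z = zi (itr (z * y))" by (simp add: cj_mult flip: add_cj)
  hence "z * y = zi (itr (z * y)) - cj y * cj z" by (simp add: algebra_simps)
  hence "z * y * z = (zi (itr (z * y)) - cj y * cj z) * z" by simp
  also have "\<dots> = zi (itr (z * y)) * z - cj y * zi (nr z)"
    by (simp add: left_diff_distrib mult.assoc cj_mult_self)
  finally show ?thesis by (simp add: zi_commute)
qed

lemma cj_mem_iz: "cj x \<in> iz n \<longleftrightarrow> x \<in> iz n"
proof -
  have "cj x \<in> iz n" if x: "x \<in> iz n" for x
  proof -
    obtain y where "x = zi n * y" using x by blast
    hence "cj x = zi n * cj y" by (simp add: cj_mult cj_simps zi_commute)
    thus ?thesis by blast
  qed
  thus ?thesis by (metis cj_simps(7))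
qed

lemma iz_subset_RI:
  assumes "nr d dvd n"
  shows "iz n \<subseteq> RI d"
proof -
  obtain k where "n = nr d * k" using assms by blast
  hence "zi n * x = d * (cj d * (zi k * x))" for x
    by (simp add: zi_simps mult.assoc flip: mult_cj)
  thus ?thesis by blast
qed

definition qn :: "zt \<Rightarrow> nat" where "qn n = nat \<bar>znorm n\<bar>"

lemma qn_normalize [simp]: "qn (normalize n) = qn n"
  by (simp add: qn_def)

lemma qn_cong: "normalize m = normalize n \<Longrightarrow> qn m = qn n"
  by (metis qn_normalize)

lemma qn_mult: "qn (m * n) = qn m * qn n"
  by (simp add: qn_def znorm_mult abs_mult nat_mult_distrib)

lemma qn_eq_0_iff [simp]: "qn n = 0 \<longleftrightarrow> n = 0"
  by (simp add: qn_def)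

lemma qn_pos_iff [simp]: "qn n > 0 \<longleftrightarrow> n \<noteq> 0"
  by (simp add: qn_def)

lemma qn_1 [simp]: "qn 1 = 1"
  by (simp add: qn_def)

lemma qn_eq_1_iff: "qn n = 1 \<longleftrightarrow> n dvd 1"
  by (auto simp: qn_def zt_is_unit_iff)

lemma qn_gt_1: "n \<noteq> 0 \<Longrightarrow> \<not> n dvd 1 \<Longrightarrow> qn n > 1"
  using qn_eq_1_iff[of n] qn_eq_0_iff[of n] by linarith

lemma qn_nr: "qn (nr a) = nat (znorm (nr a))"
  using znorm_nr_nonneg[of a] by (simp add: qn_def)

lemma idx_LI_qn: "a \<noteq> 0 \<Longrightarrow> idx UNIV (LI a) = (qn (nr a))\<^sup>2"
  by (simp add: idx_LI qn_nr)

lemma idx_RI_qn: "a \<noteq> 0 \<Longrightarrow> idx UNIV (RI a) = (qn (nr a))\<^sup>2"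
  by (simp add: idx_RI qn_nr)

lemma idx_iz_qn: "n \<noteq> 0 \<Longrightarrow> idx UNIV (iz n) = qn n ^ 4"
  by (simp add: idx_iz qn_def)

text \<open>Modulo \<open>\<pi>\<close>, a left and a right ideal of norm \<open>\<pi>\<close> meet in a line over \<open>\<int>[\<tau>]/\<pi>\<close>: for
  \<open>z\<close> in the intersection, choose \<open>u\<close> with \<open>tr (z u) \<equiv> 1\<close>; then every \<open>x = z w \<equiv> y z\<close> equals
  \<open>x u z = z w u z \<equiv> tr (z w u) z\<close>.\<close>

lemma idx_Int_prime:
  assumes \<pi>: "prime_elem \<pi>" and B: "B \<in> FI \<pi>" and d: "normalize (nr d) = normalize \<pi>"
  shows "idx (RI d \<inter> B) (iz \<pi>) = qn \<pi>"
proof -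
  have \<pi>0: "\<pi> \<noteq> 0" using \<pi> by auto
  obtain b where b: "B = LI b" "b \<notin> iz \<pi>" "b \<noteq> 0" "normalize (nr b) = normalize \<pi>"
    using FI_prime_psubset[OF \<pi> B] by blast
  have "d \<notin> iz \<pi>" using prime_elem_not_square_dvd[OF \<pi> d] iz_nr_square by blast
  \<comment> \<open>Primeness of \<pi> I supplies an element of the intersection outside \<pi>
    I.\<close>
  then obtain y where y: "d * y * b \<notin> iz \<pi>" using iz_prime[OF \<pi>, of d b] b(2) by blast
  define z where "z = d * y * b"
  have "z \<in> RI d" unfolding z_def mult.assoc by (rule rangeI)
  moreover have "z \<in> B" unfolding z_def b(1) by (rule rangeI)
  moreover have "z \<notin> iz \<pi>" using y by (simp only: z_def not_False_eq_True)
  ultimately have z: "z \<notin> iz \<pi>" "z \<in> RI d" "z \<in> B" by blast+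
  have z_nr: "\<pi> dvd nr z" using d by (auto simp: z_def nr_mult dest: associatedD2)
  obtain u where u: "\<not> \<pi> dvd itr (z * u)" using dvd_itr_imp_iz z(1) by blast
  hence "coprime \<pi> (itr (z * u))" using \<pi> prime_elem_imp_coprime by blast
  then obtain v s where "v * \<pi> + s * itr (z * u) = 1"
    using bezout_coefficients_fst_snd[of \<pi> "itr (z * u)"] by (metis coprime_iff_gcd_eq_1)
  hence s: "\<pi> dvd itr (z * (zi s * u)) - 1"
    by (simp add: zi_left_commute itr_simps) (metis add_diff_cancel_right' diff_minus_eq_add dvd_triv_right dvd_diff_commute)
  \<comment> \<open>The element called u in the explanation above: a Bezout coefficient rescales the
    trace to 1 modulo \<pi>.\<close>
  define w0 where "w0 = zi s * u"
  have sand: "z * x * z - zi (itr (z * x)) * z \<in> iz \<pi>" for x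
  proof -
    obtain k where "nr z = \<pi> * k" using z_nr by blast
    hence "z * x * z - zi (itr (z * x)) * z = zi \<pi> * (- (zi k * cj x))"
      by (simp add: sandwich zi_simps mult.assoc)
    thus ?thesis by blast
  qed
  have idem: "z * w0 * z - z \<in> iz \<pi>"
  proof -
    obtain k where k: "itr (z * w0) - 1 = \<pi> * k" using s unfolding w0_def by blast
    have "zi (itr (z * w0)) * z - z = zi (itr (z * w0) - 1) * z"
      by (simp add: zi_simps left_diff_distrib)
    also have "\<dots> \<in> iz \<pi>" unfolding k by (simp add: zi_simps mult.assoc, blast)
    finally have "(z * w0 * z - zi (itr (z * w0)) * z) + (zi (itr (z * w0)) * z - z) \<in> iz \<pi>"
      by (rule sgrp_plus[OF sgrp_iz sand])
    thus ?thesis by simp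
  qed
  define Oz where "Oz = range (\<lambda>n. zi n * z)"
  have Oz: "sgrp Oz" unfolding Oz_def by (rule sgrp_range) (simp add: zi_simps left_diff_distrib)
  have sub: "iz \<pi> \<subseteq> RI d" using d by (intro iz_subset_RI) (metis associatedD1)
  have "RI d \<inter> B = ssum Oz (iz \<pi>)"
  proof
    have "Oz \<subseteq> RI d" using z(2) by (auto simp: Oz_def zi_left_commute[symmetric])
    moreover have "Oz \<subseteq> B" using z(3) b(1) by (auto simp: Oz_def intro: lidD(2)[OF lid_LI])
    moreover have "sgrp (RI d \<inter> B)" using b(1) by (simp add: sgrp_Int)
    ultimately show "ssum Oz (iz \<pi>) \<subseteq> RI d \<inter> B"
      using iz_subset_FI[OF B] sub by (intro ssum_least) auto
    show "RI d \<inter> B \<subseteq> ssum Oz (iz \<pi>)"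
    proof
      fix x assume x: "x \<in> RI d \<inter> B"
      have "B = ssum (LI z) (iz \<pi>)" by (rule FI_prime_unique) (use \<pi> B z in auto)
      then obtain y e where xy: "x = y * z + e" "e \<in> iz \<pi>" using x by (auto simp: ssum_def)
      have "\<exists>w e'. x = z * w + e' \<and> e' \<in> iz \<pi>"
      proof -
        \<comment> \<open>The representation by a right multiple of z is the left-ideal statement
          applied to \<open>cj x\<close>.\<close>
        have cjB: "LI (cj d) \<in> FI \<pi>" using d by (simp add: FI_LI)
        have "cj z \<in> LI (cj d)" "cj z \<notin> iz \<pi>"
          using z(1,2) by (auto simp: cj_mult cj_mem_iz simp del: mem_Collect_eq)
        hence "LI (cj d) = ssum (LI (cj z)) (iz \<pi>)" using FI_prime_unique[OF \<pi> cjB] by blast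
        moreover have "cj x \<in> LI (cj d)" using x by (auto simp: cj_mult)
        ultimately obtain w e' where "cj x = w * cj z + e'" "e' \<in> iz \<pi>" by (auto simp: ssum_def)
        hence "cj (cj x) = cj (w * cj z + e')" "cj e' \<in> iz \<pi>" by (simp_all only: cj_mem_iz)
        hence "x = z * cj w + cj e'" by (simp add: cj_simps cj_mult)
        thus ?thesis using \<open>cj e' \<in> iz \<pi>\<close> by blast
      qed
      then obtain w e' where xw: "x = z * w + e'" "e' \<in> iz \<pi>" by blast
      have "x = zi (itr (z * (w * w0))) * z + 
         ((z * (w * w0) * z - zi (itr (z * (w * w0))) * z) + e' * (w0 * z) - y * (z * w0 * z - z) - e * (w0 * z) + e)"
      proof -
        have "(z * w + e') * (w0 * z) = (y * z + e) * (w0 * z)" using xy xw by simp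
        thus ?thesis unfolding xy(1) by (simp add: algebra_simps)
      qed
      moreover have "(z * (w * w0) * z - zi (itr (z * (w * w0))) * z) + e' * (w0 * z) - y * (z * w0 * z - z)
          - e * (w0 * z) + e \<in> iz \<pi>"
        by (intro sgrp_plus[OF sgrp_iz] sgrpD(2)[OF sgrp_iz] sand iz_mult_right iz_mult_left idem xy xw)
      ultimately show "x \<in> ssum Oz (iz \<pi>)" unfolding ssum_def Oz_def by blast
    qed
  qed
  hence "idx (RI d \<inter> B) (iz \<pi>) = idx Oz (Oz \<inter> iz \<pi>)" using idx_ssum[OF Oz sgrp_iz] by simp
  also have "Oz \<inter> iz \<pi> = (\<lambda>n. zi n * z) ` zideal \<pi>"
  proof
    show "Oz \<inter> iz \<pi> \<subseteq> (\<lambda>n. zi n * z) ` zideal \<pi>"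
    proof
      fix x assume "x \<in> Oz \<inter> iz \<pi>"
      then obtain n where n: "x = zi n * z" "zi n * z \<in> iz \<pi>" by (auto simp: Oz_def)
      have "\<pi> dvd n"
      proof (rule ccontr)
        assume "\<not> \<pi> dvd n"
        hence "coprime \<pi> n" using \<pi> prime_elem_imp_coprime by blast
        thus False using zi_mult_mem_iz n(2) z(1) by blast
      qed
      thus "x \<in> (\<lambda>n. zi n * z) ` zideal \<pi>" using n by (auto simp: zideal_iff)
    qed
    show "(\<lambda>n. zi n * z) ` zideal \<pi> \<subseteq> Oz \<inter> iz \<pi>"
      by (auto simp: Oz_def zi_simps mult.assoc)
  qed
  also have "idx Oz ((\<lambda>n. zi n * z) ` zideal \<pi>) = idx UNIV (zideal \<pi>)"
    unfolding Oz_def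
  proof (rule idx_image)
    have "z \<noteq> 0" using z(1) sgrpD(1)[OF sgrp_iz] by auto
    thus "inj (\<lambda>n. zi n * z)" by (auto simp: inj_def)
  qed (auto simp: sgrp_zideal zi_simps left_diff_distrib)
  finally show ?thesis using idx_zideal[OF \<pi>0] by (simp add: qn_def)
qed

text \<open>A right ideal d I of norm \<pi> has q^2 - 1 nonzero classes modulo \<pi>, collected in
  \<open>Q\<close>. Each lies in exactly one left ideal of norm \<pi>, and each such ideal contains
  q - 1 of them by \<open>idx_Int_prime\<close>.\<close>

lemma card_FI_prime:
  assumes \<pi>: "prime_elem \<pi>"
  shows "card (FI \<pi>) = qn \<pi> + 1"
proof -
  have \<pi>0: "\<pi> \<noteq> 0" using \<pi> by auto
  obtain d where d: "normalize (nr d) = normalize \<pi>" using prime_nr_exists[OF \<pi>] by blast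
  have d0: "d \<noteq> 0" using d \<pi>0 by auto
  define q where "q = qn \<pi>"
  have q: "q > 1" using \<pi> unfolding q_def by (intro qn_gt_1) auto
  define Q where "Q C = cosets C (iz \<pi>) - {iz \<pi>}" for C
  have sub: "iz \<pi> \<subseteq> RI d" using d by (intro iz_subset_RI) (metis associatedD1)
  have Qmem: "(+) x ` iz \<pi> \<in> Q C \<longleftrightarrow> (\<exists>y\<in>C. x - y \<in> iz \<pi>) \<and> x \<notin> iz \<pi>" for x C
  proof -
    have "(+) x ` iz \<pi> = iz \<pi> \<longleftrightarrow> x \<in> iz \<pi>" 
      using coset_eq_iff[OF sgrp_iz[of \<pi>], of x 0] by simp
    moreover have "(+) x ` iz \<pi> \<in> cosets C (iz \<pi>) \<longleftrightarrow> (\<exists>y\<in>C. (+) x ` iz \<pi> = (+) y ` iz \<pi>)"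
      unfolding cosets_def by blast
    ultimately show ?thesis unfolding Q_def by (simp only: coset_eq_iff[OF sgrp_iz] Diff_iff singleton_iff)
  qed
  have cardQ: "card (Q C) = idx C (iz \<pi>) - 1" "finite (Q C)" if "sgrp C" "finite (cosets C (iz \<pi>))" for C
  proof -
    have "(+) 0 ` iz \<pi> \<in> cosets C (iz \<pi>)"
      unfolding cosets_def using sgrpD(1)[OF that(1)] by (rule imageI)
    thus "card (Q C) = idx C (iz \<pi>) - 1" "finite (Q C)" using that(2) by (simp_all add: Q_def idx_def)
  qed
  have fin: "finite (cosets C (iz \<pi>))" for C
  proof -
    have "finite (cosets UNIV (iz \<pi>))" using idx_pos_iff[of UNIV "iz \<pi>"] idx_iz_qn[OF \<pi>0] \<pi>0 by simp
    thus ?thesis by (rule rev_finite_subset) (auto simp: cosets_def)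
  qed
  have "idx UNIV (iz \<pi>) = idx UNIV (RI d) * idx (RI d) (iz \<pi>)"
    by (rule idx_mult) (use sub in auto)
  hence "q ^ 4 = q\<^sup>2 * idx (RI d) (iz \<pi>)"
    using idx_iz_qn[OF \<pi>0] idx_RI_qn[OF d0] qn_cong[OF d] by (simp add: q_def)
  moreover have "q ^ 4 = q\<^sup>2 * q\<^sup>2" by (simp flip: power_add)
  ultimately have "q\<^sup>2 * q\<^sup>2 = q\<^sup>2 * idx (RI d) (iz \<pi>)" by metis
  moreover have "q\<^sup>2 \<noteq> 0" using q by simp
  ultimately have "idx (RI d) (iz \<pi>) = q\<^sup>2" by (metis mult_left_cancel)
  hence "q\<^sup>2 - 1 = card (Q (RI d))" using cardQ[OF _ fin] by simp
  also have "Q (RI d) = (\<Union>B\<in>FI \<pi>. Q (RI d \<inter> B))"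
  proof
    show "(\<Union>B\<in>FI \<pi>. Q (RI d \<inter> B)) \<subseteq> Q (RI d)" by (auto simp: Q_def cosets_def)
    show "Q (RI d) \<subseteq> (\<Union>B\<in>FI \<pi>. Q (RI d \<inter> B))"
    proof
      fix S assume S: "S \<in> Q (RI d)"
      then obtain x where x: "x \<in> RI d" "S = (+) x ` iz \<pi>" by (auto simp: Q_def cosets_def)
      have xn: "x \<notin> iz \<pi>" using S x Qmem by blast
      have "\<pi> dvd nr x" using x d by (auto simp: nr_mult dest: associatedD2)
      then obtain b where b: "ssum (LI x) (iz \<pi>) = LI b" "normalize (nr b) = normalize \<pi>"
        using prime_LI[OF \<pi> xn] by blast
      have "x \<in> LI b" using ssum_upper1[of "iz \<pi>" "LI x"] LI_mem[of x] b(1) by auto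
      moreover have "LI b \<in> FI \<pi>" using b(2) by (simp add: FI_LI)
      moreover have "x - x \<in> iz \<pi>" using sgrpD(1)[OF sgrp_iz] by simp
      ultimately show "S \<in> (\<Union>B\<in>FI \<pi>. Q (RI d \<inter> B))" using x xn Qmem by blast
    qed
  qed
  also have "card \<dots> = (\<Sum>B\<in>FI \<pi>. card (Q (RI d \<inter> B)))"
  proof (rule card_UN_disjoint)
    show "finite (FI \<pi>)" using finite_FI[OF \<pi>0] .
    show "\<forall>B\<in>FI \<pi>. finite (Q (RI d \<inter> B))" using fin by (auto simp: Q_def)
    show "\<forall>B\<in>FI \<pi>. \<forall>B'\<in>FI \<pi>. B \<noteq> B' \<longrightarrow> Q (RI d \<inter> B) \<inter> Q (RI d \<inter> B') = {}"
    proof (intro ballI impI, rule ccontr)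
      fix B B' assume B: "B \<in> FI \<pi>" "B' \<in> FI \<pi>" "B \<noteq> B'" and "Q (RI d \<inter> B) \<inter> Q (RI d \<inter> B') \<noteq> {}"
      then obtain S where S: "S \<in> Q (RI d \<inter> B)" "S \<in> Q (RI d \<inter> B')" by blast
      then obtain x where x: "S = (+) x ` iz \<pi>" "x \<in> B" by (auto simp: Q_def cosets_def)
      have xn: "x \<notin> iz \<pi>" and "\<exists>y\<in>B'. x - y \<in> iz \<pi>" using S(2) x(1) Qmem by auto
      then obtain y where "y \<in> B'" "x - y \<in> B'" using iz_subset_FI[OF B(2)] by blast
      moreover have "sgrp B'" using B(2) by (auto simp: FI_def)
      ultimately have "x \<in> B'" using sgrp_plus by fastforce
      thus False using FI_prime_unique[OF \<pi>] x xn B by metis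
    qed
  qed
  also have "\<dots> = (\<Sum>B\<in>FI \<pi>. q - 1)"
  proof (rule sum.cong[OF refl])
    fix B assume B: "B \<in> FI \<pi>"
    have "sgrp (RI d \<inter> B)" using B by (auto simp: FI_def sgrp_Int)
    thus "card (Q (RI d \<inter> B)) = q - 1" using cardQ[OF _ fin] idx_Int_prime[OF \<pi> B d] by (simp add: q_def)
  qed
  finally have "q\<^sup>2 - 1 = card (FI \<pi>) * (q - 1)" by simp
  moreover have "q\<^sup>2 - 1 = (q + 1) * (q - 1)" by (simp add: power2_eq_square algebra_simps)
  ultimately have "card (FI \<pi>) * (q - 1) = (q + 1) * (q - 1)" by (simp only:)
  thus ?thesis using q by (simp only: mult_cancel2 q_def) simp
qed

subsection \<open>Counting ideals of given norm\<close>

definition zdivs :: "zt \<Rightarrow> zt set" where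
  "zdivs n = {d. d dvd n \<and> normalize d = d}"

definition zsigma :: "zt \<Rightarrow> nat" where
  "zsigma n = (\<Sum>d\<in>zdivs n. qn d)"

text \<open>As there are infinitely many units, finiteness is read off from the subgroups above
  \<open>zideal n\<close>, into which normalised divisors inject.\<close>

lemma finite_zdivs: "n \<noteq> 0 \<Longrightarrow> finite (zdivs n)"
proof -
  assume n: "n \<noteq> 0"
  have "inj_on zideal (zdivs n)"
  proof (rule inj_onI)
    fix x y assume "x \<in> zdivs n" "y \<in> zdivs n" and eq: "zideal x = zideal y"
    moreover have "x dvd y" "y dvd x" using eq zideal_iff by (metis dvd_refl)+
    ultimately show "x = y" unfolding zdivs_def by (metis (mono_tags) associatedI mem_Collect_eq)
  qed
  moreover have "zideal ` zdivs n \<subseteq> {J. sgrp J \<and> zideal n \<subseteq> J \<and> J \<subseteq> UNIV}"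
    by (auto simp: sgrp_zideal zdivs_def) (metis dvd_def dvd_mult2 zideal_iff)
  moreover have "finite {J. sgrp J \<and> zideal n \<subseteq> J \<and> J \<subseteq> UNIV}"
    by (rule finite_subgroups_above) (use n in \<open>auto simp: sgrp_zideal idx_zideal\<close>)
  ultimately show ?thesis using inj_on_finite by blast
qed

lemma zdivs_cong: "normalize m = normalize n \<Longrightarrow> zdivs m = zdivs n"
  unfolding zdivs_def by (metis associatedD1 associatedD2 dvd_trans)

text \<open>Splitting divisors according to divisibility by \<pi> gives sigma(\<pi> m) = q sigma(m)
  + s0(m), where s0, the sum over divisors outside (\<pi>), does not change when m is multiplied by
  \<pi>. Eliminating s0 yields the recursion.\<close>

lemma zsigma_prime_mult:
  assumes \<pi>: "prime \<pi>" and n: "n \<noteq> 0"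
  shows "zsigma (\<pi> * n) + (if \<pi> dvd n then qn \<pi> * zsigma (n div \<pi>) else 0) = (qn \<pi> + 1) * zsigma n"
proof -
  have \<pi>0: "\<pi> \<noteq> 0" "normalize \<pi> = \<pi>" "prime_elem \<pi>" using \<pi> by (auto simp: prime_def)
  define s0 where "s0 m = (\<Sum>d\<in>{d\<in>zdivs m. \<not> \<pi> dvd d}. qn d)" for m
  have split: "zsigma (\<pi> * m) = qn \<pi> * zsigma m + s0 (\<pi> * m)" if "m \<noteq> 0" for m
  proof -
    have "inj_on (\<lambda>d. normalize (\<pi> * d)) (zdivs m)"
    proof (rule inj_onI)
      fix x y assume xy: "x \<in> zdivs m" "y \<in> zdivs m" and "normalize (\<pi> * x) = normalize (\<pi> * y)"
      hence "\<pi> * x dvd \<pi> * y" "\<pi> * y dvd \<pi> * x" using associatedD1 associatedD2 by blast+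
      hence "x dvd y" "y dvd x" using \<pi>0 by auto
      thus "x = y" using xy unfolding zdivs_def by (metis (mono_tags) associatedI mem_Collect_eq)
    qed
    moreover have "(\<lambda>d. normalize (\<pi> * d)) ` zdivs m = {d\<in>zdivs (\<pi> * m). \<pi> dvd d}"
    proof
      show "{d\<in>zdivs (\<pi> * m). \<pi> dvd d} \<subseteq> (\<lambda>d. normalize (\<pi> * d)) ` zdivs m"
      proof
        fix d assume "d \<in> {d\<in>zdivs (\<pi> * m). \<pi> dvd d}"
        hence d: "\<pi> dvd d" "d dvd \<pi> * m" "normalize d = d" by (auto simp: zdivs_def)
        from d(1) obtain e where "d = \<pi> * e" by blast
        note e = this d(2,3)
        hence "e dvd m" using \<pi>0 by simp
        hence "normalize e \<in> zdivs m" by (simp add: zdivs_def)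
        moreover have "normalize (\<pi> * normalize e) = d" using e by simp
        ultimately show "d \<in> (\<lambda>d. normalize (\<pi> * d)) ` zdivs m" by (metis imageI)
      qed
    qed (auto simp: zdivs_def)
    ultimately have "(\<Sum>d\<in>{d\<in>zdivs (\<pi> * m). \<pi> dvd d}. qn d) = (\<Sum>d\<in>zdivs m. qn (normalize (\<pi> * d)))"
      using sum.reindex[of "\<lambda>d. normalize (\<pi> * d)" "zdivs m" qn] by simp
    also have "\<dots> = qn \<pi> * zsigma m"
      by (simp add: qn_mult zsigma_def sum_distrib_left)
    finally have 1: "(\<Sum>d\<in>{d\<in>zdivs (\<pi> * m). \<pi> dvd d}. qn d) = qn \<pi> * zsigma m" .
    have "zsigma (\<pi> * m) = (\<Sum>d\<in>{d\<in>zdivs (\<pi> * m). \<pi> dvd d}. qn d) + s0 (\<pi> * m)"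
      unfolding zsigma_def s0_def
      by (subst sum.union_disjoint[symmetric])
        (use finite_zdivs[of "\<pi> * m"] that \<pi>0 in \<open>auto intro!: sum.cong\<close>)
    thus ?thesis using 1 by simp
  qed
  have s0: "s0 (\<pi> * m) = s0 m" for m
  proof -
    have "d dvd m" if "\<not> \<pi> dvd d" "d dvd \<pi> * m" for d
    proof -
      have "coprime d \<pi>" using that(1) \<pi>0(3) prime_elem_imp_coprime coprime_commute by blast
      thus ?thesis using that(2) by (simp add: coprime_dvd_mult_right_iff)
    qed
    hence "{d\<in>zdivs (\<pi> * m). \<not> \<pi> dvd d} = {d\<in>zdivs m. \<not> \<pi> dvd d}"
      by (auto simp: zdivs_def)
    thus ?thesis by (simp add: s0_def)
  qed
  show ?thesis
  proof (cases "\<pi> dvd n")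
    case True
    then obtain m where m: "n = \<pi> * m" by blast
    have "zsigma n = qn \<pi> * zsigma m + s0 n" using split[of m] n by (simp add: m s0)
    thus ?thesis using split[OF n] True \<pi>0 by (simp add: m s0)
  next
    case False
    hence "{d \<in> zdivs n. \<not> \<pi> dvd d} = zdivs n" by (auto simp: zdivs_def dest: dvd_trans)
    hence "zsigma n = s0 n" by (simp add: zsigma_def s0_def)
    thus ?thesis using split[OF n] False by (simp add: s0)
  qed
qed

lemma LI_mult_image: "LI (a * b) = (\<lambda>x. x * b) ` LI a"
  by (simp add: image_image mult.assoc)

text \<open>Right multiplication by b carries I a to I a b and is a bijection onto the ideals inside
  I b.\<close>

lemma card_FI_below:
  assumes "b \<noteq> 0"
  shows "card {J \<in> FI (nr b * n). J \<subseteq> LI b} = card (FI n)"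
proof -
  have "inj (\<lambda>x. x * b)" using assms by (auto simp: inj_def)
  hence "inj_on ((`) (\<lambda>x. x * b)) (FI n)" by (auto simp: inj_on_def inj_image_eq_iff)
  moreover have "(`) (\<lambda>x. x * b) ` FI n = {J \<in> FI (nr b * n). J \<subseteq> LI b}"
  proof (intro equalityI subsetI)
    fix J assume "J \<in> (`) (\<lambda>x. x * b) ` FI n"
    then obtain a where a: "J = LI (a * b)" "normalize (nr a) = normalize n"
      unfolding FI_def LI_mult_image by blast
    have "normalize (nr (a * b)) = normalize (nr b * n)"
      using a(2) by (metis mult.commute normalize_mult_normalize_right nr_mult)
    thus "J \<in> {J \<in> FI (nr b * n). J \<subseteq> LI b}" using a(1) by (auto simp: FI_LI LI_subset_iff)
  next
    fix J assume J: "J \<in> {J \<in> FI (nr b * n). J \<subseteq> LI b}"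
    then obtain a where a: "J = LI a" "normalize (nr a) = normalize (nr b * n)" by (auto simp: FI_def)
    then obtain c where c: "a = c * b" using J by (auto simp: LI_subset_iff)
    have "nr b * nr c dvd nr b * n" "nr b * n dvd nr b * nr c"
      using a(2) c associatedD1 associatedD2 by (metis mult.commute nr_mult)+
    hence "normalize (nr c) = normalize n" using assms by (intro associatedI) auto
    thus "J \<in> (`) (\<lambda>x. x * b) ` FI n" unfolding a(1) c LI_mult_image by (intro imageI) (simp add: FI_LI)
  qed
  ultimately show ?thesis using card_image by metis
qed

text \<open>\<open>zi \<pi>\<close> has norm \<pi>^2, so \<open>card_FI_below\<close> applies when
  \<pi> divides n; otherwise \<pi>^2 does not divide \<pi> n and no ideal fits.\<close>

lemma FI_below_iz:
  assumes "prime_elem \<pi>" "n \<noteq> 0"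
  shows "card {J \<in> FI (\<pi> * n). J \<subseteq> iz \<pi>} = (if \<pi> dvd n then card (FI (n div \<pi>)) else 0)"
proof (cases "\<pi> dvd n")
  case True
  then obtain m where m: "n = \<pi> * m" by blast
  have \<pi>0: "\<pi> \<noteq> 0" using assms(1) by auto
  have "{J \<in> FI (\<pi> * n). J \<subseteq> iz \<pi>} = {J \<in> FI (nr (zi \<pi>) * m). J \<subseteq> LI (zi \<pi>)}"
    by (simp only: LI_zi m nr_zi power2_eq_square mult.assoc)
  thus ?thesis using card_FI_below[of "zi \<pi>" m] True m \<pi>0 by simp
next
  case False
  have "\<not> J \<subseteq> iz \<pi>" if "J \<in> FI (\<pi> * n)" for J
  proof
    assume "J \<subseteq> iz \<pi>"
    obtain a where a: "J = LI a" "normalize (nr a) = normalize (\<pi> * n)" using \<open>J \<in> FI (\<pi> * n)\<close> by (auto simp: FI_def)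
    have "a \<in> iz \<pi>" using \<open>J \<subseteq> iz \<pi>\<close> a(1) LI_mem by blast
    hence "\<pi> * \<pi> dvd \<pi> * n" using iz_nr_square a(2) by (metis associatedD1 dvd_trans power2_eq_square)
    moreover have "\<pi> \<noteq> 0" using assms(1) by auto
    ultimately show False using False by simp
  qed
  thus ?thesis using False by (metis (mono_tags, lifting) Collect_empty_eq card.empty)
qed

text \<open>Each of the q + 1 ideals B contains f(n) ideals J. Conversely J = I a lies in all q + 1
  of them if J is inside \<pi> I, and otherwise only in I a + \<pi> I.\<close>

lemma card_FI_recursion:
  assumes \<pi>: "prime \<pi>" and n: "n \<noteq> 0"
  shows "card (FI (\<pi> * n)) + (if \<pi> dvd n then qn \<pi> * card (FI (n div \<pi>)) else 0) = (qn \<pi> + 1) * card (FI n)"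
proof -
  have p: "prime_elem \<pi>" "\<pi> \<noteq> 0" using \<pi> by auto
  have fin: "finite (FI \<pi>)" "finite (FI (\<pi> * n))" using p n by (auto intro: finite_FI)
  define g where "g = card {J \<in> FI (\<pi> * n). J \<subseteq> iz \<pi>}"
  have "(\<Sum>B\<in>FI \<pi>. card {J \<in> FI (\<pi> * n). J \<subseteq> B}) = (\<Sum>J\<in>FI (\<pi> * n). card {B \<in> FI \<pi>. J \<subseteq> B})"
    using sum.swap[of "\<lambda>B J. if J \<subseteq> B then 1 else 0 :: nat" "FI (\<pi> * n)" "FI \<pi>"] fin
    by (simp add: sum.If_cases Int_def)
  also have "(\<Sum>B\<in>FI \<pi>. card {J \<in> FI (\<pi> * n). J \<subseteq> B}) = (\<Sum>B\<in>FI \<pi>. card (FI n))"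
  proof (rule sum.cong[OF refl])
    fix B assume "B \<in> FI \<pi>"
    then obtain b where b: "B = LI b" "b \<noteq> 0" "normalize (nr b) = normalize \<pi>"
      using FI_prime_psubset[OF p(1)] by blast
    have "normalize (nr b * n) = normalize (\<pi> * n)" using b(3) by (metis normalize_mult_normalize_left)
    thus "card {J \<in> FI (\<pi> * n). J \<subseteq> B} = card (FI n)"
      using card_FI_below[OF b(2), of n] FI_cong b(1) by metis
  qed
  also have "(\<Sum>J\<in>FI (\<pi> * n). card {B \<in> FI \<pi>. J \<subseteq> B})
     = (\<Sum>J\<in>FI (\<pi> * n). if J \<subseteq> iz \<pi> then qn \<pi> + 1 else 1)"
  proof (rule sum.cong[OF refl])
    fix J assume J: "J \<in> FI (\<pi> * n)"
    then obtain a where a: "J = LI a" "normalize (nr a) = normalize (\<pi> * n)" by (auto simp: FI_def)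
    show "card {B \<in> FI \<pi>. J \<subseteq> B} = (if J \<subseteq> iz \<pi> then qn \<pi> + 1 else 1)"
    proof (cases "J \<subseteq> iz \<pi>")
      case True
      hence "{B \<in> FI \<pi>. J \<subseteq> B} = FI \<pi>" using iz_subset_FI by blast
      thus ?thesis using True card_FI_prime[OF p(1)] by simp
    next
      case False
      hence an: "a \<notin> iz \<pi>" using a(1) LI_subset_lid[OF lid_iz] by blast
      have "\<pi> dvd nr a" using a(2) by (metis associatedD2 dvd_trans dvd_triv_left)
      then obtain b where b: "ssum (LI a) (iz \<pi>) = LI b" "normalize (nr b) = normalize \<pi>"
        using prime_LI[OF p(1) an] by blast
      have "{B \<in> FI \<pi>. J \<subseteq> B} = {LI b}"
      proof (intro equalityI subsetI)
        fix B assume "B \<in> {B \<in> FI \<pi>. J \<subseteq> B}"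
        thus "B \<in> {LI b}" using FI_prime_unique[OF p(1) _ _ an, of B] a(1) b(1) LI_mem[of a] by auto
      next
        fix B assume "B \<in> {LI b}"
        thus "B \<in> {B \<in> FI \<pi>. J \<subseteq> B}"
          using b ssum_upper1[OF sgrp_iz, of "LI a" \<pi>] a(1) FI_LI[of b \<pi>] by simp
      qed
      thus ?thesis using False by simp
    qed
  qed
  also have "\<dots> = (\<Sum>J\<in>FI (\<pi> * n). 1 + (if J \<subseteq> iz \<pi> then qn \<pi> else 0))"
    by (intro sum.cong) auto
  also have "\<dots> = (\<Sum>J\<in>FI (\<pi> * n). 1) + (\<Sum>J\<in>FI (\<pi> * n). if J \<subseteq> iz \<pi> then qn \<pi> else 0)"
    by (rule sum.distrib)
  also have "\<dots> = card (FI (\<pi> * n)) + qn \<pi> * g"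
    using fin by (simp add: sum.If_cases Int_def g_def)
  finally have "card (FI \<pi>) * card (FI n) = card (FI (\<pi> * n)) + qn \<pi> * g" by simp
  thus ?thesis using card_FI_prime[OF p(1)] FI_below_iz[OF p(1) n] by (simp add: g_def split: if_splits)
qed

theorem card_FI:
  assumes "n \<noteq> 0"
  shows "card (FI n) = zsigma n"
  using assms
proof (induction "euclidean_size n" arbitrary: n rule: less_induct)
  case less
  show ?case
  proof (cases "n dvd 1")
    case True
    hence n1: "normalize n = normalize 1" by (simp add: is_unit_normalize)
    have "FI 1 = {UNIV}"
    proof (intro equalityI subsetI)
      fix J assume "J \<in> FI 1"
      then obtain a where "J = LI a" "nr a dvd 1" by (auto simp: FI_def normalize_1_iff)
      thus "J \<in> {UNIV}" using LI_unit[of a 1] by simp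
    next
      fix J :: "ico set" assume "J \<in> {UNIV}"
      hence "J = LI 1" by simp
      thus "J \<in> FI 1" by (simp only: FI_LI) simp
    qed
    moreover have "zdivs 1 = {1}"
    proof (intro equalityI subsetI)
      fix d assume "d \<in> zdivs 1"
      thus "d \<in> {1}" using is_unit_normalize[of d] by (simp add: zdivs_def)
    qed (simp add: zdivs_def)
    ultimately show ?thesis using FI_cong[OF n1] zdivs_cong[OF n1] by (simp add: zsigma_def)
  next
    case False
    then obtain \<pi> where \<pi>: "prime \<pi>" "\<pi> dvd n" using prime_divisor_exists less.prems by blast
    then obtain m where m: "n = \<pi> * m" by blast
    have \<pi>1: "\<pi> \<noteq> 0" "\<not> \<pi> dvd 1" using \<pi>(1) by auto
    have m0: "m \<noteq> 0" using m less.prems by auto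
    have sm: "euclidean_size m < euclidean_size n"
      unfolding m using euclidean_size_times_nonunit[OF \<pi>1(1) m0 \<pi>1(2)] .
    have 1: "card (FI m) = zsigma m" using less.hyps[OF sm m0] .
    have 2: "card (FI (m div \<pi>)) = zsigma (m div \<pi>)" if "\<pi> dvd m"
    proof -
      obtain k where k: "m = \<pi> * k" using \<open>\<pi> dvd m\<close> by blast
      have "k \<noteq> 0" using k m0 by auto
      hence "euclidean_size k < euclidean_size m"
        unfolding k using euclidean_size_times_nonunit[OF \<pi>1(1) _ \<pi>1(2)] by blast
      thus ?thesis using less.hyps[of k] sm \<open>k \<noteq> 0\<close> k \<pi>1 by simp
    qed
    have "card (FI n) + (if \<pi> dvd m then qn \<pi> * card (FI (m div \<pi>)) else 0) = 
      zsigma n + (if \<pi> dvd m then qn \<pi> * zsigma (m div \<pi>) else 0)"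
      unfolding m using card_FI_recursion[OF \<pi>(1) m0] zsigma_prime_mult[OF \<pi>(1) m0] 1 by simp
    thus ?thesis using 2 by (auto split: if_splits)
  qed
qed

text \<open>The divisor 1 makes sigma(n) positive, so the count itself produces an ideal of norm n.
  This is why every square of a nonzero norm occurs as an index.\<close>

corollary nr_surj_assoc: "\<exists>a. normalize (nr a) = normalize n"
proof (cases "n = 0")
  case True
  thus ?thesis by (metis nr_simps(1))
next
  case False
  have "1 \<in> zdivs n" by (simp add: zdivs_def)
  hence "qn 1 \<le> zsigma n" unfolding zsigma_def
    using finite_zdivs[OF False] by (intro member_le_sum) auto
  hence "FI n \<noteq> {}" using card_FI[OF False] by auto
  thus ?thesis by (auto simp: FI_def)
qed

section \<open>Primitive ideals and similarity submodules\<close>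

lemma zideal_principal:
  assumes "sgrp T" "\<And>t r. t \<in> T \<Longrightarrow> r * t \<in> T"
  shows "\<exists>t. T = zideal t"
proof (cases "T = {0}")
  case True
  hence "T = zideal 0" by auto
  thus ?thesis by blast
next
  case False
  then obtain b where "b \<in> T - {0}" using sgrpD(1)[OF assms(1)] by blast
  then obtain a where a: "a \<in> T - {0}"
      and min: "\<And>x. x \<in> T - {0} \<Longrightarrow> euclidean_size a \<le> euclidean_size x"
    using ex_has_least_nat[of "\<lambda>x. x \<in> T - {0}" b euclidean_size] by blast
  have "x \<in> zideal a" if x: "x \<in> T" for x
  proof -
    have "x - x div a * a \<in> T" using x a assms by (auto intro!: sgrpD(2))
    hence "x mod a \<in> T" by (simp add: minus_div_mult_eq_mod)
    moreover have "euclidean_size (x mod a) < euclidean_size a" using a by (intro mod_size_less) auto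
    ultimately have "x mod a = 0" using min[of "x mod a"] by fastforce
    thus ?thesis by (auto simp: zideal_iff)
  qed
  moreover have "zideal a \<subseteq> T" using a assms(2)[of a] by (auto simp: mult.commute)
  ultimately show ?thesis by blast
qed

text \<open>The case n = 0 is included and excludes {0}.\<close>

definition primset :: "ico set \<Rightarrow> bool" where
  "primset J \<longleftrightarrow> (\<forall>n. J \<subseteq> iz n \<longrightarrow> n dvd 1)"

definition PL :: "ico set set" where
  "PL = {J. lid J \<and> primset J}"

definition LL :: "ico set set" where
  "LL = {J. lid J \<and> J \<noteq> {0}}"

text \<open>One generator for each nonzero ideal of Z[\<tau>].\<close>

definition ZA :: "zt set" where
  "ZA = {n. n \<noteq> 0 \<and> normalize n = n}"

lemma primset_LI: "primset (LI a) \<longleftrightarrow> (\<forall>n. a \<in> iz n \<longrightarrow> n dvd 1)"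
proof -
  have "LI a \<subseteq> iz n \<longleftrightarrow> a \<in> iz n" for n
    using LI_subset_lid[OF lid_iz] LI_mem[of a] by blast
  thus ?thesis by (simp add: primset_def)
qed

lemma primset_LI_nonzero: "primset (LI a) \<Longrightarrow> a \<noteq> 0"
proof
  assume "primset (LI a)" "a = 0"
  moreover have "0 \<in> iz 0" by (rule sgrpD(1)[OF sgrp_iz])
  ultimately have "(0::zt) dvd 1" unfolding primset_LI by blast
  thus False by simp
qed

lemma PL_generator:
  assumes "P \<in> PL"
  shows "\<exists>a. P = LI a \<and> primset (LI a) \<and> a \<noteq> 0"
proof -
  have "lid P" "primset P" using assms by (auto simp: PL_def)
  moreover obtain a where "P = LI a" using lid_principal[OF \<open>lid P\<close>] by blast
  ultimately show ?thesis using primset_LI_nonzero by metis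
qed

lemma content_decomposition:
  assumes "a \<noteq> 0"
  obtains n b where "n \<in> ZA" "a = zi n * b" "primset (LI b)"
proof -
  define g where "g = gcd (gcd (ca a) (cb a)) (gcd (cc a) (cd a))"
  have g0: "g \<noteq> 0" using assms by (auto simp: g_def ico_eq_iff)
  have "a \<in> iz g" by (auto simp: iz_iff g_def intro: dvd_trans[OF gcd_dvd1] dvd_trans[OF gcd_dvd2])
  then obtain b where b: "a = zi g * b" by blast
  have "n dvd 1" if "b \<in> iz n" for n
  proof -
    obtain c where "b = zi n * c" using \<open>b \<in> iz n\<close> by blast
    hence "a = zi (g * n) * c" using b by (simp add: zi_simps mult.assoc)
    hence "a \<in> iz (g * n)" by blast
    hence "g * n dvd gcd (gcd (ca a) (cb a)) (gcd (cc a) (cd a))"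
      unfolding iz_iff by (intro gcd_greatest) simp_all
    hence "g * n dvd g * 1" by (simp add: g_def)
    thus "n dvd 1" using g0 by (simp only: dvd_mult_cancel_left) simp
  qed
  hence "primset (LI b)" by (simp add: primset_LI)
  moreover have "g \<in> ZA" using g0 by (simp add: ZA_def g_def)
  ultimately show ?thesis using that b by blast
qed

abbreviation zscale :: "zt \<Rightarrow> ico set \<Rightarrow> ico set" where
  "zscale n P \<equiv> (*) (zi n) ` P"

lemma zscale_LI: "zscale n (LI a) = LI (zi n * a)"
  by (simp add: image_image zi_left_commute)

text \<open>After cancelling gcd m n the two numbers are coprime, and P itself lies in the remaining
  n' I; primitivity makes n' a unit. This recovers the scalar from the scaled ideal.\<close>

lemma zscale_subset_iz:
  assumes "primset P" "n \<noteq> 0"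
  shows "zscale m P \<subseteq> iz n \<longleftrightarrow> n dvd m"
proof
  assume *: "zscale m P \<subseteq> iz n"
  define g where "g = gcd m n"
  have g0: "g \<noteq> 0" using assms(2) by (simp add: g_def)
  then obtain m' n' where mn: "m = g * m'" "n = g * n'" "coprime m' n'"
    using gcd_coprime_exists[of m n] unfolding g_def by (metis mult.commute)
  hence cop: "coprime n' m'" by (simp add: coprime_commute)
  have "P \<subseteq> iz n'"
  proof
    fix x assume "x \<in> P"
    then obtain y where "zi m * x = zi n * y" using * by blast
    hence "zi g * (zi m' * x) = zi g * (zi n' * y)" by (simp add: mn zi_simps mult.assoc)
    hence "zi m' * x = zi n' * y" using g0 by simp
    thus "x \<in> iz n'" using zi_mult_mem_iz[OF cop] by blast
  qed
  hence "n' dvd 1" using assms(1) by (auto simp: primset_def)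
  thus "n dvd m" using mn by (metis dvd_mult_unit_iff dvd_triv_left dvd_mult_left mult_dvd_mono one_dvd dvd_trans dvd_refl)
next
  assume "n dvd m"
  thus "zscale m P \<subseteq> iz n" by (auto simp: zi_simps mult.assoc elim!: dvdE)
qed

lemma ZA_dvd_antisym: "m \<in> ZA \<Longrightarrow> n \<in> ZA \<Longrightarrow> m dvd n \<Longrightarrow> n dvd m \<Longrightarrow> m = n"
  unfolding ZA_def by (metis (mono_tags, lifting) associatedI mem_Collect_eq)

lemma bij_LL: "bij_betw (\<lambda>(n, P). zscale n P) (ZA \<times> PL) LL"
proof (rule bij_betw_imageI)
  show "inj_on (\<lambda>(n, P). zscale n P) (ZA \<times> PL)"
  proof (rule inj_onI, clarify)
    fix m P n Q assume *: "m \<in> ZA" "n \<in> ZA" "P \<in> PL" "Q \<in> PL" and eq: "zscale m P = zscale n Q"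
    have "primset P" "primset Q" "m \<noteq> 0" "n \<noteq> 0" using * by (auto simp: PL_def ZA_def)
    hence "n dvd m" "m dvd n" using zscale_subset_iz eq by (metis dvd_refl)+
    hence "m = n" using * ZA_dvd_antisym by blast
    moreover have "inj ((*) (zi n))" using \<open>n \<noteq> 0\<close> by (auto simp: inj_def)
    ultimately show "m = n \<and> P = Q" using eq by (simp add: inj_image_eq_iff)
  qed
  show "(\<lambda>(n, P). zscale n P) ` (ZA \<times> PL) = LL"
  proof (intro equalityI subsetI)
    fix J assume "J \<in> (\<lambda>(n, P). zscale n P) ` (ZA \<times> PL)"
    then obtain n P where nP: "n \<in> ZA" "P \<in> PL" "J = zscale n P" by auto
    then obtain a where "P = LI a" "a \<noteq> 0" using PL_generator[OF nP(2)] by metis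
    hence "J = LI (zi n * a)" "zi n * a \<noteq> 0" using nP by (auto simp: zscale_LI ZA_def)
    moreover have "zi n * a \<in> LI (zi n * a)" by (rule LI_mem)
    ultimately show "J \<in> LL" unfolding LL_def by (metis (mono_tags) lid_LI mem_Collect_eq singletonD)
  next
    fix J assume "J \<in> LL"
    then obtain a where a: "J = LI a" "a \<noteq> 0" unfolding LL_def using lid_principal by force
    then obtain n b where "n \<in> ZA" "a = zi n * b" "primset (LI b)" using content_decomposition by blast
    thus "J \<in> (\<lambda>(n, P). zscale n P) ` (ZA \<times> PL)"
      using a zscale_LI by (intro image_eqI[of _ _ "(n, LI b)"]) (auto simp: PL_def)
  qed
qed

lemma idx_PL:
  assumes "P \<in> PL" "n \<in> ZA"
  shows "idx UNIV (zscale n P) = qn n ^ 4 * idx UNIV P"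
proof -
  obtain a where a: "P = LI a" "a \<noteq> 0" using PL_generator[OF assms(1)] by metis
  have "n \<noteq> 0" using assms by (auto simp: ZA_def)
  hence "idx UNIV (zscale n P) = (qn (n\<^sup>2 * nr a))\<^sup>2"
    using a idx_LI_qn[of "zi n * a"] by (simp add: zscale_LI nr_mult)
  thus ?thesis using a idx_LI_qn[of a]
    by (simp add: qn_mult power_mult_distrib power2_eq_square eval_nat_numeral)
qed

section \<open>Normal form n cj(p) I q of the similarity submodules\<close>

definition SMod :: "zt \<Rightarrow> ico set \<Rightarrow> ico set \<Rightarrow> ico set" where
  "SMod n P Q = {zi n * (cj y * z) | y z. y \<in> P \<and> z \<in> Q}"

definition SS :: "ico set set" where
  "SS = (\<lambda>(n, P, Q). SMod n P Q) ` (ZA \<times> PL \<times> PL)"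

text \<open>Conjugation turns I p into the right ideal cj(p) I, so both factors range over the same
  set \<open>PL\<close>. Single products suffice in \<open>SMod\<close> because both ideals are
  principal.\<close>

lemma SMod_LI: "SMod n (LI p) (LI q) = range (\<lambda>x. zi n * (cj p * x * q))"
proof (intro equalityI subsetI)
  fix x assume "x \<in> SMod n (LI p) (LI q)"
  then obtain y z where "x = zi n * (cj (y * p) * (z * q))" by (auto simp: SMod_def)
  hence "x = zi n * (cj p * (cj y * z) * q)" by (simp add: cj_mult mult.assoc)
  thus "x \<in> range (\<lambda>x. zi n * (cj p * x * q))" by blast
next
  fix x assume "x \<in> range (\<lambda>x. zi n * (cj p * x * q))"
  then obtain y where "x = zi n * (cj (1 * p) * (y * q))" by (auto simp: mult.assoc)
  thus "x \<in> SMod n (LI p) (LI q)" unfolding SMod_def by blast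
qed

lemma SMod_cong: "normalize m = normalize n \<Longrightarrow> SMod m (LI p) (LI q) \<subseteq> SMod n (LI p) (LI q)"
proof -
  assume "normalize m = normalize n"
  then obtain u where u: "m = n * u" by (metis associatedE2 mult.commute)
  have "zi m * (cj p * x * q) = zi n * (cj p * (zi u * x) * q)" for x
    unfolding u zi_simps mult.assoc by (simp only: zi_left_commute[of _ u] mult.assoc)
  thus ?thesis unfolding SMod_LI by blast
qed

text \<open>By \<open>iz_prime\<close>, a prime dividing the whole product would already divide
  \<open>cj p\<close> or q.\<close>

lemma primset_product:
  assumes p: "primset (LI p)" and q: "primset (LI q)"
  shows "primset (range (\<lambda>x. cj p * x * q))"
  unfolding primset_def
proof (intro allI impI, rule ccontr)
  fix n assume sub: "range (\<lambda>x. cj p * x * q) \<subseteq> iz n" and n: "\<not> n dvd 1"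
  have "n \<noteq> 0"
  proof
    assume "n = 0"
    have "cj p * 1 * q \<in> iz n" using sub by blast
    thus False using primset_LI_nonzero[OF p] primset_LI_nonzero[OF q] \<open>n = 0\<close> by (auto simp: zi_simps)
  qed
  then obtain \<pi> where \<pi>: "prime \<pi>" "\<pi> dvd n" using n prime_divisor_exists by blast
  have pe: "prime_elem \<pi>" using \<pi> by auto
  have "cj p * x * q \<in> iz \<pi>" for x
  proof -
    have "cj p * x * q \<in> iz n" using sub by blast
    thus ?thesis using \<pi>(2) unfolding iz_iff by (meson dvd_trans)
  qed
  hence "cj p \<in> iz \<pi> \<or> q \<in> iz \<pi>" using iz_prime[OF pe] by blast
  hence "\<pi> dvd 1" using p q unfolding cj_mem_iz primset_LI by blast
  thus False using pe by auto
qed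

lemma prim_mult_subset_iz:
  assumes "primset (LI p)" "primset (LI q)" "n \<noteq> 0" "range (\<lambda>x. zi m * (cj p * x * q)) \<subseteq> iz n"
  shows "n dvd m"
  using zscale_subset_iz[OF primset_product[OF assms(1,2)] assms(3)] assms(4)
  by (simp add: image_image)

text \<open>The left ideal generated by \<open>p\<I>q\<close> is \<open>\<I>q\<close>, because the traces \<open>tr (p y)\<close> lie in the
  two-sided ideal generated by \<open>p\<close> and have no common divisor.\<close>

lemma prim_generates_left:
  assumes p: "primset (LI p)" and J: "lid J" "\<And>x. cj p * x * q \<in> J"
  shows "LI q \<subseteq> J"
proof -
  define T where "T = {t. zi t * q \<in> J}"
  have "sgrp T" unfolding sgrp_def T_def
    using sgrpD[OF lidD(1)[OF J(1)]] by (auto simp: zi_simps left_diff_distrib)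
  moreover have "r * t \<in> T" if "t \<in> T" for t r
    using that lidD(2)[OF J(1), of "zi t * q" "zi r"] by (simp add: T_def zi_simps mult.assoc)
  ultimately obtain t where t: "T = zideal t" using zideal_principal by blast
  have "itr (cj p * y) \<in> T" for y
  proof -
    have "(\<Sum>k<4. ibasis ! k * (cj p * (y * idual ! k) * q)) \<in> J"
      by (intro sgrp_sum[OF lidD(1)[OF J(1)]] lidD(2)[OF J(1)] J(2))
    also have "(\<Sum>k<4. ibasis ! k * (cj p * (y * idual ! k) * q)) = (\<Sum>k<4. ibasis ! k * (cj p * y) * idual ! k) * q"
      by (simp only: sum_distrib_right mult.assoc)
    finally show ?thesis by (simp only: T_def idual_trace mem_Collect_eq)
  qed
  hence "cj p \<in> iz t" by (intro dvd_itr_imp_iz) (simp add: t zideal_iff)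
  hence "t dvd 1" using p unfolding cj_mem_iz primset_LI by blast
  hence "1 \<in> T" by (simp add: t zideal_iff)
  hence "q \<in> J" by (simp add: T_def zi_simps)
  thus ?thesis by (rule LI_subset_lid[OF J(1)])
qed

lemma prim_product_determines:
  assumes "primset (LI p)" "primset (LI p')"
    and eq: "range (\<lambda>x. cj p * x * q) = range (\<lambda>x. cj p' * x * q')"
  shows "LI q = LI q'"
proof -
  have "cj p * x * q \<in> LI q'" for x
  proof -
    have "cj p * x * q \<in> range (\<lambda>x. cj p' * x * q')" using eq by blast
    thus ?thesis by blast
  qed
  moreover have "cj p' * x * q' \<in> LI q" for x
  proof -
    have "cj p' * x * q' \<in> range (\<lambda>x. cj p * x * q)" using eq by blast
    thus ?thesis by blast
  qed
  ultimately show ?thesis using prim_generates_left[OF assms(1) lid_LI] prim_generates_left[OF assms(2) lid_LI]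
    by blast
qed

lemma cj_image_range: "cj ` range (\<lambda>x. cj p * x * q) = range (\<lambda>x. cj q * x * p)"
proof (intro equalityI subsetI)
  fix y assume "y \<in> cj ` range (\<lambda>x. cj p * x * q)"
  then obtain x where "y = cj (cj p * x * q)" by blast
  hence "y = cj q * cj x * p" by (simp add: cj_mult cj_simps mult.assoc)
  thus "y \<in> range (\<lambda>x. cj q * x * p)" by blast
next
  fix y assume "y \<in> range (\<lambda>x. cj q * x * p)"
  then obtain x where "y = cj q * x * p" by blast
  hence "y = cj (cj p * cj x * q)" by (simp add: cj_mult cj_simps mult.assoc)
  thus "y \<in> cj ` range (\<lambda>x. cj p * x * q)" by blast
qed

lemma inj_SMod: "inj_on (\<lambda>(n, P, Q). SMod n P Q) (ZA \<times> PL \<times> PL)"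
proof (rule inj_onI)
  fix S T
  assume S: "S \<in> ZA \<times> PL \<times> PL" and T: "T \<in> ZA \<times> PL \<times> PL"
    and ST: "(\<lambda>(n, P, Q). SMod n P Q) S = (\<lambda>(n, P, Q). SMod n P Q) T"
  obtain m P Q n P' Q' where dec: "S = (m, P, Q)" "T = (n, P', Q')" by (metis surj_pair)
  have *: "m \<in> ZA" "n \<in> ZA" "P \<in> PL" "Q \<in> PL" "P' \<in> PL" "Q' \<in> PL" and eq: "SMod m P Q = SMod n P' Q'"
    using S T ST by (auto simp: dec)
  obtain p q p' q' where p: "P = LI p" "primset (LI p)" and q: "Q = LI q" "primset (LI q)"
      and p': "P' = LI p'" "primset (LI p')" and q': "Q' = LI q'" "primset (LI q')"
    using PL_generator * by metis
  have nz: "m \<noteq> 0" "n \<noteq> 0" using * by (auto simp: ZA_def)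
  have eq': "range (\<lambda>x. zi m * (cj p * x * q)) = range (\<lambda>x. zi n * (cj p' * x * q'))"
    using eq p q p' q' by (simp add: SMod_LI)
  have "n dvd m" by (rule prim_mult_subset_iz[OF p(2) q(2) nz(2)]) (use eq' in auto)
  moreover have "m dvd n" by (rule prim_mult_subset_iz[OF p'(2) q'(2) nz(1)]) (use eq'[symmetric] in auto)
  ultimately have mn: "m = n" using ZA_dvd_antisym * by blast
  have "(*) (zi n) ` range (\<lambda>x. cj p * x * q) = (*) (zi n) ` range (\<lambda>x. cj p' * x * q')"
    using eq' unfolding mn image_image .
  moreover have "inj ((*) (zi n))" using nz by (auto simp: inj_def)
  ultimately have r: "range (\<lambda>x. cj p * x * q) = range (\<lambda>x. cj p' * x * q')"
    by (simp only: inj_image_eq_iff)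
  have "LI q = LI q'" using prim_product_determines[OF p(2) p'(2) r] .
  \<comment> \<open>Conjugation exchanges the two sides, so recovering the right factor also
    recovers the left one.\<close>
  moreover have "range (\<lambda>x. cj q * x * p) = range (\<lambda>x. cj q' * x * p')"
    using arg_cong[OF r, of "(`) cj"] unfolding cj_image_range .
  hence "LI p = LI p'" using prim_product_determines[OF q(2) q'(2)] by blast
  ultimately show "S = T" using mn p q p' q' by (simp add: dec)
qed

lemma idx_SMod:
  assumes "n \<in> ZA" "P \<in> PL" "Q \<in> PL"
  shows "idx UNIV (SMod n P Q) = qn n ^ 4 * (idx UNIV P * idx UNIV Q)"
proof -
  obtain p q where p: "P = LI p" "p \<noteq> 0" and q: "Q = LI q" "q \<noteq> 0" using PL_generator assms by metis
  have n: "n \<noteq> 0" using assms by (auto simp: ZA_def)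
  have "idx UNIV (SMod n P Q) = idx UNIV (range (\<lambda>x. zi n * (cj p * (x * q))))"
    unfolding p q SMod_LI by (simp only: mult.assoc)
  also have "\<dots> = idx UNIV (iz n) * idx UNIV (range (\<lambda>x. cj p * (x * q)))"
    by (rule idx_range_comp) (use n in \<open>auto simp: inj_def algebra_simps\<close>)
  also have "idx UNIV (range (\<lambda>x. cj p * (x * q))) = idx UNIV (RI (cj p)) * idx UNIV (LI q)"
    by (rule idx_range_comp) (use p in \<open>auto simp: inj_def algebra_simps\<close>)
  finally show ?thesis using n p q idx_RI_qn[of "cj p"] idx_LI_qn[of p] by (simp add: idx_iz_qn)
qed

text \<open>Normal form of p I q divided by m. Once the contents a of \<open>cj p\<close> and b of q
  are split off, the remaining product has content 1, so m divides a b.\<close>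

lemma SS_I:
  assumes "p \<noteq> 0" "q \<noteq> 0" "m \<noteq> 0" and sub: "range (\<lambda>x. p * x * q) \<subseteq> iz m"
  shows "{y. zi m * y \<in> range (\<lambda>x. p * x * q)} \<in> SS"
proof -
  obtain a p0 where a: "a \<in> ZA" "cj p = zi a * p0" "primset (LI p0)"
    using content_decomposition[of "cj p"] assms(1) by auto
  obtain b q0 where b: "b \<in> ZA" "q = zi b * q0" "primset (LI q0)"
    using content_decomposition[OF assms(2)] by auto
  have p: "p = zi a * cj p0"
    using arg_cong[OF a(2), of cj] by (simp add: cj_simps cj_mult zi_commute)
  have eq: "p * x * q = zi (a * b) * (cj p0 * x * q0)" for x
    unfolding p b(2) zi_simps mult.assoc by (simp only: zi_left_commute[of x b] zi_left_commute[of "cj p0" b])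
  have "m dvd a * b"
    by (rule prim_mult_subset_iz[OF a(3) b(3) assms(3)]) (use sub in \<open>simp only: eq\<close>)
  then obtain c where c: "a * b = m * c" by blast
  have "a * b \<noteq> 0" using a b by (simp add: ZA_def)
  hence c0: "c \<noteq> 0" using c by auto
  have "{y. zi m * y \<in> range (\<lambda>x. p * x * q)} = range (\<lambda>x. zi c * (cj p0 * x * q0))"
  proof -
    have "zi m * y = p * x * q \<longleftrightarrow> y = zi c * (cj p0 * x * q0)" for x y
    proof -
      have "p * x * q = zi m * (zi c * (cj p0 * x * q0))"
        unfolding eq c zi_simps by (rule mult.assoc)
      thus ?thesis using assms(3) by (simp only: mult_cancel_left zi_eq_0_iff) simp
    qed
    thus ?thesis by blast
  qed
  also have "\<dots> = SMod (normalize c) (LI p0) (LI q0)"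
    unfolding SMod_LI[symmetric] by (intro equalityI SMod_cong) simp_all
  also have "\<dots> \<in> SS"
    unfolding SS_def
    by (rule image_eqI[of _ _ "(normalize c, LI p0, LI q0)"]) (use a b c0 in \<open>auto simp: ZA_def PL_def\<close>)
  finally show ?thesis .
qed

subsection \<open>Similarities are given by left and right multiplications\<close>

text \<open>A similarity read on the lattice; c = nr(\<phi> 1) is the square of its ratio and lies
  in Z[\<tau>].\<close>

locale similitude =
  fixes \<phi> :: "ico \<Rightarrow> ico" and c :: zt
  assumes add: "\<phi> (x + y) = \<phi> x + \<phi> y"
    and scale: "\<phi> (zi n * x) = zi n * \<phi> x"
    and nr: "nr (\<phi> x) = c * nr x"
    and nz: "c \<noteq> 0"
begin

text \<open>This is c \<phi>(1)^-1 \<phi>, free of denominators. \<psi> / c is an isometry fixing 1,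
  hence multiplicative or product-reversing.\<close>

definition \<psi> :: "ico \<Rightarrow> ico" where "\<psi> x = cj (\<phi> 1) * \<phi> x"

text \<open>The units i, j, k, with j and k solved from 2 h = (\<tau> - 1) + \<tau> i + j and 2 i h
  = -\<tau> + (\<tau> - 1) i + k.\<close>

definition qi :: ico where "qi = Ico 0 1 0 0"
definition qj :: ico where "qj = Ico (1 - ztau) (- ztau) 2 0"
definition qk :: ico where "qk = Ico ztau (1 - ztau) 0 2"

lemma quat_table: "qi * qi = -1" "qj * qj = -1" "qk * qk = -1" "qi * qj = qk" "qj * qi = - qk"
  "qj * qk = qi" "qk * qj = - qi" "qk * qi = qj" "qi * qk = - qj"
  by (simp_all add: qi_def qj_def qk_def ico_eq_iff times_ico_def algebra_simps ztau_reduce)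

lemma itr_units: "itr qi = 0" "itr qj = 0" "itr qk = 0"
  by (simp_all add: qi_def qj_def qk_def itr_def algebra_simps ztau_reduce)

lemma nr_units: "nr qi = 1" "nr qj = 1" "nr qk = 1"
  by (simp_all add: qi_def qj_def qk_def nr_def algebra_simps ztau_reduce power2_eq_square)

lemma quat_expand: "2 * x = zi (qa x) + zi (qb x) * qi + zi (cc x) * qj + zi (cd x) * qk"
  by (simp add: numeral_2_eq_2 one_add_one[symmetric] distrib_right del: one_add_one)
    (simp add: qi_def qj_def qk_def qa_def qb_def ico_eq_iff algebra_simps ztau_reduce)

lemma \<psi>_add: "\<psi> (x + y) = \<psi> x + \<psi> y"
  by (simp add: \<psi>_def add distrib_left)

lemma \<psi>_scale: "\<psi> (zi n * x) = zi n * \<psi> x"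
  by (simp add: \<psi>_def scale zi_left_commute)

lemma \<psi>_nr: "nr (\<psi> x) = c * c * nr x"
  by (simp add: \<psi>_def nr_mult nr)

lemma \<psi>_1: "\<psi> 1 = zi c"
  by (simp add: \<psi>_def cj_mult_self nr)

lemma \<psi>_polar: "itr (\<psi> x * cj (\<psi> y)) = c * c * itr (x * cj y)"
  using nr_add[of "\<psi> x" "\<psi> y"] nr_add[of x y] by (simp add: \<psi>_nr algebra_simps flip: \<psi>_add)

lemma \<psi>_pure:
  assumes "itr x = 0"
  shows "cj (\<psi> x) = - \<psi> x" "\<psi> x * \<psi> x = - zi (c * c * nr x)"
proof -
  have "c * itr (\<psi> x) = 0"
    using \<psi>_polar[of x 1] assms by (simp add: \<psi>_1 cj_simps zi_commute itr_simps)
  hence "itr (\<psi> x) = 0" using nz by simp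
  thus *: "cj (\<psi> x) = - \<psi> x" by (simp add: cj_eq zi_simps)
  show "\<psi> x * \<psi> x = - zi (c * c * nr x)"
    using mult_cj[of "\<psi> x"] unfolding * \<psi>_nr by (metis mult_minus_right minus_minus)
qed

lemma \<psi>_anticommute:
  assumes "itr x = 0" "itr y = 0" "itr (x * y) = 0"
  shows "\<psi> y * \<psi> x = - (\<psi> x * \<psi> y)"
proof -
  have "itr (\<psi> x * cj (\<psi> y)) = 0"
    using \<psi>_polar[of x y] assms by (simp add: cj_eq[of y] zi_simps itr_simps)
  hence "itr (\<psi> x * \<psi> y) = 0" using \<psi>_pure[OF assms(2)] by (simp add: itr_simps)
  hence "\<psi> x * \<psi> y + cj (\<psi> x * \<psi> y) = 0" by (simp add: add_cj zi_simps)
  thus ?thesis using \<psi>_pure(1)[OF assms(1)] \<psi>_pure(1)[OF assms(2)]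
    by (simp add: cj_mult add_eq_0_iff)
qed

text \<open>P Q and c R commute and have the same square, so (P Q - c R) (P Q + c R) = 0 and a
  factor vanishes. The sign decides whether \<psi> / c preserves or reverses products.\<close>

lemma \<psi>_qk: "\<psi> qi * \<psi> qj = zi c * \<psi> qk \<or> \<psi> qi * \<psi> qj = - (zi c * \<psi> qk)"
proof -
  define P Q R where PQR: "P = \<psi> qi" "Q = \<psi> qj" "R = \<psi> qk"
  have sq: "P * P = - (zi c * zi c)" "Q * Q = - (zi c * zi c)" "R * R = - (zi c * zi c)"
    unfolding PQR using \<psi>_pure(2) itr_units nr_units by (simp_all add: zi_simps)
  have ac: "Q * P = - (P * Q)" "R * P = - (P * R)" "R * Q = - (Q * R)"
    unfolding PQR by (rule \<psi>_anticommute; simp add: itr_units quat_table itr_simps)+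
  have "P * Q * R = R * (P * Q)"
  proof -
    have "R * (P * Q) = - (P * R) * Q" by (simp only: ac mult.assoc[symmetric])
    also have "\<dots> = P * Q * R" by (simp add: mult.assoc ac)
    finally show ?thesis ..
  qed
  moreover have "(P * Q) * (P * Q) = - (P * P * (Q * Q))"
  proof -
    have "(P * Q) * (P * Q) = P * (Q * P) * Q" by (simp only: mult.assoc)
    thus ?thesis by (simp add: ac mult.assoc)
  qed
  hence "(P * Q) * (P * Q) = - (zi c * zi c * (zi c * zi c))" by (simp add: sq)
  moreover have "(zi c * R) * (zi c * R) = - (zi c * zi c * (zi c * zi c))"
  proof -
    have "(zi c * R) * (zi c * R) = zi c * (R * zi c) * R" by (simp only: mult.assoc)
    also have "\<dots> = zi c * zi c * (R * R)" by (simp only: zi_commute[of R c] mult.assoc)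
    finally show ?thesis by (simp add: sq mult.assoc)
  qed
  ultimately have "(P * Q - zi c * R) * (P * Q + zi c * R) = P * Q * (zi c * R) - zi c * R * (P * Q)"
    by (simp add: left_diff_distrib distrib_left)
  also have "P * Q * (zi c * R) = zi c * (P * Q * R)" by (rule zi_left_commute)
  also have "zi c * (P * Q * R) = zi c * R * (P * Q)"
    unfolding \<open>P * Q * R = R * (P * Q)\<close> by (simp only: mult.assoc)
  finally have "P * Q - zi c * R = 0 \<or> P * Q + zi c * R = 0" by simp
  thus ?thesis unfolding PQR by (auto simp: eq_neg_iff_add_eq_0)
qed

text \<open>Skolem-Noether: \<open>u = \<Sum> \<psi> e w e\<^sup>*\<close> (sum over \<open>e \<in> {1, i, j, k}\<close>) satisfies \<open>\<psi> x u = c u x\<close>,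
  and \<open>u \<noteq> 0\<close> for some \<open>w \<in> {1, i, j, k}\<close>.\<close>

lemma intertwiner:
  assumes "\<psi> qi * \<psi> qj = zi c * \<psi> qk"
  obtains u where "u \<noteq> 0" "\<And>x. \<psi> x * u = zi c * (u * x)"
proof -
  define P Q R where PQR: "P = \<psi> qi" "Q = \<psi> qj" "R = \<psi> qk"
  define C where "C = zi c"
  have C: "x * C = C * x" for x by (simp add: C_def zi_commute)
  have C': "x * (C * y) = C * (x * y)" for x y by (simp add: C_def zi_left_commute)
  have C0: "C \<noteq> 0" using nz by (simp add: C_def)
  have sq: "P * P = - (C * C)" "Q * Q = - (C * C)" "R * R = - (C * C)"
    unfolding PQR C_def using \<psi>_pure(2) itr_units nr_units by (simp_all add: zi_simps)
  have ac: "Q * P = - (P * Q)" "R * P = - (P * R)" "R * Q = - (Q * R)"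
    unfolding PQR by (rule \<psi>_anticommute; simp add: itr_units quat_table itr_simps)+
  have pq: "P * Q = C * R" using assms by (simp add: PQR C_def)
  have "C * (P * R) = C * (- (C * Q))"
  proof -
    have "C * (P * R) = P * (P * Q)" by (simp only: pq C')
    also have "\<dots> = - (C * C) * Q" by (simp only: sq mult.assoc[symmetric])
    finally show ?thesis by (simp add: mult.assoc)
  qed
  hence pr: "P * R = - (C * Q)" using C0 by (metis mult_left_cancel)
  have "C * (Q * R) = C * (C * P)"
  proof -
    have "C * (Q * R) = Q * (P * Q)" by (simp only: pq C')
    also have "\<dots> = - (P * (Q * Q))" by (simp only: ac mult.assoc[symmetric] mult_minus_left)
    also have "\<dots> = P * (C * C)" by (simp add: sq)
    finally show ?thesis by (simp only: C'[of P C] C[of P])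
  qed
  hence qr: "Q * R = C * P" using C0 by (metis mult_left_cancel)
  have t1: "P * P = - (C * C)" "P * Q = C * R" "P * R = - (C * Q)"
    "Q * P = - (C * R)" "Q * Q = - (C * C)" "Q * R = C * P"
    "R * P = C * Q" "R * Q = - (C * P)" "R * R = - (C * C)"
    using sq ac pq pr qr by simp_all
  have t2: "P * (P * z) = - (C * (C * z))" "P * (Q * z) = C * (R * z)" "P * (R * z) = - (C * (Q * z))"
    "Q * (P * z) = - (C * (R * z))" "Q * (Q * z) = - (C * (C * z))" "Q * (R * z) = C * (P * z)"
    "R * (P * z) = C * (Q * z)" "R * (Q * z) = - (C * (P * z))" "R * (R * z) = - (C * (C * z))" for z
    by (simp_all only: mult.assoc[symmetric] t1 mult_minus_left)
  define u where "u w = C * w - P * (w * qi) - Q * (w * qj) - R * (w * qk)" for w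
  have PQRu: "P * u w = C * (u w * qi)" "Q * u w = C * (u w * qj)" "R * u w = C * (u w * qk)" for w
    unfolding u_def
    by (simp_all add: left_diff_distrib right_diff_distrib distrib_left mult.assoc quat_table t2
         C'[of P] C'[of Q] C'[of R])
  have tw: "\<psi> x * u w = zi c * (u w * x)" for x w
  proof -
    \<comment> \<open>An icosian is an integral combination of 1, i, j, k only after doubling; the
      factor 2 is cancelled at the end.\<close>
    have "\<psi> (2 * x) = zi (qa x) * C + zi (qb x) * P + zi (cc x) * Q + zi (cd x) * R"
      unfolding quat_expand[of x] \<psi>_add \<psi>_scale PQR using \<psi>_scale[of "qa x" 1] by (simp add: \<psi>_1 C_def)
    hence "\<psi> (2 * x) * u w = zi (qa x) * (C * u w) + zi (qb x) * (P * u w) + zi (cc x) * (Q * u w) + zi (cd x) * (R * u w)"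
      by (simp only: distrib_right mult.assoc)
    also have "\<dots> = C * (u w * (zi (qa x) + zi (qb x) * qi + zi (cc x) * qj + zi (cd x) * qk))"
      unfolding PQRu distrib_left zi_left_commute[of "u w"] zi_left_commute[of C]
      by (simp add: zi_commute[of "u w"] zi_left_commute[of C])
    also have "\<dots> = C * (u w * (2 * x))" by (simp only: quat_expand)
    finally have "2 * (\<psi> x * u w) = 2 * (C * (u w * x))"
      using \<psi>_scale[of 2 x] by (simp add: mult_2 \<psi>_add distrib_left distrib_right)
    moreover have "(2 :: ico) = zi 2" by (metis of_int_numeral zi_of_int)
    ultimately show ?thesis by (simp add: C_def)
  qed
  \<comment> \<open>The sum of u(w) w^* over w in {1, i, j, k} is 4 c: the sum of w e^* w^* is twice
    the trace of e^*, which is 0 unless e = 1.\<close>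
  have "u 1 - u qi * qi - u qj * qj - u qk * qk = C + (C + (C + C))"
    unfolding u_def
    by (simp add: left_diff_distrib mult.assoc quat_table algebra_simps)
  also have "\<dots> = zi (4 * c)" by (simp add: C_def flip: zi_simps)
  finally have total: "u 1 - u qi * qi - u qj * qj - u qk * qk = zi (4 * c)" .
  have "\<exists>w. u w \<noteq> 0"
  proof (rule ccontr)
    assume "\<not> (\<exists>w. u w \<noteq> 0)"
    hence "u w = 0" for w by blast
    hence "zi (4 * c) = 0" using total by (simp only: mult_zero_left diff_zero)
    thus False using nz by simp
  qed
  then obtain w where "u w \<noteq> 0" by blast
  thus ?thesis using that tw by blast
qed

text \<open>The intertwiner gives \<phi> x = a u x u^-1 with a = \<phi> 1; multiplication by nr u
  brings this into the shape of \<open>SS_I\<close>.\<close>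

lemma range_form:
  assumes "\<psi> qi * \<psi> qj = zi c * \<psi> qk"
  shows "range \<phi> \<in> SS"
proof -
  obtain u where u: "u \<noteq> 0" "\<And>x. \<psi> x * u = zi c * (u * x)" using intertwiner[OF assms] by blast
  define a where "a = \<phi> 1"
  have a: "a * cj a = zi c" "a \<noteq> 0" using nr[of 1] nz by (auto simp: a_def mult_cj)
  have "\<phi> x * u = a * (u * x)" for x
  proof -
    have "zi c * (\<phi> x * u) = a * (\<psi> x * u)" by (simp add: \<psi>_def mult.assoc flip: a_def a(1))
    also have "\<dots> = zi c * (a * (u * x))" by (simp only: u zi_left_commute)
    finally show ?thesis using nz by simp
  qed
  hence *: "zi (nr u) * \<phi> x = (a * u) * x * cj u" for x
    by (metis mult.assoc mult_cj zi_commute)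
  have "range \<phi> = {y. zi (nr u) * y \<in> range (\<lambda>x. (a * u) * x * cj u)}"
  proof -
    have "zi (nr u) * y = (a * u) * x * cj u \<longleftrightarrow> y = \<phi> x" for x y
      unfolding *[symmetric] using u(1) by simp
    thus ?thesis by blast
  qed
  also have "\<dots> \<in> SS" by (rule SS_I) (use u a in \<open>auto simp flip: *\<close>)
  finally show ?thesis .
qed

end

text \<open>In the minus case, precomposing with conjugation flips the sign of \<psi> on pure
  quaternions and leaves the range unchanged.\<close>

lemma similitude_range:
  assumes "similitude \<phi> c"
  shows "range \<phi> \<in> SS"
proof -
  interpret similitude \<phi> c by fact
  consider "\<psi> qi * \<psi> qj = zi c * \<psi> qk" | "\<psi> qi * \<psi> qj = - (zi c * \<psi> qk)" using \<psi>_qk by blast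
  thus ?thesis
  proof cases
    case 1
    thus ?thesis by (rule range_form)
  next
    case 2
    interpret S: similitude "\<lambda>x. \<phi> (cj x)" c
      by standard (simp_all add: add scale nr nz cj_simps cj_mult zi_commute)
    have neg: "\<phi> (- x) = - \<phi> x" for x using scale[of "- 1" x] by (simp add: zi_simps)
    have "S.\<psi> x = - \<psi> x" if "itr x = 0" for x
      using that by (simp add: S.\<psi>_def \<psi>_def cj_simps cj_eq[of x] zi_simps neg)
    hence "S.\<psi> qi * S.\<psi> qj = zi c * S.\<psi> qk" using 2 by (simp add: itr_units)
    hence "range (\<lambda>x. \<phi> (cj x)) \<in> SS" by (rule S.range_form)
    moreover have "range (\<lambda>x. \<phi> (cj x)) = range \<phi>" by (metis cj_simps(7) surj_def surj_image_vimage_eq image_image)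
    ultimately show ?thesis by simp
  qed
qed

section \<open>Multiplicativity\<close>

abbreviation izn :: "nat \<Rightarrow> ico set" where "izn k \<equiv> iz (of_nat k)"

lemma qn_of_nat [simp]: "qn (of_nat k) = k\<^sup>2"
proof -
  have "(of_nat k :: zt) = of_int (int k)" by simp
  thus ?thesis unfolding qn_def by (simp only: znorm_simps) (simp add: nat_power_eq)
qed

lemma idx_izn: "k > 0 \<Longrightarrow> idx UNIV (izn k) = k ^ 8"
  by (subst idx_iz_qn) (auto simp flip: power_mult)

lemma izn_subset:
  assumes "sgrp J"
  shows "izn (idx UNIV J) \<subseteq> J"
proof
  fix x assume "x \<in> izn (idx UNIV J)"
  then obtain y where "x = zi (of_nat (idx UNIV J)) * y" by blast
  moreover have "zi (of_nat k) = of_nat k" for k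
    using zi_of_int[of "int k"] by simp
  ultimately show "x \<in> J" using idx_mult_mem[of UNIV J y] assms by simp
qed

lemma finite_subgroups_idx:
  assumes "m > 0"
  shows "finite {J :: ico set. sgrp J \<and> idx UNIV J = m}"
proof (rule finite_subset)
  show "{J :: ico set. sgrp J \<and> idx UNIV J = m} \<subseteq> {J. sgrp J \<and> izn m \<subseteq> J \<and> J \<subseteq> UNIV}"
    using izn_subset by auto
  show "finite {J. sgrp J \<and> izn m \<subseteq> J \<and> J \<subseteq> UNIV}"
    by (rule finite_subgroups_above) (use assms idx_izn[of m] in auto)
qed

lemma idx_dvd_mono:
  assumes "sgrp A" "sgrp B" "A \<subseteq> B"
  shows "idx UNIV B dvd idx UNIV A"
  using idx_mult[of UNIV B A] assms by simp

lemma bezout_nat_int: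
  assumes "coprime k l"
  obtains u v :: int where "u * int k + v * int l = 1"
  using bezout_int[of "int k" "int l"] assms by (metis coprime_int_iff coprime_iff_gcd_eq_1)

lemma mult_eq_imp_eq_nat:
  fixes a b k l :: nat
  assumes "a * b = k * l" "a dvd k" "b dvd l" "k > 0" "l > 0"
  shows "a = k" "b = l"
proof -
  obtain c d where cd: "k = a * c" "l = b * d" using assms by auto
  have "a * b * 1 = a * b * (c * d)" using assms(1) cd by (simp add: algebra_simps)
  moreover have "a * b \<noteq> 0" using assms(1,4,5) by simp
  ultimately have "c * d = 1" by (metis mult_left_cancel)
  thus "a = k" "b = l" using cd by simp_all
qed

text \<open>By Lagrange k l I lies in J. With u k + v l = 1 this makes (J + k I) \<inter> (J + l I)
  equal to J, while the two sums together span everything, so their indices multiply to k l.\<close>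

lemma idx_primary_part:
  assumes J: "sgrp J" "idx UNIV J = k * l" and kl: "coprime k l" "k > 0" "l > 0"
  shows "idx UNIV (ssum J (izn k)) = k" "ssum J (izn k) \<inter> ssum J (izn l) = J"
proof -
  define J1 J2 where "J1 = ssum J (izn k)" and "J2 = ssum J (izn l)"
  have s: "sgrp J1" "sgrp J2" using J by (simp_all add: J1_def J2_def sgrp_ssum)
  have sub: "J \<subseteq> J1" "J \<subseteq> J2" "izn k \<subseteq> J1" "izn l \<subseteq> J2"
    using J ssum_upper1[OF sgrp_iz] ssum_upper2[OF J(1)] by (auto simp: J1_def J2_def)
  obtain u v where uv: "u * int k + v * int l = 1" using bezout_nat_int[OF kl(1)] by blast
  have one: "x = zi (of_nat k) * (of_int u * x) + zi (of_nat l) * (of_int v * x)" for x :: ico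
  proof -
    have "x = zi (of_int (u * int k + v * int l)) * x" unfolding uv by (simp add: zi_simps)
    thus ?thesis unfolding zi_of_int[symmetric]
      by (simp only: of_int_add of_int_mult zi_simps distrib_right mult.assoc of_int_of_nat_eq zi_left_commute[of "zi _"])
  qed
  have kl_sub: "zi (of_nat k) * (zi (of_nat l) * y) \<in> J" for y
    using izn_subset[OF J(1)] J(2) by (auto simp: zi_simps mult.assoc)
  show int: "J1 \<inter> J2 = J"
  proof
    show "J1 \<inter> J2 \<subseteq> J"
    proof
      fix x assume "x \<in> J1 \<inter> J2"
      hence x12: "x \<in> J1" "x \<in> J2" by simp_all
      obtain j y where x1: "x = j + zi (of_nat k) * y" "j \<in> J"
        using x12(1) unfolding J1_def ssum_def by blast
      obtain j' y' where x2: "x = j' + zi (of_nat l) * y'" "j' \<in> J"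
        using x12(2) unfolding J2_def ssum_def by blast
      note x = x1(1) x2(1) x1(2) x2(2)
      have mem: "zi (of_int m) * z \<in> J" if "z \<in> J" for m z
      proof -
        have "zi (of_nat n) * z \<in> J" for n
          by (induction n) (use that sgrp_plus[OF J(1)] sgrpD(1)[OF J(1)] in \<open>auto simp: zi_simps distrib_right\<close>)
        thus ?thesis using sgrp_uminus[OF J(1)] by (cases m rule: int_cases2) (auto simp: zi_simps)
      qed
      have memn: "zi (of_nat n) * z \<in> J" if "z \<in> J" for n z
        using mem[OF that, of "int n"] by simp
      have "zi (of_nat l) * (zi (of_nat k) * y) \<in> J"
        using kl_sub[of y] by (simp only: zi_left_commute[of "zi (of_nat l)" "of_nat k"])
      hence "zi (of_nat l) * x \<in> J"
        unfolding x(1) distrib_left by (rule sgrp_plus[OF J(1) memn[OF x(3)]])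
      moreover have "zi (of_nat k) * x \<in> J"
        unfolding x(2) distrib_left by (rule sgrp_plus[OF J(1) memn[OF x(4)] kl_sub])
      ultimately have "zi (of_int u) * (zi (of_nat k) * x) + zi (of_int v) * (zi (of_nat l) * x) \<in> J"
        by (intro sgrp_plus[OF J(1)] mem)
      also have "zi (of_int u) * (zi (of_nat k) * x) + zi (of_int v) * (zi (of_nat l) * x) = x"
        by (subst one[of x]) (simp only: zi_of_int zi_left_commute[of "of_int _"])
      finally show "x \<in> J" .
    qed
  qed (use sub in auto)
  have "ssum J1 J2 = UNIV"
  proof -
    have "x \<in> ssum J1 J2" for x
      unfolding ssum_def using one[of x] sub by blast
    thus ?thesis by blast
  qed
  hence "idx J1 J = idx UNIV J2" using idx_ssum[OF s] int by simp
  moreover have "idx UNIV J = idx UNIV J1 * idx J1 J" using idx_mult[of UNIV J1 J] s J sub by simp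
  ultimately have prod: "idx UNIV J1 * idx UNIV J2 = k * l" using J(2) by simp
  \<comment> \<open>k I has index k^8, 8 being the rank over Z. Hence the two indices are prime to l
    and to k respectively, and the product k l can split in one way only.\<close>
  have "idx UNIV J1 dvd k ^ 8" "idx UNIV J2 dvd l ^ 8"
    using idx_dvd_mono[OF sgrp_iz s(1) sub(3)] idx_dvd_mono[OF sgrp_iz s(2) sub(4)] idx_izn kl by simp_all
  moreover have "coprime (k ^ 8) l" "coprime (l ^ 8) k" using kl by (simp_all add: coprime_commute)
  ultimately have "coprime (idx UNIV J1) l" "coprime (idx UNIV J2) k"
    using coprime_divisors dvd_refl by blast+
  hence "idx UNIV J1 dvd k" "idx UNIV J2 dvd l"
    using prod by (metis coprime_dvd_mult_left_iff dvd_triv_left, metis coprime_dvd_mult_right_iff dvd_triv_right)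
  thus "idx UNIV J1 = k" using mult_eq_imp_eq_nat prod kl by blast
qed

lemma idx_Int_coprime:
  assumes "sgrp J1" "sgrp J2" "idx UNIV J1 = k" "idx UNIV J2 = l" "coprime k l" "k > 0" "l > 0"
  shows "idx UNIV (J1 \<inter> J2) = k * l" "ssum (J1 \<inter> J2) (izn k) = J1"
proof -
  have s: "sgrp (ssum J1 J2)" "sgrp (J1 \<inter> J2)" using assms by (simp_all add: sgrp_ssum sgrp_Int)
  have "idx UNIV (ssum J1 J2) dvd k" "idx UNIV (ssum J1 J2) dvd l"
    using idx_dvd_mono[OF assms(1) s(1)] idx_dvd_mono[OF assms(2) s(1)] assms ssum_upper1 ssum_upper2 by blast+
  hence "idx UNIV (ssum J1 J2) = 1" using assms(5) coprime_common_divisor_nat by blast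
  hence "ssum J1 J2 = UNIV" using idx_1_imp_eq[OF sgrp_UNIV s(1)] by simp
  hence "idx J1 (J1 \<inter> J2) = l" using idx_ssum[OF assms(1,2)] assms by simp
  thus 1: "idx UNIV (J1 \<inter> J2) = k * l"
    using idx_mult[of UNIV J1 "J1 \<inter> J2"] assms s by simp
  have k: "izn k \<subseteq> J1" using izn_subset[OF assms(1)] assms(3) by simp
  have s2: "sgrp (ssum (J1 \<inter> J2) (izn k))" using s by (simp add: sgrp_ssum)
  have sub: "ssum (J1 \<inter> J2) (izn k) \<subseteq> J1" using k assms(1) by (intro ssum_least) auto
  have "idx UNIV (ssum (J1 \<inter> J2) (izn k)) = k" using idx_primary_part(1)[OF s(2) 1] assms by blast
  hence "k = k * idx J1 (ssum (J1 \<inter> J2) (izn k))"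
    using idx_mult[of UNIV J1 "ssum (J1 \<inter> J2) (izn k)"] assms s2 sub by simp
  hence "idx J1 (ssum (J1 \<inter> J2) (izn k)) = 1" using assms(6) by simp
  thus "ssum (J1 \<inter> J2) (izn k) = J1" using idx_1_imp_eq[OF assms(1) s2 sub] by simp
qed

text \<open>J corresponds to the pair (J + k I, J + l I), with intersection as inverse. Stating it
  for any family X closed under both operations covers the ideals n I and the primitive left ideals
  alike.\<close>

lemma card_subgroups_mult:
  assumes X: "\<And>J. J \<in> X \<Longrightarrow> sgrp J"
    and plus: "\<And>J k. J \<in> X \<Longrightarrow> k > 0 \<Longrightarrow> ssum J (izn k) \<in> X"
    and int: "\<And>J1 J2. J1 \<in> X \<Longrightarrow> J2 \<in> X \<Longrightarrow> coprime (idx UNIV J1) (idx UNIV J2) \<Longrightarrow>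
        idx UNIV J1 > 0 \<Longrightarrow> idx UNIV J2 > 0 \<Longrightarrow> J1 \<inter> J2 \<in> X"
    and kl: "coprime k l" "k > 0" "l > 0"
  shows "card {J \<in> X. idx UNIV J = k * l} = card {J \<in> X. idx UNIV J = k} * card {J \<in> X. idx UNIV J = l}"
proof -
  have lk: "coprime l k" using kl by (simp add: coprime_commute)
  have "bij_betw (\<lambda>J. (ssum J (izn k), ssum J (izn l))) {J \<in> X. idx UNIV J = k * l}
      ({J \<in> X. idx UNIV J = k} \<times> {J \<in> X. idx UNIV J = l})"
  proof (rule bij_betw_byWitness[where f' = "\<lambda>(J1, J2). J1 \<inter> J2"])
    show "\<forall>J\<in>{J \<in> X. idx UNIV J = k * l}. (\<lambda>(J1, J2). J1 \<inter> J2) (ssum J (izn k), ssum J (izn l)) = J"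
      using idx_primary_part(2)[OF X _ kl] by auto
    show "\<forall>J\<in>{J \<in> X. idx UNIV J = k} \<times> {J \<in> X. idx UNIV J = l}.
       (\<lambda>J. (ssum J (izn k), ssum J (izn l))) ((\<lambda>(J1, J2). J1 \<inter> J2) J) = J"
    proof
      fix p assume "p \<in> {J \<in> X. idx UNIV J = k} \<times> {J \<in> X. idx UNIV J = l}"
      then obtain J1 J2 where p: "p = (J1, J2)" and J: "J1 \<in> X" "J2 \<in> X"
        and i: "idx UNIV J1 = k" "idx UNIV J2 = l" by auto
      have "ssum (J1 \<inter> J2) (izn k) = J1"
        using idx_Int_coprime(2)[OF X[OF J(1)] X[OF J(2)] i kl] .
      moreover have "ssum (J2 \<inter> J1) (izn l) = J2"
        using idx_Int_coprime(2)[OF X[OF J(2)] X[OF J(1)] i(2,1) lk kl(3,2)] .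
      ultimately show "(\<lambda>J. (ssum J (izn k), ssum J (izn l))) ((\<lambda>(J1, J2). J1 \<inter> J2) p) = p"
        by (simp add: p Int_commute)
    qed
    show "(\<lambda>J. (ssum J (izn k), ssum J (izn l))) ` {J \<in> X. idx UNIV J = k * l}
        \<subseteq> {J \<in> X. idx UNIV J = k} \<times> {J \<in> X. idx UNIV J = l}"
    proof (intro image_subsetI)
      fix J assume "J \<in> {J \<in> X. idx UNIV J = k * l}"
      hence J: "J \<in> X" "idx UNIV J = k * l" "idx UNIV J = l * k" by (auto simp: mult.commute)
      thus "(ssum J (izn k), ssum J (izn l)) \<in> {J \<in> X. idx UNIV J = k} \<times> {J \<in> X. idx UNIV J = l}"
        using idx_primary_part(1)[OF X[OF J(1)] J(2) kl] idx_primary_part(1)[OF X[OF J(1)] J(3) lk kl(3,2)]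
          plus kl by simp
    qed
    show "(\<lambda>(J1, J2). J1 \<inter> J2) ` ({J \<in> X. idx UNIV J = k} \<times> {J \<in> X. idx UNIV J = l})
        \<subseteq> {J \<in> X. idx UNIV J = k * l}"
    proof (intro image_subsetI)
      fix p assume "p \<in> {J \<in> X. idx UNIV J = k} \<times> {J \<in> X. idx UNIV J = l}"
      then obtain J1 J2 where p: "p = (J1, J2)" and J: "J1 \<in> X" "J2 \<in> X"
        and i: "idx UNIV J1 = k" "idx UNIV J2 = l" by auto
      show "(case p of (J1, J2) \<Rightarrow> J1 \<inter> J2) \<in> {J \<in> X. idx UNIV J = k * l}"
        using idx_Int_coprime(1)[OF X[OF J(1)] X[OF J(2)] i kl] int[OF J] i kl by (simp add: p)
    qed
  qed
  thus ?thesis by (simp add: bij_betw_same_card flip: card_cartesian_product)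
qed

subsection \<open>Weighted sets with multiplicative counting function\<close>

text \<open>The SSM count is handled by transport from \<open>ZA \<times> PL \<times> PL\<close>;
  the predicate bundles what passes through bijections (\<open>mulw_bij\<close>) and products
  (\<open>mulw_Times\<close>).\<close>

definition mulw :: "'a set \<Rightarrow> ('a \<Rightarrow> nat) \<Rightarrow> bool" where
  "mulw A w \<longleftrightarrow> (\<forall>x\<in>A. w x > 0) \<and> (\<forall>m>0. finite {x \<in> A. w x = m}) \<and> card {x \<in> A. w x = 1} = 1 \<and>
     (\<forall>k>0. \<forall>l>0. coprime k l \<longrightarrow>
        card {x \<in> A. w x = k * l} = card {x \<in> A. w x = k} * card {x \<in> A. w x = l})"

lemma mulw_bij:
  assumes "mulw A w" "bij_betw f A B" "\<And>x. x \<in> A \<Longrightarrow> v (f x) = w x"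
  shows "mulw B v"
proof -
  have b: "bij_betw f {x \<in> A. w x = m} {y \<in> B. v y = m}" for m
  proof (rule bij_betw_subset[OF assms(2)])
    show "f ` {x \<in> A. w x = m} = {y \<in> B. v y = m}"
      using assms(2,3) by (auto simp: bij_betw_def)
  qed auto
  have "\<forall>y\<in>B. v y > 0" using assms by (auto simp: mulw_def bij_betw_def)
  thus ?thesis using assms(1) bij_betw_same_card[OF b] bij_betw_finite[OF b] by (simp add: mulw_def)
qed

definition fpairs :: "nat \<Rightarrow> (nat \<times> nat) set" where
  "fpairs m = {(d, e). d * e = m}"

lemma fpairs_dvd: "(d, e) \<in> fpairs m \<Longrightarrow> d dvd m" "(d, e) \<in> fpairs m \<Longrightarrow> e dvd m"
  unfolding fpairs_def by auto

lemma finite_fpairs: "m > 0 \<Longrightarrow> finite (fpairs m)"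
proof (rule finite_subset)
  assume "m > 0"
  thus "fpairs m \<subseteq> {..m} \<times> {..m}" by (auto simp: fpairs_def)
qed auto

text \<open>A factorisation of k l splits along the coprime factors, and its parts are recovered as
  gcds with k and l.\<close>

lemma fpairs_bij:
  assumes kl: "coprime k l" "k > 0" "l > 0"
  shows "bij_betw (\<lambda>((d, e), (d', e')). (d * d', e * e')) (fpairs k \<times> fpairs l) (fpairs (k * l))"
proof (rule bij_betw_imageI)
  have gcds: "gcd (d * d') k = d" "gcd (d * d') l = d'" if "d dvd k" "d' dvd l" for d d'
  proof -
    have *: "gcd (x * y) m = x" if "x dvd m" "coprime y m" for x y m :: nat
    proof (rule dvd_antisym)
      have "coprime (gcd (x * y) m) y" using that(2) coprime_divisors by (metis coprime_commute dvd_refl gcd_dvd2)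
      thus "gcd (x * y) m dvd x" by (metis coprime_dvd_mult_left_iff gcd_dvd1)
    qed (use that in auto)
    have "coprime d' k" "coprime d l" using that kl(1) coprime_divisors coprime_commute dvd_refl by metis+
    thus "gcd (d * d') k = d" "gcd (d * d') l = d'"
      using *[of d k d'] *[of d' l d] that by (simp_all add: mult.commute)
  qed
  show "inj_on (\<lambda>((d, e), (d', e')). (d * d', e * e')) (fpairs k \<times> fpairs l)"
  proof (rule inj_onI, clarify)
    fix d e d' e' a b a' b'
    assume "(d, e) \<in> fpairs k" "(d', e') \<in> fpairs l" "(a, b) \<in> fpairs k" "(a', b') \<in> fpairs l"
      and eq: "d * d' = a * a'" "e * e' = b * b'"
    hence "d dvd k" "e dvd k" "a dvd k" "b dvd k" "d' dvd l" "e' dvd l" "a' dvd l" "b' dvd l"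
      using fpairs_dvd by blast+
    thus "((d, e) = (a, b)) \<and> ((d', e') = (a', b'))" using gcds eq by (metis (no_types))
  qed
  show "(\<lambda>((d, e), (d', e')). (d * d', e * e')) ` (fpairs k \<times> fpairs l) = fpairs (k * l)"
  proof
    show "fpairs (k * l) \<subseteq> (\<lambda>((d, e), (d', e')). (d * d', e * e')) ` (fpairs k \<times> fpairs l)"
    proof clarify
      fix D E assume "(D, E) \<in> fpairs (k * l)"
      hence DE: "D * E = k * l" by (simp add: fpairs_def)
      obtain d d' where d: "D = d * d'" "d dvd k" "d' dvd l" using DE division_decomp by (metis dvd_triv_left)
      obtain e e' where e: "E = e * e'" "e dvd k" "e' dvd l" using DE division_decomp by (metis dvd_triv_right)
      have prod: "(d * e) * (d' * e') = k * l" using DE d e by (simp add: algebra_simps)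
      have "coprime d l" "coprime e l" "coprime d' k" "coprime e' k"
        using d e kl(1) coprime_divisors coprime_commute dvd_refl by metis+
      hence "coprime (d * e) l" "coprime (d' * e') k" by simp_all
      hence "d * e dvd k" "d' * e' dvd l"
        using prod by (metis coprime_dvd_mult_left_iff dvd_triv_left, metis coprime_dvd_mult_right_iff dvd_triv_right)
      hence "d * e = k" "d' * e' = l" using mult_eq_imp_eq_nat[OF prod] kl by blast+
      thus "(D, E) \<in> (\<lambda>((d, e), (d', e')). (d * d', e * e')) ` (fpairs k \<times> fpairs l)"
        using d e by (intro image_eqI[of _ _ "((d, e), (d', e'))"]) (auto simp: fpairs_def)
    qed
  qed (auto simp: fpairs_def algebra_simps)
qed

text \<open>The counting function of the product is the Dirichlet convolution of a and b.\<close>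

lemma mulw_Times:
  assumes A: "mulw A w" and B: "mulw B v"
  shows "mulw (A \<times> B) (\<lambda>(x, y). w x * v y)"
proof -
  define a b where "a d = card {x \<in> A. w x = d}" and "b d = card {x \<in> B. v x = d}" for d
  have eq: "{p \<in> A \<times> B. (\<lambda>(x, y). w x * v y) p = m} = (\<Union>(d, e)\<in>fpairs m. {x \<in> A. w x = d} \<times> {y \<in> B. v y = e})" for m
    by (auto simp: fpairs_def)
  have fin: "finite {x \<in> A. w x = d}" "finite {x \<in> B. v x = d}" if "d > 0" for d
    using A B that by (auto simp: mulw_def)
  have pos: "d > 0" "e > 0" if "(d, e) \<in> fpairs m" "m > 0" for d e m
    using that by (auto simp: fpairs_def)
  have card: "card {p \<in> A \<times> B. (\<lambda>(x, y). w x * v y) p = m} = (\<Sum>(d, e)\<in>fpairs m. a d * b e)" if m: "m > 0" for m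
  proof -
    have "card (\<Union>(d, e)\<in>fpairs m. {x \<in> A. w x = d} \<times> {y \<in> B. v y = e})
        = (\<Sum>p\<in>fpairs m. card (case p of (d, e) \<Rightarrow> {x \<in> A. w x = d} \<times> {y \<in> B. v y = e}))"
      by (rule card_UN_disjoint) (use finite_fpairs[OF m] fin pos m in \<open>auto split: prod.splits\<close>)
    thus ?thesis unfolding eq by (simp add: card_cartesian_product a_def b_def case_prod_unfold)
  qed
  show ?thesis
    unfolding mulw_def
  proof (intro conjI allI impI ballI)
    fix p assume "p \<in> A \<times> B"
    thus "(case p of (x, y) \<Rightarrow> w x * v y) > 0" using A B by (auto simp: mulw_def)
  next
    fix m :: nat assume m: "m > 0"
    show "finite {p \<in> A \<times> B. (case p of (x, y) \<Rightarrow> w x * v y) = m}"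
      unfolding eq using finite_fpairs[OF m] fin pos[OF _ m] by auto
  next
    have "fpairs 1 = {(1, 1)}" by (auto simp: fpairs_def)
    thus "card {p \<in> A \<times> B. (case p of (x, y) \<Rightarrow> w x * v y) = 1} = 1"
      using card[of 1] A B by (simp add: a_def b_def mulw_def)
  next
    fix k l :: nat assume kl: "k > 0" "l > 0" "coprime k l"
    have ab: "a (d * d') = a d * a d'" "b (d * d') = b d * b d'" if "d dvd k" "d' dvd l" for d d'
    proof -
      have "coprime d d'" using that kl(3) coprime_divisors by blast
      moreover have "d > 0" "d' > 0" using that kl by (auto intro: gr0I)
      ultimately show "a (d * d') = a d * a d'" "b (d * d') = b d * b d'"
        using A B by (simp_all add: mulw_def a_def b_def)
    qed
    have "(\<Sum>(d, e)\<in>fpairs (k * l). a d * b e)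
       = (\<Sum>p\<in>fpairs k \<times> fpairs l. (\<lambda>(d, e). a d * b e) ((\<lambda>((d, e), (d', e')). (d * d', e * e')) p))"
      by (rule sum.reindex_bij_betw[symmetric]) (rule fpairs_bij[OF kl(3,1,2)])
    also have "\<dots> = (\<Sum>p\<in>fpairs k \<times> fpairs l. (\<lambda>(d, e). a d * b e) (fst p) * (\<lambda>(d, e). a d * b e) (snd p))"
    proof (rule sum.cong[OF refl])
      fix p assume "p \<in> fpairs k \<times> fpairs l"
      then obtain d e d' e' where "p = ((d, e), (d', e'))" "d * e = k" "d' * e' = l"
        by (auto simp: fpairs_def)
      thus "(\<lambda>(d, e). a d * b e) ((\<lambda>((d, e), (d', e')). (d * d', e * e')) p)
          = (\<lambda>(d, e). a d * b e) (fst p) * (\<lambda>(d, e). a d * b e) (snd p)"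
        using ab by auto
    qed
    also have "\<dots> = (\<Sum>(d, e)\<in>fpairs k. a d * b e) * (\<Sum>(d, e)\<in>fpairs l. a d * b e)"
      by (simp add: sum_product sum.cartesian_product case_prod_unfold)
    finally show "card {p \<in> A \<times> B. (case p of (x, y) \<Rightarrow> w x * v y) = k * l} =
        card {p \<in> A \<times> B. (case p of (x, y) \<Rightarrow> w x * v y) = k} * card {p \<in> A \<times> B. (case p of (x, y) \<Rightarrow> w x * v y) = l}"
      using card kl by simp
  qed
qed

lemma mulw_subgroups:
  assumes X: "\<And>J. J \<in> X \<Longrightarrow> sgrp J" "\<And>J. J \<in> X \<Longrightarrow> idx UNIV J > 0" "UNIV \<in> X"
    and plus: "\<And>J k. J \<in> X \<Longrightarrow> k > 0 \<Longrightarrow> ssum J (izn k) \<in> X"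
    and int: "\<And>J1 J2. J1 \<in> X \<Longrightarrow> J2 \<in> X \<Longrightarrow> coprime (idx UNIV J1) (idx UNIV J2) \<Longrightarrow>
        idx UNIV J1 > 0 \<Longrightarrow> idx UNIV J2 > 0 \<Longrightarrow> J1 \<inter> J2 \<in> X"
  shows "mulw X (idx UNIV)"
  unfolding mulw_def
proof (intro conjI ballI allI impI)
  fix m :: nat assume "m > 0"
  from finite_subgroups_idx[OF this] show "finite {J \<in> X. idx UNIV J = m}"
    by (rule rev_finite_subset) (use X in auto)
next
  have "{J \<in> X. idx UNIV J = 1} = {UNIV}"
  proof (intro equalityI subsetI)
    fix J assume "J \<in> {J \<in> X. idx UNIV J = 1}"
    hence "J = UNIV" using idx_1_imp_eq[OF sgrp_UNIV X(1)[of J]] by simp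
    thus "J \<in> {UNIV}" by simp
  next
    fix J :: "ico set" assume "J \<in> {UNIV}"
    thus "J \<in> {J \<in> X. idx UNIV J = 1}" using X(3) idx_self[OF sgrp_UNIV] by simp
  qed
  thus "card {J \<in> X. idx UNIV J = 1} = 1" by simp
next
  fix k l :: nat assume "k > 0" "l > 0" "coprime k l"
  thus "card {J \<in> X. idx UNIV J = k * l} = card {J \<in> X. idx UNIV J = k} * card {J \<in> X. idx UNIV J = l}"
    using card_subgroups_mult[OF X(1) plus int] by blast
qed (use X in auto)

text \<open>n is represented by the ideal n I of index N(n)^4 to make \<open>mulw_subgroups\<close>
  applicable; sums and intersections of these ideals are given by gcd and lcm.\<close>

lemma mulw_ZA: "mulw ZA (\<lambda>n. qn n ^ 4)"
proof (rule mulw_bij)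
  define X where "X = iz ` ZA"
  have mem: "iz n \<in> X" if "n \<noteq> 0" for n
  proof -
    have "iz n = iz (normalize n)" by (intro Set.set_eqI) (simp only: iz_iff normalize_dvd_iff)
    thus ?thesis using that by (auto simp: X_def ZA_def)
  qed
  have XE: "\<exists>n. n \<noteq> 0 \<and> J = iz n" if "J \<in> X" for J
    using that by (auto simp: X_def ZA_def)
  show "mulw X (idx UNIV)"
  proof (rule mulw_subgroups)
    show "sgrp J" "idx UNIV J > 0" if "J \<in> X" for J
      using XE[OF that] by (auto simp: idx_iz_qn)
    have "iz 1 = UNIV" by (auto simp: iz_iff)
    thus "UNIV \<in> X" using mem[of 1] by simp
  next
    fix J and k :: nat assume J: "J \<in> X" "k > 0"
    then obtain n where n: "n \<noteq> 0" "J = iz n" using XE by blast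
    define g where "g = gcd n (of_nat k)"
    have "ssum (iz n) (izn k) = iz g"
    proof
      show "ssum (iz n) (izn k) \<subseteq> iz g"
        by (rule ssum_least) (auto simp: iz_iff g_def intro: dvd_trans[OF gcd_dvd1] dvd_trans[OF gcd_dvd2])
      show "iz g \<subseteq> ssum (iz n) (izn k)"
      proof
        fix x assume "x \<in> iz g"
        then obtain y where y: "x = zi g * y" by blast
        obtain u v where "u * n + v * of_nat k = g"
          using bezout_coefficients_fst_snd unfolding g_def by blast
        hence "x = zi (n * u + of_nat k * v) * y" unfolding y by (simp only: mult.commute[of _ u] mult.commute[of _ v])
        also have "\<dots> = zi n * (zi u * y) + zi (of_nat k) * (zi v * y)"
          by (simp only: zi_simps distrib_right mult.assoc)
        finally have "x = zi n * (zi u * y) + zi (of_nat k) * (zi v * y)" .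
        thus "x \<in> ssum (iz n) (izn k)" unfolding ssum_def by blast
      qed
    qed
    moreover have "g \<noteq> 0" using n by (simp add: g_def)
    ultimately show "ssum J (izn k) \<in> X" using n mem by simp
  next
    fix J1 J2 assume "J1 \<in> X" "J2 \<in> X"
    then obtain m n where mn: "m \<noteq> 0" "n \<noteq> 0" "J1 = iz m" "J2 = iz n" using XE by metis
    have "iz m \<inter> iz n = iz (lcm m n)" 
      by (intro Set.set_eqI) (unfold Int_iff iz_iff lcm_least_iff, blast)
    moreover have "lcm m n \<noteq> 0" using mn by (simp add: lcm_eq_0_iff)
    ultimately show "J1 \<inter> J2 \<in> X" using mn mem by simp
  qed
  have inj: "inj_on iz ZA"
  proof (rule inj_onI)
    fix m n assume mn: "m \<in> ZA" "n \<in> ZA" and eq: "iz m = iz n"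
    have "zi m \<in> iz n" "zi n \<in> iz m" using eq LI_mem[of "zi m"] LI_mem[of "zi n"] unfolding LI_zi by blast+
    hence "n dvd m" "m dvd n" by (simp_all add: iz_iff)
    thus "m = n" using ZA_dvd_antisym mn by blast
  qed
  thus "bij_betw (the_inv_into ZA iz) X ZA"
    unfolding X_def by (intro bij_betw_the_inv_into bij_betw_imageI) auto
  show "qn (the_inv_into ZA iz J) ^ 4 = idx UNIV J" if "J \<in> X" for J
  proof -
    obtain n where "n \<in> ZA" "J = iz n" using \<open>J \<in> X\<close> by (auto simp: X_def)
    hence "the_inv_into ZA iz J = n" using the_inv_into_f_f[OF inj] by metis
    thus ?thesis using \<open>n \<in> ZA\<close> \<open>J = iz n\<close> by (simp add: idx_iz_qn ZA_def)
  qed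
qed

lemma idx_PL_pos: "P \<in> PL \<Longrightarrow> idx UNIV P > 0"
  using PL_generator[of P] by (auto simp: idx_LI_qn)

text \<open>Ideals above a primitive one are primitive. For coprime indices k, l suppose \<pi> I
  contains J1 \<inter> J2. Then N(\<pi>)^4 divides k l, so the rational prime p above which \<pi>
  lies divides k, say. Hence k I lies in \<pi> I, and so does J1 = (J1 \<inter> J2) + k I.\<close>

lemma mulw_PL: "mulw PL (idx UNIV)"
proof (rule mulw_subgroups)
  show "sgrp J" "idx UNIV J > 0" if "J \<in> PL" for J
    using that idx_PL_pos by (auto simp: PL_def lid_def)
  have "primset UNIV"
    unfolding primset_def
  proof (intro allI impI)
    fix n assume "UNIV \<subseteq> iz n"
    hence "1 \<in> iz n" by blast
    thus "n dvd 1" by (simp add: iz_iff)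
  qed
  thus "UNIV \<in> PL" by (simp add: PL_def lid_def)
next
  fix J k assume J: "J \<in> PL" "(k::nat) > 0"
  have "J \<subseteq> ssum J (izn k)" by (rule ssum_upper1) simp
  thus "ssum J (izn k) \<in> PL" using J unfolding PL_def primset_def
    by (auto intro!: lid_ssum)
next
  fix J1 J2 assume J: "J1 \<in> PL" "J2 \<in> PL" and cop: "coprime (idx UNIV J1) (idx UNIV J2)"
    and pos: "idx UNIV J1 > 0" "idx UNIV J2 > 0"
  define k l where "k = idx UNIV J1" and "l = idx UNIV J2"
  have s: "sgrp J1" "sgrp J2" "lid J1" "lid J2" using J by (auto simp: PL_def lid_def)
  have ind: "idx UNIV (J1 \<inter> J2) = k * l" "ssum (J1 \<inter> J2) (izn k) = J1"
    using idx_Int_coprime[OF s(1,2)] cop pos by (auto simp: k_def l_def)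
  have ind': "ssum (J1 \<inter> J2) (izn l) = J2"
    using idx_Int_coprime(2)[OF s(2,1) _ _ _ pos(2,1)] cop by (auto simp: l_def coprime_commute Int_commute)
  have "primset (J1 \<inter> J2)"
    unfolding primset_def
  proof (intro allI impI, rule ccontr)
    fix n assume sub: "J1 \<inter> J2 \<subseteq> iz n" and n: "\<not> n dvd 1"
    have dvd: "qn n ^ 4 dvd k * l" if "n \<noteq> 0" "J1 \<inter> J2 \<subseteq> iz n" for n
      using idx_dvd_mono[OF sgrp_Int[OF s(1,2)] sgrp_iz that(2)] idx_iz_qn[OF that(1)] ind(1) by simp
    have "n \<noteq> 0"
    proof
      assume "n = 0"
      have "izn (k * l) \<subseteq> J1 \<inter> J2" using izn_subset[OF sgrp_Int[OF s(1,2)]] unfolding ind(1) .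
      hence "izn (k * l) \<subseteq> iz 0" using sub unfolding \<open>n = 0\<close> by (rule subset_trans)
      hence "zi (of_nat (k * l)) \<in> iz 0" using LI_mem[of "zi (of_nat (k * l))"] unfolding LI_zi by blast
      hence "(of_nat (k * l) :: zt) = 0" by (simp add: iz_iff)
      thus False using pos unfolding k_def l_def by (simp only: of_nat_eq_0_iff) simp
    qed
    then obtain \<pi> where \<pi>: "prime \<pi>" "\<pi> dvd n" using n prime_divisor_exists by blast
    have pe: "prime_elem \<pi>" using \<pi> by auto
    have sub\<pi>: "J1 \<inter> J2 \<subseteq> iz \<pi>" using sub \<pi>(2) unfolding subset_iff iz_iff by (meson dvd_trans)
    obtain p where p: "prime p" "\<pi> dvd of_nat p" using prime_elem_divides_rational_prime[OF pe] by blast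
    obtain r where "of_nat p = \<pi> * r" using p(2) by blast
    hence "qn (of_nat p) = qn \<pi> * qn r" by (simp only: qn_mult)
    hence "qn \<pi> dvd qn (of_nat p)" by simp
    hence "qn \<pi> dvd p ^ 2" by simp
    then obtain i where i: "qn \<pi> = p ^ i" using p(1) divides_primepow_nat by blast
    have "\<not> \<pi> dvd 1" "\<pi> \<noteq> 0" using pe by auto
    hence "i \<noteq> 0" using i qn_gt_1[of \<pi>] by (cases i) auto
    hence "p dvd qn \<pi> ^ 4" unfolding i by (simp add: dvd_power flip: power_mult)
    hence "p dvd k * l" using dvd[OF \<open>\<pi> \<noteq> 0\<close> sub\<pi>] by (rule dvd_trans)
    hence "p dvd k \<or> p dvd l" using p(1) by (simp add: prime_dvd_mult_iff)
    hence "izn k \<subseteq> iz \<pi> \<or> izn l \<subseteq> iz \<pi>"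
    proof -
      have "izn m \<subseteq> iz \<pi>" if "p dvd m" for m
      proof -
        have "\<pi> dvd of_nat m" using that p(2) by (metis dvd_trans of_nat_dvd_iff of_nat_mult dvd_def)
        thus ?thesis unfolding subset_iff iz_iff by (meson dvd_trans)
      qed
      thus ?thesis using \<open>p dvd k \<or> p dvd l\<close> by blast
    qed
    hence "J1 \<subseteq> iz \<pi> \<or> J2 \<subseteq> iz \<pi>"
      using ssum_least[OF sgrp_iz sub\<pi>] ind(2) ind' by metis
    hence "\<pi> dvd 1" using J by (auto simp: PL_def primset_def)
    thus False using pe by auto
  qed
  thus "J1 \<inter> J2 \<in> PL" using s by (simp add: PL_def lid_Int)
qed

theorem mulw_SS: "mulw SS (idx UNIV)"
proof (rule mulw_bij)
  show "mulw (ZA \<times> PL \<times> PL) (\<lambda>(n, P). qn n ^ 4 * (\<lambda>(P, Q). idx UNIV P * idx UNIV Q) P)"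
    by (intro mulw_Times mulw_ZA mulw_PL)
  show "bij_betw (\<lambda>(n, P, Q). SMod n P Q) (ZA \<times> PL \<times> PL) SS"
    unfolding SS_def by (intro bij_betw_imageI inj_SMod refl)
qed (auto simp: idx_SMod)

text \<open>n cj(p) I q has index N(n^2 nr(p) nr(q))^2. Conversely I a with nr a associated to n is
  an SSM of index N(n)^2.\<close>

lemma SS_index:
  "idx UNIV ` SS = {m. \<exists>n. n \<noteq> 0 \<and> m = (qn n)\<^sup>2}"
proof (intro equalityI subsetI)
  fix m assume "m \<in> idx UNIV ` SS"
  then obtain n P Q where *: "n \<in> ZA" "P \<in> PL" "Q \<in> PL" "m = idx UNIV (SMod n P Q)"
    by (auto simp: SS_def)
  obtain p q where p: "P = LI p" "p \<noteq> 0" and q: "Q = LI q" "q \<noteq> 0" using PL_generator * by metis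
  have "m = (qn (n\<^sup>2 * (nr p * nr q)))\<^sup>2"
    using * p q idx_SMod[of n P Q] by (simp add: idx_LI_qn qn_mult power_mult_distrib power2_eq_square eval_nat_numeral)
  moreover have "n\<^sup>2 * (nr p * nr q) \<noteq> 0" using * p q by (simp add: ZA_def)
  ultimately show "m \<in> {m. \<exists>n. n \<noteq> 0 \<and> m = (qn n)\<^sup>2}" by blast
next
  fix m assume "m \<in> {m. \<exists>n. n \<noteq> 0 \<and> m = (qn n)\<^sup>2}"
  then obtain n where n: "n \<noteq> 0" "m = (qn n)\<^sup>2" by blast
  obtain a where a: "normalize (nr a) = normalize n" using nr_surj_assoc by blast
  have a0: "a \<noteq> 0" using a n by auto
  have eq: "{y. zi 1 * y \<in> range (\<lambda>x. 1 * x * a)} = LI a" by (simp add: zi_simps)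
  have "LI a \<in> SS"
    unfolding eq[symmetric] by (rule SS_I) (use a0 in \<open>auto simp: iz_iff\<close>)
  moreover have "idx UNIV (LI a) = m" using idx_LI_qn[OF a0] n qn_cong[OF a] by simp
  ultimately show "m \<in> idx UNIV ` SS" by blast
qed

section \<open>Dirichlet series\<close>

abbreviation absconv :: "('a \<Rightarrow> 'b::real_normed_vector) \<Rightarrow> 'a set \<Rightarrow> bool" (infix "absconv'_on" 46) where
  "f absconv_on A \<equiv> (\<lambda>x. norm (f x)) summable_on A"

definition npow :: "nat \<Rightarrow> complex \<Rightarrow> complex" where
  "npow m s = of_nat m powr (- s)"

lemma norm_npow: "norm (npow m s) = real m powr (- Re s)"
  using norm_powr_real_powr[of "of_nat m" "- s"] by (simp add: npow_def)

lemma npow_mult: "npow (m * n) s = npow m s * npow n s"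
  unfolding npow_def using powr_times_real[of "of_nat m" "of_nat n" "- s"] by simp

lemma npow_power: "m > 0 \<Longrightarrow> npow (m ^ k) s = npow m (of_nat k * s)"
proof (induction k)
  case (Suc k)
  have "npow (m ^ Suc k) s = npow m s * npow (m ^ k) s" by (simp add: npow_mult)
  also have "\<dots> = of_nat m powr (- s) * of_nat m powr (- (of_nat k * s))"
    using Suc by (simp add: npow_def)
  also have "\<dots> = npow m (of_nat (Suc k) * s)"
    by (simp add: npow_def algebra_simps flip: powr_add)
  finally show ?case .
qed (simp add: npow_def)

lemma of_nat_mult_npow: "m > 0 \<Longrightarrow> of_nat m * npow m s = npow m (s - 1)"
proof -
  assume m: "m > 0"
  have "npow m (s - 1) = of_nat m powr (1 + - s)" by (simp add: npow_def)
  also have "\<dots> = of_nat m powr 1 * of_nat m powr (- s)" by (rule powr_add)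
  also have "\<dots> = of_nat m * npow m s" using m by (simp add: npow_def)
  finally show ?thesis ..
qed

lemma abs_summable_Times:
  fixes f :: "'a \<Rightarrow> complex" and g :: "'b \<Rightarrow> complex"
  assumes f: "f absconv_on A" and g: "g absconv_on B"
  shows "(\<lambda>p. f (fst p) * g (snd p)) absconv_on (A \<times> B)"
    "infsum (\<lambda>p. f (fst p) * g (snd p)) (A \<times> B) = infsum f A * infsum g B"
proof -
  show 1: "(\<lambda>p. f (fst p) * g (snd p)) absconv_on (A \<times> B)"
    unfolding Infinite_Sum.abs_summable_on_Sigma_iff
  proof (intro conjI ballI)
    fix x
    show "(\<lambda>y. f (fst (x, y)) * g (snd (x, y))) absconv_on B"
      using summable_on_cmult_right[OF g, of "norm (f x)"] by (simp add: norm_mult)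
    have "(\<lambda>x. norm (f x) * infsum (\<lambda>y. norm (g y)) B) summable_on A"
      by (rule summable_on_cmult_left[OF f])
    hence "(\<lambda>x. norm (norm (f x) * infsum (\<lambda>y. norm (g y)) B)) summable_on A"
      by (rule summable_on_iff_abs_summable_on_real[THEN iffD1])
    thus "(\<lambda>x. \<Sum>\<^sub>\<infinity>y\<in>B. norm (f (fst (x, y)) * g (snd (x, y)))) absconv_on A"
      by (simp add: norm_mult infsum_cmult_right')
  qed
  show "infsum (\<lambda>p. f (fst p) * g (snd p)) (A \<times> B) = infsum f A * infsum g B"
    using infsum_Sigma_banach[OF abs_summable_summable[OF 1]]
    by (simp add: infsum_cmult_right' infsum_cmult_left')
qed

lemma absconv_cong:
  assumes "\<And>x. x \<in> A \<Longrightarrow> f x = g x"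
  shows "f absconv_on A \<longleftrightarrow> g absconv_on A"
  by (intro summable_on_cong) (simp add: assms)

lemma abs_summable_reindex_bij_betw:
  assumes "bij_betw h A B"
  shows "(\<lambda>x. f (h x)) absconv_on A \<longleftrightarrow> f absconv_on B"
  using summable_on_reindex_bij_betw[OF assms, of "\<lambda>x. norm (f x)"] .

subsection \<open>Convergence of the zeta function of the golden field\<close>

lemma summable_on_int_powr:
  assumes "\<sigma> > 1"
  shows "(\<lambda>k :: int. real_of_int (max 1 \<bar>k\<bar>) powr (- \<sigma>)) summable_on UNIV"
proof -
  have "summable (\<lambda>n. of_nat n powr - \<sigma> :: real)" using assms by (simp add: summable_real_powr_iff)
  hence "summable (\<lambda>n. real (Suc n) powr - \<sigma>)" by (subst summable_Suc_iff) 
  hence "(\<lambda>n. real (Suc n) powr - \<sigma>) summable_on UNIV"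
    by (subst summable_on_UNIV_nonneg_real_iff) auto
  hence 1: "(\<lambda>k :: int. real_of_int (max 1 \<bar>k\<bar>) powr (- \<sigma>)) summable_on range (\<lambda>n. int (Suc n))"
    and 2: "(\<lambda>k :: int. real_of_int (max 1 \<bar>k\<bar>) powr (- \<sigma>)) summable_on range (\<lambda>n. - int (Suc n))"
    by (subst summable_on_reindex; force simp: inj_def o_def algebra_simps)+
  have disj: "range (\<lambda>n. int (Suc n)) \<inter> range (\<lambda>n. - int (Suc n)) = {}" by auto
  have "(\<lambda>k :: int. real_of_int (max 1 \<bar>k\<bar>) powr (- \<sigma>)) summable_on
      ((range (\<lambda>n. int (Suc n)) \<union> range (\<lambda>n. - int (Suc n))) \<union> {0})"
    by (rule summable_on_Un_disjoint[OF summable_on_Un_disjoint[OF 1 2 disj]]) auto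
  also have "(range (\<lambda>n. int (Suc n)) \<union> range (\<lambda>n. - int (Suc n))) \<union> {0} = UNIV"
  proof -
    have "k \<in> (range (\<lambda>n. int (Suc n)) \<union> range (\<lambda>n. - int (Suc n))) \<union> {0}" for k
    proof (cases "k = 0")
      case False
      hence "k = int (Suc (nat (\<bar>k\<bar> - 1))) \<or> k = - int (Suc (nat (\<bar>k\<bar> - 1)))" by auto
      thus ?thesis by blast
    qed simp
    thus ?thesis by blast
  qed
  finally show ?thesis .
qed

text \<open>Squared length in the Minkowski embedding, see \<open>zlen_real\<close>.\<close>

definition zlen :: "zt \<Rightarrow> int" where
  "zlen x = 2 * (zre x)\<^sup>2 + 2 * (zre x * zim x) + 3 * (zim x)\<^sup>2"

lemma zlen_real: "real_of_int (zlen x) = (of_zt x)\<^sup>2 + (of_zt (zconj x))\<^sup>2"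
proof -
  have "(of_zt x)\<^sup>2 + (of_zt (zconj x))\<^sup>2 = of_zt (x * x + zconj (x * x))"
    by (simp add: power2_eq_square zconj_simps)
  also have "x * x + zconj (x * x) = of_int (zlen x)"
    by (simp add: zt_eq_iff zlen_def power2_eq_square algebra_simps)
  finally show ?thesis by simp
qed

text \<open>Among the generators of a principal ideal, the one with the shortest pair of embeddings has
  embeddings of comparable size, since it cannot be shortened by the units \<open>\<tau>\<close> and \<open>\<tau>\<^sup>-\<^sup>1\<close>.\<close>

lemma balanced_generator:
  assumes "n \<noteq> 0"
  obtains r where "normalize r = normalize n" "zlen r \<le> 4 * int (qn n)"
proof -
  obtain r where r: "normalize r = normalize n"
    and min: "\<And>y. normalize y = normalize n \<Longrightarrow> nat (zlen r) \<le> nat (zlen y)"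
    using ex_has_least_nat[of "\<lambda>r. normalize r = normalize n" n "\<lambda>r. nat (zlen r)"] by blast
  have pos: "zlen y \<ge> 0" for y
    using zlen_real[of y] by (metis of_int_0_le_iff sum_power2_ge_zero)
  have min': "real_of_int (zlen r) \<le> real_of_int (zlen (r * u))" if "u dvd 1" for u
  proof -
    have "normalize (r * u) = normalize n" using r that by (simp add: normalize_mult_unit_right)
    from min[OF this] show ?thesis using pos[of r] pos[of "r * u"] by simp
  qed
  define x y where "x = of_zt r" and "y = of_zt (zconj r)"
  have tt: "ztau * (ztau - 1) = 1" by (simp add: zt_eq_iff)
  have units: "ztau dvd 1" "ztau - 1 dvd 1" by (metis tt dvd_triv_left, metis tt dvd_triv_right)
  have cj: "of_zt (zconj ztau) = 1 - tau" "of_zt (zconj (ztau - 1)) = - tau"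
    by (simp_all add: of_zt_def tau_def field_simps)
  have t2: "tau\<^sup>2 = tau + 1" using tau_square by (simp add: power2_eq_square)
  \<comment> \<open>Multiplying r by \<tau> scales the embeddings by \<tau> and 1 - \<tau>.
    Minimality gives (\<tau> - 1) y^2 \<le> \<tau> x^2, that is y^2 \<le> \<tau>^2 x^2, and \<tau> <
    2. The unit \<tau> - 1 gives the reverse bound.\<close>
  have "x\<^sup>2 + y\<^sup>2 \<le> tau\<^sup>2 * x\<^sup>2 + (1 - tau)\<^sup>2 * y\<^sup>2"
    using min'[OF units(1)] unfolding zlen_real
    by (simp add: zconj_simps cj power_mult_distrib x_def y_def mult.commute)
  hence "x\<^sup>2 + y\<^sup>2 \<le> (tau + 1) * x\<^sup>2 + (2 - tau) * y\<^sup>2"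
    by (simp add: power2_diff t2)
  hence "tau * (tau - 1) * y\<^sup>2 \<le> tau * tau * x\<^sup>2"
    using mult_left_mono[of "(tau - 1) * y\<^sup>2" "tau * x\<^sup>2" tau] tau_bounds by (simp add: algebra_simps)
  moreover have tt': "tau * (tau - 1) = 1" using tau_square by (simp add: algebra_simps)
  moreover have "tau * tau * z\<^sup>2 \<le> 2 * 2 * z\<^sup>2" for z
    using tau_bounds by (intro mult_right_mono mult_mono) auto
  ultimately have yx: "y\<^sup>2 \<le> (2 * x)\<^sup>2" by (simp add: power_mult_distrib) (meson order_trans)
  have "x\<^sup>2 + y\<^sup>2 \<le> (tau - 1)\<^sup>2 * x\<^sup>2 + tau\<^sup>2 * y\<^sup>2"
    using min'[OF units(2)] unfolding zlen_real
    by (simp only: zconj_simps(3) of_zt_simps(6) cj power_mult_distrib x_def y_def power2_minus of_zt_simps)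
      (simp add: mult.commute)
  hence "x\<^sup>2 + y\<^sup>2 \<le> (2 - tau) * x\<^sup>2 + (tau + 1) * y\<^sup>2"
    by (simp add: power2_diff t2)
  hence "tau * (tau - 1) * x\<^sup>2 \<le> tau * tau * y\<^sup>2"
    using mult_left_mono[of "(tau - 1) * x\<^sup>2" "tau * y\<^sup>2" tau] tau_bounds by (simp add: algebra_simps)
  moreover have "tau * tau * y\<^sup>2 \<le> 2 * 2 * y\<^sup>2"
    using tau_bounds by (intro mult_right_mono mult_mono) auto
  ultimately have xy: "x\<^sup>2 \<le> (2 * y)\<^sup>2" using tt' by (simp add: power_mult_distrib)
  have "\<bar>y\<bar> \<le> \<bar>2 * x\<bar>" "\<bar>x\<bar> \<le> \<bar>2 * y\<bar>"
    using yx xy unfolding abs_le_square_iff by blast+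
  hence a: "\<bar>y\<bar> \<le> 2 * \<bar>x\<bar>" "\<bar>x\<bar> \<le> 2 * \<bar>y\<bar>"
    by (simp_all add: abs_mult)
  have "x\<^sup>2 \<le> 2 * \<bar>x * y\<bar>" "y\<^sup>2 \<le> 2 * \<bar>x * y\<bar>"
    using mult_left_mono[OF a(2), of "\<bar>x\<bar>"] mult_left_mono[OF a(1), of "\<bar>y\<bar>"]
    by (simp_all add: abs_mult power2_eq_square mult_ac)
  hence "real_of_int (zlen r) \<le> 4 * \<bar>x * y\<bar>" by (simp add: zlen_real x_def y_def)
  also have "\<bar>x * y\<bar> = real_of_int \<bar>znorm r\<bar>" by (simp add: x_def y_def of_zt_zconj_mult)
  also have "\<bar>znorm r\<bar> = int (qn n)" using qn_cong[OF r] by (simp add: qn_def)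
  finally have "zlen r \<le> 4 * int (qn n)" by linarith
  thus ?thesis using that r by blast
qed

text \<open>The maxima with 1 keep the product form of the bound when a coordinate vanishes, so that
  the comparison series is a product of two series over Z.\<close>

lemma zlen_lower:
  assumes "x \<noteq> 0"
  shows "max 1 \<bar>zre x\<bar> * max 1 \<bar>zim x\<bar> \<le> zlen x"
proof -
  define a b where "a = \<bar>zre x\<bar>" and "b = \<bar>zim x\<bar>"
  have "zlen x = (zre x + zim x)\<^sup>2 + (zre x)\<^sup>2 + 2 * (zim x)\<^sup>2"
    by (simp add: zlen_def power2_eq_square algebra_simps)
  hence le: "a\<^sup>2 + b\<^sup>2 \<le> zlen x" by (simp add: a_def b_def)
  have ab: "a \<ge> 0" "b \<ge> 0" "a \<noteq> 0 \<or> b \<noteq> 0" using assms by (auto simp: a_def b_def zt_eq_iff)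
  define c where "c = max a b"
  have "max 1 a * max 1 b \<le> c * c"
    using ab by (intro mult_mono) (auto simp: c_def)
  also have "c * c \<le> a\<^sup>2 + b\<^sup>2" by (auto simp: c_def max_def power2_eq_square)
  finally show ?thesis using le by (simp add: a_def b_def)
qed

text \<open>A balanced generator with coordinates a, b has N(n) \<ge> max(1,|a|) max(1,|b|) / 4. So
  the sum over ideals is dominated by 4^\<sigma> times the square of a convergent sum over
  Z.\<close>

lemma zeta_abs_summable:
  assumes "Re s > 1"
  shows "(\<lambda>n. npow (qn n) s) absconv_on ZA"
proof -
  define \<sigma> where "\<sigma> = Re s"
  have \<sigma>: "\<sigma> > 1" using assms by (simp add: \<sigma>_def)
  have "\<forall>n\<in>ZA. \<exists>r. normalize r = normalize n \<and> zlen r \<le> 4 * int (qn n)"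
    using balanced_generator by (metis (mono_tags, lifting) ZA_def mem_Collect_eq)
  then obtain r where r: "\<And>n. n \<in> ZA \<Longrightarrow> normalize (r n) = normalize n"
      "\<And>n. n \<in> ZA \<Longrightarrow> zlen (r n) \<le> 4 * int (qn n)"
    by metis
  define h where "h n = (zre (r n), zim (r n))" for n
  define F where "F k = real_of_int (max 1 \<bar>k\<bar>) powr (- \<sigma>)" for k
  have inj: "inj_on h ZA"
  proof (rule inj_onI)
    fix m n assume mn: "m \<in> ZA" "n \<in> ZA" "h m = h n"
    hence "r m = r n" by (simp add: h_def zt_eq_iff)
    hence "normalize m = normalize n" using r(1) mn by metis
    thus "m = n" using mn by (simp add: ZA_def)
  qed
  have "(\<lambda>k. complex_of_real (F k)) absconv_on UNIV"
    using summable_on_int_powr[OF \<sigma>] by (simp add: F_def)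
  from abs_summable_Times(1)[OF this this]
  have "(\<lambda>p. F (fst p) * F (snd p)) summable_on UNIV"
    by (simp add: norm_mult F_def)
  hence "(\<lambda>p. F (fst p) * F (snd p)) summable_on (h ` ZA)"
    by (rule summable_on_subset_banach) auto
  hence "(\<lambda>n. F (fst (h n)) * F (snd (h n))) summable_on ZA"
    by (subst (asm) summable_on_reindex[OF inj]) (simp add: o_def)
  hence "(\<lambda>n. 4 powr \<sigma> * (F (fst (h n)) * F (snd (h n)))) summable_on ZA"
    by (rule summable_on_cmult_right)
  thus ?thesis
  proof (rule Infinite_Sum.abs_summable_on_comparison_test')
    fix n assume n: "n \<in> ZA"
    have rn: "r n \<noteq> 0" using r(1)[OF n] n by (auto simp: ZA_def)
    define M where "M = max 1 \<bar>zre (r n)\<bar> * max 1 \<bar>zim (r n)\<bar>"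
    have "M \<le> 4 * int (qn n)" using zlen_lower[OF rn] r(2)[OF n] by (simp add: M_def)
    hence le: "real_of_int M / 4 \<le> real (qn n)" by linarith
    have M: "M > 0" by (simp add: M_def)
    have "norm (npow (qn n) s) = real (qn n) powr (- \<sigma>)" by (simp add: norm_npow \<sigma>_def)
    also have "\<dots> \<le> (real_of_int M / 4) powr (- \<sigma>)"
      using le M \<sigma> by (intro powr_mono2') auto
    also have "\<dots> = 4 powr \<sigma> * real_of_int M powr (- \<sigma>)"
      using M by (simp add: powr_divide powr_minus field_simps)
    also have "real_of_int M powr (- \<sigma>) = F (fst (h n)) * F (snd (h n))"
      by (simp add: M_def F_def h_def powr_mult)
    finally show "norm (npow (qn n) s) \<le> 4 powr \<sigma> * (F (fst (h n)) * F (snd (h n)))" .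
  qed
qed

section \<open>Zeta functions as sums over ideals\<close>

definition zetaK :: "complex \<Rightarrow> complex" where
  "zetaK s = (\<Sum>\<^sub>\<infinity>n\<in>ZA. npow (qn n) s)"

definition zetaI :: "complex \<Rightarrow> complex" where
  "zetaI s = (\<Sum>\<^sub>\<infinity>J\<in>LL. npow (idx UNIV J) s)"

definition zetaP :: "complex \<Rightarrow> complex" where
  "zetaP s = (\<Sum>\<^sub>\<infinity>P\<in>PL. npow (idx UNIV P) s)"

subsection \<open>The zeta function of the icosian ring\<close>

lemma bij_divisor_pairs:
  "bij_betw (\<lambda>(d, e). (normalize (d * e), d)) (ZA \<times> ZA) (Sigma ZA zdivs)"
proof (rule bij_betw_imageI)
  show "inj_on (\<lambda>(d, e). (normalize (d * e), d)) (ZA \<times> ZA)"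
  proof (rule inj_onI)
    fix p p' assume "p \<in> ZA \<times> ZA" "p' \<in> ZA \<times> ZA"
      and eq: "(\<lambda>(d, e). (normalize (d * e), d)) p = (\<lambda>(d, e). (normalize (d * e), d)) p'"
    then obtain d e e' where p: "p = (d, e)" "p' = (d, e')" "d \<in> ZA" "e \<in> ZA" "e' \<in> ZA"
      by (cases p; cases p') auto
    hence "normalize (d * e) = normalize (d * e')" using eq by simp
    hence "d * e dvd d * e'" "d * e' dvd d * e" using associatedD1 associatedD2 by blast+
    hence "e dvd e'" "e' dvd e" using p by (simp_all add: ZA_def)
    thus "p = p'" using p ZA_dvd_antisym by simp
  qed
  show "(\<lambda>(d, e). (normalize (d * e), d)) ` (ZA \<times> ZA) = Sigma ZA zdivs"
  proof
    show "(\<lambda>(d, e). (normalize (d * e), d)) ` (ZA \<times> ZA) \<subseteq> Sigma ZA zdivs"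
      by (auto simp: ZA_def zdivs_def)
    show "Sigma ZA zdivs \<subseteq> (\<lambda>(d, e). (normalize (d * e), d)) ` (ZA \<times> ZA)"
    proof
      fix p assume "p \<in> Sigma ZA zdivs"
      then obtain n d where p: "p = (n, d)" "n \<in> ZA" "d \<in> zdivs n" by blast
      then obtain e where e: "n = d * e" by (auto simp: zdivs_def)
      have "normalize (d * normalize e) = n" using p e by (simp add: ZA_def)
      moreover have "d \<in> ZA" "normalize e \<in> ZA" using p e by (auto simp: ZA_def zdivs_def)
      ultimately show "p \<in> (\<lambda>(d, e). (normalize (d * e), d)) ` (ZA \<times> ZA)"
        using p(1) by (intro image_eqI[of _ _ "(d, normalize e)"]) auto
    qed
  qed
qed

lemma bij_LL_FI: "bij_betw snd (Sigma ZA FI) LL"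
proof (rule bij_betw_imageI)
  show "inj_on snd (Sigma ZA FI)"
  proof (rule inj_onI)
    fix p p' assume "p \<in> Sigma ZA FI" "p' \<in> Sigma ZA FI" "snd p = snd p'"
    then obtain m n J where p: "p = (m, J)" "p' = (n, J)" "m \<in> ZA" "n \<in> ZA" "J \<in> FI m" "J \<in> FI n"
      by (cases p; cases p') auto
    then obtain a where "J = LI a" "normalize (nr a) = normalize m" unfolding FI_def by blast
    hence "normalize m = normalize n" using p(6) FI_LI by metis
    thus "p = p'" using p by (simp add: ZA_def)
  qed
  show "snd ` Sigma ZA FI = LL"
  proof (intro equalityI subsetI)
    fix J assume "J \<in> snd ` Sigma ZA FI"
    then obtain n where n: "n \<in> ZA" "J \<in> FI n" by force
    then obtain a where a: "J = LI a" "normalize (nr a) = normalize n" unfolding FI_def by blast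
    hence "a \<noteq> 0" using n by (auto simp: ZA_def)
    thus "J \<in> LL" using a LI_mem[of a] unfolding LL_def by (metis (mono_tags) lid_LI mem_Collect_eq singletonD)
  next
    fix J assume J: "J \<in> LL"
    then obtain a where a: "J = LI a" using lid_principal unfolding LL_def by blast
    have "LI 0 = {0}" by auto
    hence "a \<noteq> 0" using J a unfolding LL_def by blast
    hence "normalize (nr a) \<in> ZA" by (simp add: ZA_def)
    moreover have "J \<in> FI (normalize (nr a))" unfolding a FI_LI by simp
    ultimately show "J \<in> snd ` Sigma ZA FI" by force
  qed
qed

lemma idx_FI: "n \<in> ZA \<Longrightarrow> J \<in> FI n \<Longrightarrow> idx UNIV J = (qn n)\<^sup>2"
proof -
  assume n: "n \<in> ZA" "J \<in> FI n"
  then obtain a where a: "J = LI a" "normalize (nr a) = normalize n" unfolding FI_def by blast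
  hence "a \<noteq> 0" using n by (auto simp: ZA_def)
  thus ?thesis using a idx_LI_qn qn_cong[OF a(2)] by simp
qed

text \<open>Ideals and divisors are matched only through their numbers: the sigma(n) ideals of norm
  n contribute sigma(n) N(n)^(-2s), and with n = d e the divisor d contributes N(d)^(1-2s)
  N(e)^(-2s). Absolute convergence moves from the divisor side to the ideal side.\<close>

lemma zetaI_product:
  assumes "Re s > 1"
  shows "(\<lambda>J. npow (idx UNIV J) s) absconv_on LL"
    "zetaI s = zetaK (2 * s) * zetaK (2 * s - 1)"
proof -
  define g where "g p = of_nat (qn (snd p)) * npow (qn (fst p)) (2 * s)" for p
  define f where "f p = npow (idx UNIV (snd p)) s" for p :: "zt \<times> ico set"
  have conv: "Re (2 * s - 1) > 1" "Re (2 * s) > 1" using assms by simp_all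
  have q: "qn d > 0" if "d \<in> ZA" for d using that by (simp add: ZA_def)
  have gh: "g ((\<lambda>(d, e). (normalize (d * e), d)) p) = npow (qn (fst p)) (2 * s - 1) * npow (qn (snd p)) (2 * s)"
    if "p \<in> ZA \<times> ZA" for p
    using that q by (auto simp: g_def qn_mult npow_mult of_nat_mult_npow[symmetric])
  have "(\<lambda>p. g ((\<lambda>(d, e). (normalize (d * e), d)) p)) absconv_on (ZA \<times> ZA)"
    using abs_summable_Times(1)[OF zeta_abs_summable[OF conv(1)] zeta_abs_summable[OF conv(2)]]
    by (subst absconv_cong[OF gh])
  hence g: "g absconv_on Sigma ZA zdivs"
    by (subst (asm) abs_summable_reindex_bij_betw[OF bij_divisor_pairs])
  have fin: "finite (zdivs n)" "finite (FI n)" if "n \<in> ZA" for n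
    using that finite_zdivs finite_FI by (auto simp: ZA_def)
  have sums: "infsum (\<lambda>d. g (n, d)) (zdivs n) = infsum (\<lambda>J. f (n, J)) (FI n)"
     "infsum (\<lambda>d. norm (g (n, d))) (zdivs n) = infsum (\<lambda>J. norm (f (n, J))) (FI n)" if n: "n \<in> ZA" for n
  proof -
    have f: "f (n, J) = npow (qn n) (2 * s)" if "J \<in> FI n" for J
      using idx_FI[OF n that] npow_power[OF q[OF n], of 2 s] by (simp add: f_def)
    have c: "card (FI n) = zsigma n" using n card_FI by (simp add: ZA_def)
    show "infsum (\<lambda>d. g (n, d)) (zdivs n) = infsum (\<lambda>J. f (n, J)) (FI n)"
      using fin[OF n] c by (simp add: f g_def zsigma_def flip: sum_distrib_right)
    show "infsum (\<lambda>d. norm (g (n, d))) (zdivs n) = infsum (\<lambda>J. norm (f (n, J))) (FI n)"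
      using fin[OF n] c by (simp add: f g_def zsigma_def norm_mult flip: sum_distrib_right)
  qed
  have "(\<lambda>n. infsum (\<lambda>d. norm (g (n, d))) (zdivs n)) absconv_on ZA"
    using g unfolding Infinite_Sum.abs_summable_on_Sigma_iff by blast
  hence "(\<lambda>n. infsum (\<lambda>J. norm (f (n, J))) (FI n)) absconv_on ZA"
    by (subst (asm) absconv_cong[OF sums(2)])
  hence f: "f absconv_on Sigma ZA FI"
    unfolding Infinite_Sum.abs_summable_on_Sigma_iff using fin by simp
  thus "(\<lambda>J. npow (idx UNIV J) s) absconv_on LL"
    unfolding f_def by (subst (asm) abs_summable_reindex_bij_betw[OF bij_LL_FI, of "\<lambda>J. npow (idx UNIV J) s"])
  have "zetaI s = infsum f (Sigma ZA FI)"
    unfolding zetaI_def f_def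
    using infsum_reindex_bij_betw[OF bij_LL_FI, of "\<lambda>J. npow (idx UNIV J) s"] by simp
  also have "\<dots> = (\<Sum>\<^sub>\<infinity>n\<in>ZA. infsum (\<lambda>J. f (n, J)) (FI n))"
    by (rule infsum_Sigma_banach[OF abs_summable_summable[OF f], symmetric])
  also have "\<dots> = (\<Sum>\<^sub>\<infinity>n\<in>ZA. infsum (\<lambda>d. g (n, d)) (zdivs n))"
    by (intro infsum_cong) (simp add: sums(1))
  also have "\<dots> = infsum g (Sigma ZA zdivs)"
    by (rule infsum_Sigma_banach[OF abs_summable_summable[OF g]])
  also have "\<dots> = infsum (\<lambda>p. g ((\<lambda>(d, e). (normalize (d * e), d)) p)) (ZA \<times> ZA)"
    by (rule infsum_reindex_bij_betw[OF bij_divisor_pairs, symmetric])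
  also have "\<dots> = infsum (\<lambda>p. npow (qn (fst p)) (2 * s - 1) * npow (qn (snd p)) (2 * s)) (ZA \<times> ZA)"
    by (intro infsum_cong gh)
  also have "\<dots> = zetaK (2 * s - 1) * zetaK (2 * s)"
    unfolding zetaK_def by (rule abs_summable_Times(2)) (use conv zeta_abs_summable in auto)
  finally show "zetaI s = zetaK (2 * s) * zetaK (2 * s - 1)" by (simp add: mult.commute)
qed

lemma PL_subset_LL: "PL \<subseteq> LL"
proof
  fix P assume P: "P \<in> PL"
  then obtain a where "P = LI a" "a \<noteq> 0" using PL_generator by blast
  thus "P \<in> LL" using P LI_mem[of a] unfolding LL_def PL_def by (metis (mono_tags, lifting) mem_Collect_eq singletonD)
qed

lemma zetaP_factorization:
  assumes "Re s > 1"
  shows "(\<lambda>P. npow (idx UNIV P) s) absconv_on PL"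
    "zetaI s = zetaK (4 * s) * zetaP s"
proof -
  show P: "(\<lambda>P. npow (idx UNIV P) s) absconv_on PL"
    by (rule summable_on_subset_banach[OF zetaI_product(1)[OF assms] PL_subset_LL])
  have conv: "Re (4 * s) > 1" using assms by simp
  have "zetaI s = infsum (\<lambda>p. npow (idx UNIV ((\<lambda>(n, P). zscale n P) p)) s) (ZA \<times> PL)"
    unfolding zetaI_def by (rule infsum_reindex_bij_betw[OF bij_LL, symmetric])
  also have "\<dots> = infsum (\<lambda>p. npow (qn (fst p)) (4 * s) * npow (idx UNIV (snd p)) s) (ZA \<times> PL)"
  proof (rule infsum_cong)
    fix p assume "p \<in> ZA \<times> PL"
    then obtain n P where p: "p = (n, P)" "n \<in> ZA" "P \<in> PL" by blast
    have "qn n > 0" using p by (simp add: ZA_def)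
    thus "npow (idx UNIV ((\<lambda>(n, P). zscale n P) p)) s = npow (qn (fst p)) (4 * s) * npow (idx UNIV (snd p)) s"
      using p npow_power[of "qn n" 4 s] by (simp add: idx_PL npow_mult)
  qed
  also have "\<dots> = zetaK (4 * s) * zetaP s"
    unfolding zetaK_def zetaP_def by (rule abs_summable_Times(2)[OF zeta_abs_summable[OF conv] P])
  finally show "zetaI s = zetaK (4 * s) * zetaP s" .
qed

lemma SS_series:
  assumes "Re s > 1"
  shows "(\<lambda>M. npow (idx UNIV M) s) absconv_on SS"
    "(\<Sum>\<^sub>\<infinity>M\<in>SS. npow (idx UNIV M) s) = (zetaI s)\<^sup>2 / zetaK (4 * s)"
proof -
  have conv: "Re (4 * s) > 1" using assms by simp
  define h where "h p = npow (qn (fst p)) (4 * s) * (npow (idx UNIV (fst (snd p))) s * npow (idx UNIV (snd (snd p))) s)"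
    for p :: "zt \<times> ico set \<times> ico set"
  have bij: "bij_betw (\<lambda>(n, P, Q). SMod n P Q) (ZA \<times> PL \<times> PL) SS"
    unfolding SS_def by (intro bij_betw_imageI inj_SMod refl)
  have eq: "npow (idx UNIV ((\<lambda>(n, P, Q). SMod n P Q) p)) s = h p" if mem: "p \<in> ZA \<times> PL \<times> PL" for p
  proof -
    obtain n P Q where p: "p = (n, P, Q)" "n \<in> ZA" "P \<in> PL" "Q \<in> PL" using mem by blast
    have "qn n > 0" using p by (simp add: ZA_def)
    thus ?thesis using p npow_power[of "qn n" 4 s] by (simp add: idx_SMod npow_mult h_def)
  qed
  note PP = abs_summable_Times[OF zetaP_factorization(1)[OF assms] zetaP_factorization(1)[OF assms]]
  note ZPP = abs_summable_Times[OF zeta_abs_summable[OF conv] PP(1)]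
  have h: "h absconv_on (ZA \<times> PL \<times> PL)" "infsum h (ZA \<times> PL \<times> PL) = zetaK (4 * s) * (zetaP s * zetaP s)"
    using ZPP PP(2) unfolding h_def zetaK_def zetaP_def by simp_all
  have "(\<lambda>p. npow (idx UNIV ((\<lambda>(n, P, Q). SMod n P Q) p)) s) absconv_on (ZA \<times> PL \<times> PL)"
    using h(1) by (subst absconv_cong[OF eq])
  thus "(\<lambda>M. npow (idx UNIV M) s) absconv_on SS"
    by (subst (asm) abs_summable_reindex_bij_betw[OF bij])
  have "(\<Sum>\<^sub>\<infinity>M\<in>SS. npow (idx UNIV M) s) = infsum h (ZA \<times> PL \<times> PL)"
    by (subst infsum_reindex_bij_betw[OF bij, symmetric]) (intro infsum_cong eq)
  \<comment> \<open>If \<open>zetaK (4 * s)\<close> is 0, then so is \<open>zetaI s\<close>, and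
    with division by zero equal to 0 the equation reads 0 = 0.\<close>
  also have "\<dots> = (zetaI s)\<^sup>2 / zetaK (4 * s)"
    by (simp add: h(2) zetaP_factorization(2)[OF assms] power2_eq_square)
  finally show "(\<Sum>\<^sub>\<infinity>M\<in>SS. npow (idx UNIV M) s) = (zetaI s)\<^sup>2 / zetaK (4 * s)" .
qed

lemma SS_series_by_index:
  assumes "Re s > 1"
  shows "(\<lambda>m. of_nat (card {M \<in> SS. idx UNIV M = m}) * npow m s) summable_on {1..}"
    "(\<Sum>\<^sub>\<infinity>m\<in>{1..}. of_nat (card {M \<in> SS. idx UNIV M = m}) * npow m s) = (zetaI s)\<^sup>2 / zetaK (4 * s)"
proof -
  define f where "f p = npow (idx UNIV (snd p)) s" for p :: "nat \<times> ico set"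
  define B where "B m = {M \<in> SS. idx UNIV M = m}" for m
  have pos: "idx UNIV M > 0" if "M \<in> SS" for M
    using mulw_SS that by (simp add: mulw_def)
  have bij: "bij_betw snd (Sigma {1..} B) SS"
  proof (rule bij_betw_imageI)
    show "inj_on snd (Sigma {1..} B)" by (auto simp: inj_on_def B_def)
    show "snd ` Sigma {1..} B = SS"
    proof (intro equalityI subsetI)
      fix M assume M: "M \<in> SS"
      hence "(idx UNIV M, M) \<in> Sigma {1..} B" using pos[OF M] by (auto simp: B_def)
      thus "M \<in> snd ` Sigma {1..} B" by force
    qed (auto simp: B_def)
  qed
  have "f absconv_on Sigma {1..} B"
    unfolding f_def abs_summable_reindex_bij_betw[OF bij, of "\<lambda>M. npow (idx UNIV M) s"]
    by (rule SS_series(1)[OF assms])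
  hence f: "f summable_on Sigma {1..} B" by (rule abs_summable_summable)
  have "finite (B m)" if "m \<ge> 1" for m
    using mulw_SS that by (simp add: mulw_def B_def)
  hence inner: "infsum (\<lambda>M. f (m, M)) (B m) = of_nat (card (B m)) * npow m s" if "m \<in> {1..}" for m
    using that by (simp add: f_def B_def)
  show "(\<lambda>m. of_nat (card {M \<in> SS. idx UNIV M = m}) * npow m s) summable_on {1..}"
    using summable_on_Sigma_banach[of "\<lambda>m M. f (m, M)" "{1..}" B] f inner
    by (subst summable_on_cong[OF inner[symmetric, unfolded B_def]]) (auto simp: B_def)
  have "(\<Sum>\<^sub>\<infinity>m\<in>{1..}. of_nat (card {M \<in> SS. idx UNIV M = m}) * npow m s)
      = (\<Sum>\<^sub>\<infinity>m\<in>{1..}. infsum (\<lambda>M. f (m, M)) (B m))"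
    by (rule infsum_cong) (use inner in \<open>simp add: B_def\<close>)
  also have "\<dots> = infsum f (Sigma {1..} B)" by (rule infsum_Sigma_banach[OF f])
  also have "\<dots> = (\<Sum>\<^sub>\<infinity>M\<in>SS. npow (idx UNIV M) s)"
    unfolding f_def by (rule infsum_reindex_bij_betw[OF bij])
  finally show "(\<Sum>\<^sub>\<infinity>m\<in>{1..}. of_nat (card {M \<in> SS. idx UNIV M = m}) * npow m s) = (zetaI s)\<^sup>2 / zetaK (4 * s)"
    using SS_series(2)[OF assms] by simp
qed

section \<open>The concrete icosian ring\<close>

subsection \<open>Additive subgroups of records\<close>

lemma abelian_group_of_sgrp:
  fixes R :: "('a::ab_group_add, 'b) ring_scheme"
  assumes "add R = (+)" "zero R = 0" "sgrp (carrier R)"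
  shows "abelian_group R"
proof (rule abelian_groupI)
  fix x assume "x \<in> carrier R"
  thus "\<exists>y\<in>carrier R. y \<oplus>\<^bsub>R\<^esub> x = \<zero>\<^bsub>R\<^esub>"
    using sgrp_uminus[OF assms(3)] assms by (intro bexI[of _ "- x"]) auto
qed (use assms in \<open>auto simp: algebra_simps intro: sgrp_plus sgrpD\<close>)

lemma additive_subgroup_iff:
  fixes R :: "('a::ab_group_add, 'b) ring_scheme"
  assumes R: "add R = (+)" "zero R = 0" "sgrp (carrier R)"
  shows "additive_subgroup J R \<longleftrightarrow> sgrp J \<and> J \<subseteq> carrier R"
proof -
  interpret abelian_group R by (rule abelian_group_of_sgrp[OF R])
  have inv: "inv\<^bsub>add_monoid R\<^esub> x = - x" if "x \<in> carrier R" for x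
    using minus_equality[of "- x" x] that R sgrp_uminus[OF R(3)] by (simp add: a_inv_def)
  show ?thesis
  proof
    assume "additive_subgroup J R"
    then interpret J: additive_subgroup J R .
    have sub: "J \<subseteq> carrier R" by (rule J.a_subset)
    have "- x \<in> J" if "x \<in> J" for x
      using subgroup.m_inv_closed[OF J.a_subgroup that] inv sub that by auto
    moreover have "x + y \<in> J" if "x \<in> J" "y \<in> J" for x y
      using J.a_closed[OF that] R by simp
    ultimately have "x - y \<in> J" if "x \<in> J" "y \<in> J" for x y
      using that by (metis diff_conv_add_uminus)
    moreover have "0 \<in> J" using J.zero_closed R by simp
    ultimately show "sgrp J \<and> J \<subseteq> carrier R" using sub by (simp add: sgrp_def)
  next
    assume J: "sgrp J \<and> J \<subseteq> carrier R"
    show "additive_subgroup J R"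
    proof (intro additive_subgroup.intro subgroup.intro)
      fix x y assume "x \<in> J" "y \<in> J"
      thus "x \<otimes>\<^bsub>add_monoid R\<^esub> y \<in> J" using J R sgrp_plus by auto
    next
      fix x assume x: "x \<in> J"
      hence "inv\<^bsub>add_monoid R\<^esub> x = - x" using J inv by blast
      thus "inv\<^bsub>add_monoid R\<^esub> x \<in> J" using sgrp_uminus[of J x] J x by (simp only:)
    qed (use J R sgrpD(1) in auto)
  qed
qed

lemma add_index_image:
  fixes f :: "'a::ab_group_add \<Rightarrow> 'b::ab_group_add" and R :: "('b, 'c) ring_scheme"
  assumes R: "add R = (+)" "carrier R = range f"
    and f: "inj f" "\<And>x y. f (x + y) = f x + f y"
  shows "add_index R (f ` J) = idx UNIV J"
proof -
  have "f ` J +>\<^bsub>R\<^esub> f x = f ` ((+) x ` J)" for x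
    unfolding a_r_coset_def' R(1) by (auto simp: f(2) add.commute image_iff)
  hence "a_rcosets\<^bsub>R\<^esub> (f ` J) = (`) f ` cosets UNIV J"
    unfolding A_RCOSETS_def' R(2) cosets_def by auto
  moreover have "inj_on ((`) f) (cosets UNIV J)"
    using f(1) by (auto simp: inj_on_def inj_image_eq_iff)
  ultimately show ?thesis by (simp add: add_index_def idx_def card_image)
qed

subsection \<open>Integral spans\<close>

lemma int_span_base: "x \<in> S \<Longrightarrow> x \<in> int_span S"
  unfolding int_span_def by (rule CollectI, rule exI[of _ "{x}"], rule exI[of _ "\<lambda>_. 1"]) auto

lemma sgrp_int_span: "sgrp (int_span S)"
  unfolding sgrp_def
proof (intro conjI ballI)
  show "0 \<in> int_span S" unfolding int_span_def by (rule CollectI, rule exI[of _ "{}"]) auto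
  fix x y assume "x \<in> int_span S" "y \<in> int_span S"
  then obtain T c T' c' where *: "finite T" "T \<subseteq> S" "x = (\<Sum>v\<in>T. of_int (c v) *\<^sub>R v)"
      "finite T'" "T' \<subseteq> S" "y = (\<Sum>v\<in>T'. of_int (c' v) *\<^sub>R v)"
    unfolding int_span_def by blast
  define d where "d v = (if v \<in> T then c v else 0) - (if v \<in> T' then c' v else 0)" for v
  have "x = (\<Sum>v\<in>T \<union> T'. of_int (if v \<in> T then c v else 0) *\<^sub>R v)"
    unfolding *(3) using * by (intro sum.mono_neutral_cong_left) auto
  moreover have "y = (\<Sum>v\<in>T \<union> T'. of_int (if v \<in> T' then c' v else 0) *\<^sub>R v)"
    unfolding *(6) using * by (intro sum.mono_neutral_cong_left) auto
  ultimately have "x - y = (\<Sum>v\<in>T \<union> T'. of_int (d v) *\<^sub>R v)"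
    by (simp add: d_def scaleR_diff_left flip: sum_subtractf)
  thus "x - y \<in> int_span S" unfolding int_span_def using * by blast
qed

lemma sgrp_scaleR_int:
  fixes H :: "'a::real_vector set"
  assumes "sgrp H" "x \<in> H"
  shows "of_int k *\<^sub>R x \<in> H"
proof -
  have n: "of_nat n *\<^sub>R x \<in> H" for n
    by (induction n) (use assms in \<open>auto simp: scaleR_add_left intro: sgrp_plus sgrpD\<close>)
  show ?thesis
    by (cases k rule: int_cases2) (use n sgrp_uminus[OF assms(1) n] in auto)
qed

lemma int_span_least: "sgrp H \<Longrightarrow> S \<subseteq> H \<Longrightarrow> int_span S \<subseteq> H"
  unfolding int_span_def by (auto intro!: sgrp_sum sgrp_scaleR_int)

subsection \<open>The embedding\<close>

definition emb :: "ico \<Rightarrow> real ^ 4" where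
  "emb x = vector [of_zt (qa x) / 2, of_zt (qb x) / 2, of_zt (cc x) / 2, of_zt (cd x) / 2]"

lemma emb_nth [simp]: "emb x $ 1 = of_zt (qa x) / 2" "emb x $ 2 = of_zt (qb x) / 2"
  "emb x $ 3 = of_zt (cc x) / 2" "emb x $ 4 = of_zt (cd x) / 2"
  by (simp_all add: emb_def)

lemma qmult_nth [simp]:
  "qmult x y $ 1 = x$1 * y$1 - x$2 * y$2 - x$3 * y$3 - x$4 * y$4"
  "qmult x y $ 2 = x$1 * y$2 + x$2 * y$1 + x$3 * y$4 - x$4 * y$3"
  "qmult x y $ 3 = x$1 * y$3 - x$2 * y$4 + x$3 * y$1 + x$4 * y$2"
  "qmult x y $ 4 = x$1 * y$4 + x$2 * y$3 - x$3 * y$2 + x$4 * y$1"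
  by (simp_all add: qmult_def)

lemma vec4_eq_iff: "x = y \<longleftrightarrow> x$1 = y$1 \<and> x$2 = y$2 \<and> x$3 = y$3 \<and> x$4 = y$4"
  for x y :: "'a ^ 4"
  by (simp add: vec_eq_iff forall_4)

lemma emb_add: "emb (x + y) = emb x + emb y" and emb_diff: "emb (x - y) = emb x - emb y"
  by (simp_all add: vec4_eq_iff qa_def qb_def field_simps)

lemma emb_zi: "emb (zi n * x) = of_zt n *\<^sub>R emb x"
  by (simp add: vec4_eq_iff qa_def qb_def field_simps)

lemma double_mult:
  "2 * qa (x * y) = qa x * qa y - qb x * qb y - cc x * cc y - cd x * cd y"
  "2 * qb (x * y) = qa x * qb y + qb x * qa y + cc x * cd y - cd x * cc y"
  "2 * cc (x * y) = qa x * cc y - qb x * cd y + cc x * qa y + cd x * qb y"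
  "2 * cd (x * y) = qa x * cd y + qb x * cc y - cc x * qb y + cd x * qa y"
  by (simp_all add: qa_def qb_def times_ico_def algebra_simps ztau_reduce)

lemma emb_mult: "emb (x * y) = qmult (emb x) (emb y)"
  using double_mult[of x y, THEN arg_cong[of _ _ of_zt]]
  by (simp add: vec4_eq_iff field_simps)

lemma inj_emb: "inj emb"
  by (rule injI) (auto simp: vec4_eq_iff qa_def qb_def ico_eq_iff)

lemma norm_vec4: "(norm (x :: real ^ 4))\<^sup>2 = (x$1)\<^sup>2 + (x$2)\<^sup>2 + (x$3)\<^sup>2 + (x$4)\<^sup>2"
  unfolding power2_norm_eq_inner by (simp add: inner_vec_def sum_4 power2_eq_square)

lemma norm_emb: "(norm (emb x))\<^sup>2 = of_zt (nr x)"
  using of_zt_nr[of x] by (simp add: norm_vec4 power_divide)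

lemma norm_qmult: "norm (qmult x y) = norm x * norm y"
proof -
  have "(norm (qmult x y))\<^sup>2 = (norm x * norm y)\<^sup>2"
    by (simp add: norm_vec4 power_mult_distrib) (simp add: power2_eq_square algebra_simps)
  thus ?thesis by (simp add: power2_eq_iff_nonneg)
qed

lemma sgrp_range_emb: "sgrp (range emb)"
  by (rule sgrp_range) (rule emb_diff)

subsection \<open>The icosian group generates the image of the embedding\<close>

text \<open>Modulo 2, the coordinates of doubled icosians form a linear code over the field with four
  elements, which every transposition of coordinates interchanges with its Galois conjugate.\<close>

definition icode :: "(4 \<Rightarrow> zt) \<Rightarrow> bool" where
  "icode u \<longleftrightarrow> even (zre (u 1) + zre (u 3) + zim (u 3) + zim (u 4)) \<and>
     even (zim (u 1) + zre (u 3) + zre (u 4) + zim (u 4)) \<and>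
     even (zre (u 2) + zim (u 3) + zre (u 4) + zim (u 4)) \<and>
     even (zim (u 2) + zre (u 3) + zim (u 3) + zre (u 4))"

definition icode' :: "(4 \<Rightarrow> zt) \<Rightarrow> bool" where
  "icode' u = icode (\<lambda>i. zconj (u i))"

lemma icode'_iff:
  "icode' u \<longleftrightarrow> even (zre (u 1) + zim (u 1) + zre (u 3) + zim (u 4)) \<and>
     even (zim (u 1) + zre (u 3) + zim (u 3) + zre (u 4)) \<and>
     even (zre (u 2) + zim (u 2) + zim (u 3) + zre (u 4)) \<and>
     even (zim (u 2) + zre (u 3) + zre (u 4) + zim (u 4))"
  unfolding icode'_def icode_def by (simp; blast)

lemma icode_transpose:
  assumes "a \<noteq> b"
  shows "icode u \<Longrightarrow> icode' (u \<circ> Transposition.transpose a b)"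
proof -
  have *: "icode u \<Longrightarrow> icode' (u \<circ> Transposition.transpose a b)"
    if "(a, b) \<in> {(1, 2), (1, 3), (1, 4), (2, 3), (2, 4), (3, 4)}" for a b :: 4 and u
    using that unfolding icode'_iff icode_def
    by (elim insertE emptyE; simp add: Transposition.transpose_def; argo)
  show "icode u \<Longrightarrow> icode' (u \<circ> Transposition.transpose a b)"
    using assms exhaust_4[of a] exhaust_4[of b] *[of a b u] *[of b a u]
    by (auto simp: Transposition.transpose_commute)
qed

lemma icode'_transpose:
  assumes "a \<noteq> b" "icode' u"
  shows "icode (u \<circ> Transposition.transpose a b)"
proof -
  have "icode' ((\<lambda>i. zconj (u i)) \<circ> Transposition.transpose a b)"
    using icode_transpose[OF assms(1)] assms(2) unfolding icode'_def by blast
  thus ?thesis by (simp add: icode'_def o_def zconj_simps)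
qed

text \<open>Each swap exchanges the code with its conjugate, so the parity of the number of swaps
  decides; this is where even permutations matter.\<close>

lemma icode_swapidseq:
  assumes "swapidseq n p"
  shows "(icode u \<longrightarrow> (if even n then icode else icode') (u \<circ> p)) \<and>
    (icode' u \<longrightarrow> (if even n then icode' else icode) (u \<circ> p))"
  using assms
proof (induction n p arbitrary: u rule: swapidseq.induct)
  case (comp_Suc n p a b)
  have assoc: "u \<circ> (Transposition.transpose a b \<circ> p) = (u \<circ> Transposition.transpose a b) \<circ> p"
    by (rule o_assoc)
  show ?case unfolding assoc
    using comp_Suc.IH[of "u \<circ> Transposition.transpose a b"] icode_transpose[OF comp_Suc.hyps(2), of u]
      icode'_transpose[OF comp_Suc.hyps(2), of u]
    by (cases "even n") (simp_all del: comp_apply)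
qed auto

lemma icode_even_perm:
  assumes "p permutes UNIV" "evenperm p" "icode u"
  shows "icode (u \<circ> p)"
proof -
  obtain n where n: "swapidseq n p"
    using assms(1) permutation_permutes[of p] unfolding permutation_def by (metis finite)
  moreover have "even n" using evenperm_unique[OF n refl] assms(2) by simp
  ultimately show ?thesis using icode_swapidseq[OF n, of u] assms(3) by simp
qed

lemma icode_sign:
  assumes "icode u" "\<And>i. w i = u i \<or> w i = - u i"
  shows "icode w"
proof -
  have "even (zre (w i)) = even (zre (u i))" "even (zim (w i)) = even (zim (u i))" for i
    using assms(2)[of i] by auto
  thus ?thesis using assms(1) by (simp add: icode_def)
qed

lemma icode_imp_range:
  assumes "icode u"
  shows "(\<chi> i. of_zt (u i) / 2) \<in> range emb"
proof -
  define half where "half x = ZT (zre x div 2) (zim x div 2)" for x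
  have half: "2 * half x = x" if "even (zre x)" "even (zim x)" for x
    using that by (simp add: half_def zt_eq_iff)
  define x where "x = Ico (half (u 1 - ((ztau - 1) * u 3 - ztau * u 4)))
     (half (u 2 - (ztau * u 3 + (ztau - 1) * u 4))) (u 3) (u 4)"
  have "2 * ca x = u 1 - ((ztau - 1) * u 3 - ztau * u 4)"
    unfolding x_def ico.sel
    by (rule half) (use assms in \<open>auto simp: icode_def\<close>)
  hence "qa x = u 1" by (simp add: qa_def x_def algebra_simps)
  moreover have "2 * cb x = u 2 - (ztau * u 3 + (ztau - 1) * u 4)"
    unfolding x_def ico.sel
    by (rule half) (use assms in \<open>auto simp: icode_def\<close>)
  hence "qb x = u 2" by (simp add: qb_def x_def algebra_simps)
  ultimately have "(\<chi> i. of_zt (u i) / 2) = emb x" by (simp add: vec4_eq_iff x_def)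
  thus ?thesis by blast
qed

lemma inverse_tau: "1 / tau = tau - 1"
  using tau_square tau_bounds by (simp add: field_simps)

lemma icosian_group_subset: "icosian_group \<subseteq> range emb"
proof
  fix x assume "x \<in> icosian_group"
  then obtain \<epsilon> :: "4 \<Rightarrow> real" and v :: "real ^ 4" and p where x: "x = (\<chi> i. \<epsilon> i * v $ p i)" and v: "v \<in> {vector [1, 0, 0, 0],
             (1/2) *\<^sub>R vector [1, 1, 1, 1], (1/2) *\<^sub>R vector [tau, 1, - 1 / tau, 0]}"
    and p: "p permutes UNIV" "evenperm p" and \<epsilon>: "\<And>i. \<epsilon> i = 1 \<or> \<epsilon> i = - 1"
    unfolding icosian_group_def by blast
  have "\<exists>u. icode u \<and> v = (\<chi> i. of_zt (u i) / 2)"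
  proof -
    consider "v = vector [1, 0, 0, 0]" | "v = (1/2) *\<^sub>R vector [1, 1, 1, 1]"
      | "v = (1/2) *\<^sub>R vector [tau, 1, - 1 / tau, 0]" using v by blast
    thus ?thesis
    proof cases
      case 1
      define u where "u = (\<lambda>i :: 4. if i = 1 then 2 else (0 :: zt))"
      have "icode u" by (simp add: icode_def u_def)
      moreover have "v = (\<chi> i. of_zt (u i) / 2)" by (simp add: 1 vec4_eq_iff u_def)
      ultimately show ?thesis by blast
    next
      case 2
      define u where "u = (\<lambda>i :: 4. 1 :: zt)"
      have "icode u" by (simp add: icode_def u_def)
      moreover have "v = (\<chi> i. of_zt (u i) / 2)" by (simp add: 2 vec4_eq_iff u_def)
      ultimately show ?thesis by blast
    next
      case 3
      define u where "u = (\<lambda>i :: 4. if i = 1 then ztau else if i = 2 then 1 else if i = 3 then 1 - ztau else 0)"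
      have "icode u" by (simp add: icode_def u_def)
      moreover have "v = (\<chi> i. of_zt (u i) / 2)"
        using inverse_tau by (simp add: 3 vec4_eq_iff u_def)
      ultimately show ?thesis by blast
    qed
  qed
  then obtain u where u: "icode u" "v = (\<chi> i. of_zt (u i) / 2)" by blast
  define w where "w i = (if \<epsilon> i = 1 then u (p i) else - u (p i))" for i
  have "icode (u \<circ> p)" by (rule icode_even_perm[OF p u(1)])
  hence "icode w" by (rule icode_sign) (simp add: w_def)
  moreover have "x = (\<chi> i. of_zt (w i) / 2)"
  proof -
    have "\<epsilon> i * (of_zt (u (p i)) / 2) = of_zt (w i) / 2" for i
      using \<epsilon>[of i] by (auto simp: w_def)
    thus ?thesis unfolding x u(2) by (simp add: vec_eq_iff)
  qed
  ultimately show "x \<in> range emb" using icode_imp_range by simp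
qed

abbreviation icosian_seeds :: "(real ^ 4) set" where
  "icosian_seeds \<equiv> {vector [1, 0, 0, 0], (1/2) *\<^sub>R vector [1, 1, 1, 1], (1/2) *\<^sub>R vector [tau, 1, - 1 / tau, 0]}"

text \<open>Every even permutation of four points is a product of two transpositions; equal ones
  give the identity.\<close>

lemma icosian_groupI:
  assumes "v \<in> icosian_seeds"
    "a \<noteq> b" "c \<noteq> d" "\<forall>i. \<epsilon> i = 1 \<or> \<epsilon> i = - 1"
  shows "(\<chi> i. \<epsilon> i * v $ (Transposition.transpose a b \<circ> Transposition.transpose c d) i) \<in> icosian_group"
proof -
  have "Transposition.transpose a b \<circ> Transposition.transpose c d permutes UNIV"
    by (intro permutes_compose permutes_swap_id) auto
  moreover have "evenperm (Transposition.transpose a b \<circ> Transposition.transpose c d)"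
    using assms by (simp add: evenperm_comp permutation_swap_id evenperm_swap)
  ultimately show ?thesis unfolding icosian_group_def using assms by blast
qed

text \<open>A Z-basis is expressed by group elements: \<tau> and \<tau> i are sums of two of them,
  1, i, h and i h belong to the group, and \<tau> h and \<tau> i h differ from group elements by i
  and -1.\<close>

lemma range_emb_subset: "range emb \<subseteq> int_span icosian_group"
proof -
  define H where "H = int_span icosian_group"
  have H: "sgrp H" unfolding H_def by (rule sgrp_int_span)
  define v where "v = (1/2 :: real) *\<^sub>R (vector [tau, 1, 1 - tau, 0] :: real ^ 4)"
  have v: "v \<in> icosian_seeds"
  proof -
    have "- 1 / tau = 1 - tau" using inverse_tau by simp
    thus ?thesis by (simp add: v_def)
  qed
  have mem: "w \<in> H" if "w = (\<chi> i. \<epsilon> i * v' $ (Transposition.transpose a b \<circ> Transposition.transpose c d) i)"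
      "v' \<in> icosian_seeds"
      "a \<noteq> b" "c \<noteq> d" "\<forall>i. \<epsilon> i = 1 \<or> \<epsilon> i = - 1" for w v' a b c d \<epsilon>
    unfolding H_def that(1) by (intro int_span_base icosian_groupI that(2-5))
  define sg where "sg S i = (if i \<in> S then - 1 else 1 :: real)" for S :: "4 set" and i
  have sg: "\<forall>i. sg S i = 1 \<or> sg S i = - 1" for S by (simp add: sg_def)
  have one: "vector [1, 0, 0, 0] \<in> H"
    by (rule mem[of _ "sg {}" "vector [1, 0, 0, 0]" 1 2 1 2]) (use sg in \<open>auto simp: vec4_eq_iff sg_def\<close>)
  have i: "vector [0, 1, 0, 0] \<in> H"
    by (rule mem[of _ "sg {}" "vector [1, 0, 0, 0]" 1 2 3 4])
      (use sg in \<open>auto simp: vec4_eq_iff sg_def Transposition.transpose_def\<close>)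
  have h: "(1/2) *\<^sub>R vector [tau - 1, tau, 1, 0] \<in> H"
    by (rule mem[of _ "sg {1}" v 1 2 1 3]) (use sg v in \<open>auto simp: vec4_eq_iff sg_def Transposition.transpose_def v_def\<close>)
  have h': "(1/2) *\<^sub>R vector [1 - tau, tau, - 1, 0] \<in> H"
    by (rule mem[of _ "sg {3}" v 1 2 1 3]) (use sg v in \<open>auto simp: vec4_eq_iff sg_def Transposition.transpose_def v_def\<close>)
  have ih: "(1/2) *\<^sub>R vector [- tau, tau - 1, 0, 1] \<in> H"
    by (rule mem[of _ "sg {1, 2}" v 2 4 2 3]) (use sg v in \<open>auto simp: vec4_eq_iff sg_def Transposition.transpose_def v_def\<close>)
  have t: "(1/2) *\<^sub>R vector [tau, 1, 1 - tau, 0] \<in> H"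
    by (rule mem[of _ "sg {}" v 1 2 1 2]) (use sg v in \<open>auto simp: vec4_eq_iff sg_def Transposition.transpose_def v_def\<close>)
  have t': "(1/2) *\<^sub>R vector [tau, - 1, tau - 1, 0] \<in> H"
    by (rule mem[of _ "sg {2, 3}" v 1 2 1 2]) (use sg v in \<open>auto simp: vec4_eq_iff sg_def Transposition.transpose_def v_def\<close>)
  have th: "(1/2) *\<^sub>R vector [1, tau - 1, tau, 0] \<in> H"
    by (rule mem[of _ "sg {2}" v 1 3 1 2]) (use sg v in \<open>auto simp: vec4_eq_iff sg_def Transposition.transpose_def v_def\<close>)
  have tih: "(1/2) *\<^sub>R vector [1 - tau, 1, 0, tau] \<in> H"
    by (rule mem[of _ "sg {}" v 1 4 1 3]) (use sg v in \<open>auto simp: vec4_eq_iff sg_def Transposition.transpose_def v_def\<close>)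
  have "emb x \<in> H" for x
  proof -
    have "emb x = of_int (zre (ca x)) *\<^sub>R vector [1, 0, 0, 0]
       + of_int (zim (ca x)) *\<^sub>R ((1/2) *\<^sub>R vector [tau, 1, 1 - tau, 0] + (1/2) *\<^sub>R vector [tau, - 1, tau - 1, 0])
       + of_int (zre (cb x)) *\<^sub>R vector [0, 1, 0, 0]
       + of_int (zim (cb x)) *\<^sub>R ((1/2) *\<^sub>R vector [tau - 1, tau, 1, 0] + (1/2) *\<^sub>R vector [1 - tau, tau, - 1, 0])
       + of_int (zre (cc x)) *\<^sub>R ((1/2) *\<^sub>R vector [tau - 1, tau, 1, 0])
       + of_int (zim (cc x)) *\<^sub>R ((1/2) *\<^sub>R vector [1, tau - 1, tau, 0] + vector [0, 1, 0, 0])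
       + of_int (zre (cd x)) *\<^sub>R ((1/2) *\<^sub>R vector [- tau, tau - 1, 0, 1])
       + of_int (zim (cd x)) *\<^sub>R ((1/2) *\<^sub>R vector [1 - tau, 1, 0, tau] - vector [1, 0, 0, 0])"
    proof -
      have tt: "tau * (tau * y) = tau * y + y" for y
        using tau_square by (simp add: algebra_simps flip: mult.assoc)
      show ?thesis
        by (simp add: vec4_eq_iff qa_def qb_def of_zt_def)
          (simp add: field_simps tau_square tt)
    qed
    also have "\<dots> \<in> H"
      by (intro sgrp_plus[OF H] sgrp_scaleR_int[OF H] sgrpD(2)[OF H] one i h h' ih t t' th tih)
    finally show ?thesis .
  qed
  thus ?thesis unfolding H_def by blast
qed

lemma carrier_icosian_ring: "carrier icosian_ring = range emb"
  using int_span_least[OF sgrp_range_emb icosian_group_subset] range_emb_subset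
  by (auto simp: icosian_ring_def)

lemma icosian_ring_simps: "add icosian_ring = (+)" "zero icosian_ring = 0" "mult icosian_ring = qmult"
  by (simp_all add: icosian_ring_def)

lemma add_index_emb: "add_index icosian_ring (emb ` J) = idx UNIV J"
  by (rule add_index_image) (auto simp: icosian_ring_simps carrier_icosian_ring inj_emb emb_add)

lemma sgrp_emb_image: "sgrp (emb ` J) \<longleftrightarrow> sgrp J"
proof
  assume J: "sgrp (emb ` J)"
  have e: "emb x \<in> emb ` J \<longleftrightarrow> x \<in> J" for x using inj_emb by (auto dest: injD)
  have "emb 0 = 0" using emb_diff[of 0 0] by simp
  thus "sgrp J" using J unfolding sgrp_def by (metis e emb_diff imageI)
qed (auto intro!: sgrp_image emb_diff)

lemma left_ideal_emb: "left_ideal (emb ` J) icosian_ring \<longleftrightarrow> lid J"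
proof -
  have s: "sgrp (carrier icosian_ring)" by (simp add: carrier_icosian_ring sgrp_range_emb)
  have e: "emb x \<in> emb ` J \<longleftrightarrow> x \<in> J" for x using inj_emb by (auto dest: injD)
  have "additive_subgroup (emb ` J) icosian_ring \<longleftrightarrow> sgrp J"
    by (subst additive_subgroup_iff[OF icosian_ring_simps(1,2) s]) (auto simp: sgrp_emb_image carrier_icosian_ring)
  moreover have "(\<forall>r\<in>carrier icosian_ring. \<forall>x\<in>emb ` J. r \<otimes>\<^bsub>icosian_ring\<^esub> x \<in> emb ` J) \<longleftrightarrow> (\<forall>r. \<forall>x\<in>J. r * x \<in> J)"
    by (simp add: carrier_icosian_ring icosian_ring_simps e flip: emb_mult)
  ultimately show ?thesis by (simp add: left_ideal_def lid_def)
qed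

lemma left_ideals_icosian_ring:
  "{J. left_ideal J icosian_ring \<and> J \<noteq> {0}} = (`) emb ` LL"
proof (intro equalityI subsetI)
  fix J assume J: "J \<in> {J. left_ideal J icosian_ring \<and> J \<noteq> {0}}"
  have s: "sgrp (carrier icosian_ring)" by (simp add: carrier_icosian_ring sgrp_range_emb)
  have "J \<subseteq> range emb"
    using J additive_subgroup_iff[OF icosian_ring_simps(1,2) s] by (auto simp: left_ideal_def carrier_icosian_ring)
  then obtain I where I: "J = emb ` I" by (metis subset_imageE)
  have "emb 0 = 0" using emb_diff[of 0 0] by simp
  hence "I \<noteq> {0}" using J I by auto
  thus "J \<in> (`) emb ` LL" using J left_ideal_emb unfolding I LL_def by blast
next
  fix J assume "J \<in> (`) emb ` LL"
  then obtain I where I: "J = emb ` I" "lid I" "I \<noteq> {0}" by (auto simp: LL_def)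
  have "emb 0 = 0" using emb_diff[of 0 0] by simp
  hence "J \<noteq> {0}" using I inj_emb by (metis image_empty image_insert inj_image_eq_iff)
  thus "J \<in> {J. left_ideal J icosian_ring \<and> J \<noteq> {0}}" using I left_ideal_emb by simp
qed

lemma icosian_zeta_eq: "icosian_zeta s = zetaI s"
proof -
  have "inj_on ((`) emb) LL" using inj_emb by (auto simp: inj_on_def inj_image_eq_iff)
  thus ?thesis
    unfolding icosian_zeta_def zetaI_def left_ideals_icosian_ring
    by (subst infsum_reindex) (auto simp: o_def add_index_emb npow_def)
qed

subsection \<open>Similarity submodules\<close>

lemma linear_qmult: "linear (\<lambda>v. qmult a v)" "linear (\<lambda>v. qmult v a)"
  by (rule linearI; simp add: vec4_eq_iff algebra_simps)+

text \<open>An orthogonal map is R-linear, hence commutes with the scalars of Z[\<tau>] on the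
  lattice; this makes it a \<open>similitude\<close>. Conversely, left and right multiplication
  divided by the norms of the factors is orthogonal.\<close>

lemma SSM_iff: "SSM (carrier icosian_ring) M \<longleftrightarrow> (\<exists>N\<in>SS. M = emb ` N)"
proof
  assume "SSM (carrier icosian_ring) M"
  then obtain \<alpha> R where R: "\<alpha> \<noteq> 0" "orthogonal_transformation R"
      "M = (\<lambda>x. \<alpha> *\<^sub>R R x) ` range emb" "M \<subseteq> range emb"
    unfolding SSM_def carrier_icosian_ring by blast
  define \<phi> where "\<phi> x = inv_into UNIV emb (\<alpha> *\<^sub>R R (emb x))" for x
  have \<phi>: "emb (\<phi> x) = \<alpha> *\<^sub>R R (emb x)" for x
  proof -
    have "\<alpha> *\<^sub>R R (emb x) \<in> range emb" using R(3,4) by blast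
    thus ?thesis unfolding \<phi>_def by (rule f_inv_into_f)
  qed
  have lin: "linear R" and nrm: "norm (R v) = norm v" for v
    using R(2) by (auto simp: orthogonal_transformation)
  have n: "of_zt (nr (\<phi> x)) = \<alpha>\<^sup>2 * of_zt (nr x)" for x
    unfolding norm_emb[symmetric] \<phi> by (simp add: nrm power_mult_distrib)
  have "similitude \<phi> (nr (\<phi> 1))"
  proof
    fix x y n
    show "\<phi> (x + y) = \<phi> x + \<phi> y"
      by (rule injD[OF inj_emb]) (simp add: \<phi> emb_add linear_add[OF lin] scaleR_add_right)
    show "\<phi> (zi n * x) = zi n * \<phi> x"
      by (rule injD[OF inj_emb]) (simp add: \<phi> emb_zi linear_scale[OF lin])
    have "of_zt (nr (\<phi> x)) = of_zt (nr (\<phi> 1) * nr x)" using n[of x] n[of 1] by simp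
    thus "nr (\<phi> x) = nr (\<phi> 1) * nr x" by (simp only: of_zt_eq_iff)
    have "of_zt (nr (\<phi> 1)) \<noteq> 0" using n[of 1] R(1) by simp
    thus "nr (\<phi> 1) \<noteq> 0" by auto
  qed
  hence "range \<phi> \<in> SS" by (rule similitude_range)
  moreover have "M = emb ` range \<phi>" unfolding R(3) image_image by (simp add: \<phi>)
  ultimately show "\<exists>N\<in>SS. M = emb ` N" by blast
next
  assume "\<exists>N\<in>SS. M = emb ` N"
  then obtain n P Q where N: "n \<in> ZA" "P \<in> PL" "Q \<in> PL" "M = emb ` SMod n P Q"
    by (auto simp: SS_def)
  obtain p q where p: "P = LI p" "p \<noteq> 0" and q: "Q = LI q" "q \<noteq> 0" using PL_generator N by metis
  define a b where "a = emb (cj p)" and "b = emb q"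
  have "emb x \<noteq> 0" if "x \<noteq> 0" for x
    using that injD[OF inj_emb, of x 0] emb_diff[of 0 0] by auto
  hence ab: "norm a \<noteq> 0" "norm b \<noteq> 0" using p q by (auto simp: a_def b_def)
  define R where "R v = (1 / (norm a * norm b)) *\<^sub>R qmult (qmult a v) b" for v
  define \<alpha> where "\<alpha> = of_zt n * (norm a * norm b)"
  have "linear R"
    unfolding R_def
    by (intro linear_compose_scale_right linear_compose[OF linear_qmult(1) linear_qmult(2), unfolded o_def])
  moreover have "norm (R v) = norm v" for v
    using ab by (simp add: R_def norm_qmult)
  ultimately have "orthogonal_transformation R" by (simp add: orthogonal_transformation)
  moreover have "\<alpha> \<noteq> 0" using ab N(1) by (simp add: \<alpha>_def ZA_def)
  moreover have "M = (\<lambda>x. \<alpha> *\<^sub>R R x) ` range emb"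
  proof -
    have "emb (zi n * (cj p * x * q)) = \<alpha> *\<^sub>R R (emb x)" for x
      unfolding emb_zi using ab by (simp add: emb_mult \<alpha>_def R_def a_def b_def)
    thus ?thesis unfolding N(4) p q SMod_LI image_image by simp
  qed
  moreover have "M \<subseteq> range emb" using N(4) by blast
  ultimately show "SSM (carrier icosian_ring) M" unfolding SSM_def carrier_icosian_ring by blast
qed

lemma icosian_SSMs_eq: "icosian_SSMs m = (`) emb ` {N \<in> SS. idx UNIV N = m}"
  unfolding icosian_SSMs_def using SSM_iff add_index_emb by auto

lemma card_icosian_SSMs: "card (icosian_SSMs m) = card {N \<in> SS. idx UNIV N = m}"
  unfolding icosian_SSMs_eq
  by (intro card_image) (use inj_emb in \<open>auto simp: inj_on_def inj_image_eq_iff\<close>)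

subsection \<open>The ring of integers of the golden field\<close>

lemma of_zt_quotient:
  assumes "x \<in> Q_sqrt5"
  obtains r t where "t \<noteq> 0" "of_zt t * x = of_zt r"
proof -
  obtain a b where x: "x = of_rat a + of_rat b * sqrt 5" using assms by (auto simp: Q_sqrt5_def)
  obtain m d where a: "quotient_of a = (m, d)" by fastforce
  obtain n e where b: "quotient_of b = (n, e)" by fastforce
  have de: "d > 0" "e > 0" using quotient_of_denom_pos a b by blast+
  have "a = of_int m / of_int d" "b = of_int n / of_int e" using quotient_of_div a b by blast+
  hence ab: "(of_rat a :: real) = of_int m / of_int d" "(of_rat b :: real) = of_int n / of_int e"
    by (simp_all add: of_rat_divide)
  have "of_zt (of_int (d * e)) * x = of_zt (of_int (m * e) + of_int (n * d) * (2 * ztau - 1))"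
    using de by (simp add: x ab tau_def field_simps)
  moreover have "(of_int (d * e) :: zt) \<noteq> 0" using de by simp
  ultimately show ?thesis using that by blast
qed

lemma algebraic_int_of_zt: "algebraic_int (of_zt n)"
proof -
  define p where "p = [:znorm n, - (2 * zre n + zim n), 1 :: int:]"
  have "n * n - of_int (2 * zre n + zim n) * n + of_int (znorm n) = 0"
    by (simp add: zt_eq_iff znorm_def power2_eq_square algebra_simps)
  hence "of_zt (n * n - of_int (2 * zre n + zim n) * n + of_int (znorm n)) = 0" by simp
  hence "poly (map_poly of_int p) (of_zt n) = 0"
    by (simp add: p_def map_poly_pCons algebra_simps)
  moreover have "lead_coeff p = 1" by (simp add: p_def)
  ultimately show ?thesis unfolding algebraic_int_altdef_ipoly by blast
qed

text \<open>Rational root theorem in Z[\<tau>]: for x = r' / t' in lowest terms, the monic equation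
  cleared of denominators shows that t' divides r'^n, so t' is a unit.\<close>

lemma integrally_closed:
  assumes "of_zt t * x = of_zt r" "t \<noteq> 0" "algebraic_int x"
  shows "x \<in> range of_zt"
proof -
  obtain g r' t' where g: "r = r' * g" "t = t' * g" "coprime r' t'" "g \<noteq> 0"
    using gcd_coprime_exists[of r t] assms(2) by auto
  have t': "t' \<noteq> 0" "of_zt t' * x = of_zt r'"
    using assms(1,2) g by auto
  obtain p where p: "poly (map_poly of_int p) x = 0" "lead_coeff p = 1"
    using assms(3) unfolding algebraic_int_altdef_ipoly by blast
  define n where "n = degree p"
  define c where "c i = (of_int (coeff p i) :: zt)" for i
  have deg: "degree (map_poly (of_int :: int \<Rightarrow> real) p) = n"
    unfolding n_def by (rule degree_map_poly) simp
  have "(\<Sum>i\<le>n. of_int (coeff p i) * x ^ i) = 0"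
    using p(1) unfolding poly_altdef deg by (simp add: coeff_map_poly)
  hence "0 = of_zt t' ^ n * (\<Sum>i\<le>n. of_int (coeff p i) * x ^ i)" by simp
  also have "\<dots> = (\<Sum>i\<le>n. of_zt (c i * r' ^ i * t' ^ (n - i)))"
    unfolding sum_distrib_left
  proof (rule sum.cong[OF refl])
    fix i assume "i \<in> {..n}"
    hence "of_zt t' ^ n = of_zt t' ^ i * of_zt t' ^ (n - i)" by (simp flip: power_add)
    thus "of_zt t' ^ n * (of_int (coeff p i) * x ^ i) = of_zt (c i * r' ^ i * t' ^ (n - i))"
      by (simp add: c_def t'(2)[symmetric] power_mult_distrib mult_ac)
  qed
  also have "\<dots> = of_zt (\<Sum>i\<le>n. c i * r' ^ i * t' ^ (n - i))"
  proof -
    have "sum (\<lambda>i. of_zt (f i)) A = of_zt (sum f A)" for f and A :: "nat set"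
      by (induction A rule: infinite_finite_induct) auto
    thus ?thesis .
  qed
  finally have "(\<Sum>i\<le>n. c i * r' ^ i * t' ^ (n - i)) = 0" by (metis of_zt_eq_0_iff)
  moreover have "(\<Sum>i\<le>n. c i * r' ^ i * t' ^ (n - i)) = (\<Sum>i<n. c i * r' ^ i * t' ^ (n - i)) + r' ^ n"
    using p(2) by (simp add: c_def n_def flip: lessThan_Suc_atMost)
  ultimately have "r' ^ n = - (\<Sum>i<n. c i * r' ^ i * t' ^ (n - i))" by (simp add: eq_neg_iff_add_eq_0 add.commute)
  moreover have "t' dvd (\<Sum>i<n. c i * r' ^ i * t' ^ (n - i))"
    by (intro dvd_sum dvd_mult dvd_power) auto
  ultimately have "t' dvd r' ^ n" by simp
  moreover have "coprime t' (r' ^ n)" using g(3) by (simp add: coprime_commute)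
  ultimately have "t' dvd 1" by (metis coprime_common_divisor dvd_refl)
  then obtain u where "1 = t' * u" by blast
  hence "of_zt t' * of_zt u = 1" by (metis of_zt_simps(5,6))
  hence "x = of_zt u * (of_zt t' * x)" by (simp add: mult.commute mult.left_commute flip: mult.assoc)
  hence "x = of_zt (u * r')" by (simp add: t'(2))
  thus ?thesis by blast
qed

lemma carrier_ring_of_integers: "carrier (ring_of_integers Q_sqrt5) = range of_zt"
proof (intro equalityI subsetI)
  fix x assume "x \<in> carrier (ring_of_integers Q_sqrt5)"
  hence "x \<in> Q_sqrt5" "algebraic_int x" by (auto simp: ring_of_integers_def)
  thus "x \<in> range of_zt" using of_zt_quotient integrally_closed by metis
next
  fix x assume "x \<in> range of_zt"
  then obtain n where n: "x = of_zt n" by blast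
  have "x = of_rat (of_int (zre n) + of_int (zim n) / 2) + of_rat (of_int (zim n) / 2) * sqrt 5"
    by (simp add: n of_zt_def tau_def of_rat_add of_rat_divide of_rat_mult field_simps)
  hence "x \<in> Q_sqrt5" unfolding Q_sqrt5_def by blast
  thus "x \<in> carrier (ring_of_integers Q_sqrt5)"
    using algebraic_int_of_zt by (simp add: ring_of_integers_def n)
qed

abbreviation "OK5 \<equiv> ring_of_integers Q_sqrt5"

lemma OK5_simps: "add OK5 = (+)" "zero OK5 = 0" "mult OK5 = (*)" "one OK5 = 1"
  by (simp_all add: ring_of_integers_def)

lemma inj_of_zt: "inj of_zt"
  by (rule injI) simp

lemma sgrp_range_of_zt: "sgrp (range of_zt)"
  by (rule sgrp_range) simp

lemma ring_OK5: "ring OK5"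
proof -
  have s: "sgrp (carrier OK5)" by (simp add: carrier_ring_of_integers sgrp_range_of_zt)
  interpret abelian_group OK5 by (rule abelian_group_of_sgrp[OF OK5_simps(1,2) s])
  show ?thesis
  proof (rule ringI)
    show "abelian_group OK5" by (rule abelian_group_axioms)
    show "monoid OK5"
      by (rule monoidI) (auto simp: OK5_simps carrier_ring_of_integers simp flip: of_zt_simps(5,6))
  qed (simp_all add: OK5_simps algebra_simps)
qed

lemma ideals_OK5: "{J. ideal J OK5 \<and> J \<noteq> {0}} = (\<lambda>n. of_zt ` zideal n) ` ZA"
proof (intro equalityI subsetI)
  fix J assume "J \<in> {J. ideal J OK5 \<and> J \<noteq> {0}}"
  hence J: "ideal J OK5" "J \<noteq> {0}" by simp_all
  interpret ideal J OK5 by (rule J(1))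
  have s: "sgrp (carrier OK5)" by (simp add: carrier_ring_of_integers sgrp_range_of_zt)
  have sJ: "sgrp J" "J \<subseteq> range of_zt"
    using additive_subgroup_iff[OF OK5_simps(1,2) s, of J] is_additive_subgroup
    by (simp_all add: carrier_ring_of_integers)
  obtain T where T: "J = of_zt ` T" using sJ(2) by (metis subset_imageE)
  have e: "of_zt x \<in> of_zt ` T \<longleftrightarrow> x \<in> T" for x by auto
  have "sgrp T"
    unfolding sgrp_def using sJ(1) unfolding T sgrp_def
    by (metis e imageI of_zt_simps(2,4))
  moreover have "r * t \<in> T" if "t \<in> T" for t r
    using I_l_closed[of "of_zt t" "of_zt r"] that
    by (simp add: T e carrier_ring_of_integers OK5_simps flip: of_zt_simps(6))
  ultimately obtain t where t: "T = zideal t" using zideal_principal by blast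
  have "t \<noteq> 0" using J(2) T t by auto
  hence "normalize t \<in> ZA" by (simp add: ZA_def)
  moreover have "zideal (normalize t) = zideal t"
    by (intro Set.set_eqI) (simp only: zideal_iff normalize_dvd_iff)
  ultimately show "J \<in> (\<lambda>n. of_zt ` zideal n) ` ZA" using T t by (metis imageI)
next
  fix J assume "J \<in> (\<lambda>n. of_zt ` zideal n) ` ZA"
  then obtain n where n: "n \<in> ZA" "J = of_zt ` zideal n" by blast
  have s: "sgrp (carrier OK5)" by (simp add: carrier_ring_of_integers sgrp_range_of_zt)
  have "additive_subgroup J OK5"
    unfolding additive_subgroup_iff[OF OK5_simps(1,2) s] n(2)
    by (auto simp: carrier_ring_of_integers intro!: sgrp_image sgrp_zideal)
  hence sub: "subgroup J (add_monoid OK5)" by (simp add: additive_subgroup_def)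
  have cl: "of_zt (r * t) \<in> J" if "of_zt t \<in> J" for r t
  proof -
    have "t \<in> zideal n" using that unfolding n(2) by (simp only: inj_image_mem_iff[OF inj_of_zt])
    hence "n dvd t" by (simp only: zideal_iff)
    hence "r * t \<in> zideal n" by (simp add: zideal_iff)
    thus ?thesis using n(2) by blast
  qed
  have sJ: "J \<subseteq> range of_zt" using n(2) by blast
  have "ideal J OK5"
  proof (rule idealI[OF ring_OK5 sub])
    fix a x assume "a \<in> J" "x \<in> carrier OK5"
    then obtain t r where "a = of_zt t" "x = of_zt r" "of_zt t \<in> J" using sJ by (auto simp: carrier_ring_of_integers)
    thus "x \<otimes>\<^bsub>OK5\<^esub> a \<in> J" "a \<otimes>\<^bsub>OK5\<^esub> x \<in> J"
      using cl[of t r] by (simp_all add: OK5_simps mult.commute)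
  qed
  moreover have "of_zt n \<in> J" "of_zt n \<noteq> 0"
    using n by (auto simp: ZA_def zideal_iff intro!: imageI)
  ultimately show "J \<in> {J. ideal J OK5 \<and> J \<noteq> {0}}" by auto
qed

lemma dedekind_zeta_eq: "dedekind_zeta Q_sqrt5 s = zetaK s"
proof -
  have "inj_on (\<lambda>n. of_zt ` zideal n) ZA"
  proof (rule inj_onI)
    fix m n assume mn: "m \<in> ZA" "n \<in> ZA" and "of_zt ` zideal m = of_zt ` zideal n"
    hence "zideal m = zideal n" using inj_of_zt by (simp only: inj_image_eq_iff)
    hence "m dvd n" "n dvd m" using zideal_iff by (metis dvd_refl)+
    thus "m = n" using ZA_dvd_antisym mn by blast
  qed
  hence "dedekind_zeta Q_sqrt5 s = (\<Sum>\<^sub>\<infinity>n\<in>ZA. of_nat (add_index OK5 (of_zt ` zideal n)) powr (- s))"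
    unfolding dedekind_zeta_def ideals_OK5 by (subst infsum_reindex) (auto simp: o_def)
  also have "\<dots> = zetaK s"
    unfolding zetaK_def
  proof (rule infsum_cong)
    fix n assume "n \<in> ZA"
    hence "add_index OK5 (of_zt ` zideal n) = qn n"
      by (subst add_index_image)
        (auto simp: OK5_simps carrier_ring_of_integers inj_of_zt idx_zideal qn_def ZA_def)
    thus "of_nat (add_index OK5 (of_zt ` zideal n)) powr (- s) = npow (qn n) s" by (simp add: npow_def)
  qed
  finally show ?thesis .
qed

lemma SSM_indices:
  "{add_index icosian_ring M | M. SSM (carrier icosian_ring) M} =
     {m. \<exists>x y k :: int. k = x\<^sup>2 + x * y - y\<^sup>2 \<and> k \<noteq> 0 \<and> int m = k\<^sup>2}"
proof -
  have "{add_index icosian_ring M | M. SSM (carrier icosian_ring) M} = idx UNIV ` SS"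
    using SSM_iff add_index_emb by auto metis
  also have "\<dots> = {m. \<exists>n. n \<noteq> 0 \<and> m = (qn n)\<^sup>2}" by (rule SS_index)
  also have "\<dots> = {m. \<exists>x y k :: int. k = x\<^sup>2 + x * y - y\<^sup>2 \<and> k \<noteq> 0 \<and> int m = k\<^sup>2}"
  proof (intro Collect_cong iffI)
    fix m assume "\<exists>n. n \<noteq> 0 \<and> m = (qn n)\<^sup>2"
    then obtain n where n: "n \<noteq> 0" "m = (qn n)\<^sup>2" by blast
    have "int m = (znorm n)\<^sup>2" by (simp add: n qn_def)
    thus "\<exists>x y k :: int. k = x\<^sup>2 + x * y - y\<^sup>2 \<and> k \<noteq> 0 \<and> int m = k\<^sup>2"
      using n(1) by (intro exI[of _ "zre n"] exI[of _ "zim n"] exI[of _ "znorm n"]) (simp add: znorm_def[symmetric])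
  next
    fix m assume "\<exists>x y k :: int. k = x\<^sup>2 + x * y - y\<^sup>2 \<and> k \<noteq> 0 \<and> int m = k\<^sup>2"
    then obtain x y k :: int where k: "k = x\<^sup>2 + x * y - y\<^sup>2" "k \<noteq> 0" "int m = k\<^sup>2" by blast
    have z: "znorm (ZT x y) = k" by (simp add: znorm_def k(1))
    hence "ZT x y \<noteq> 0" using k(2) by auto
    moreover have "int m = int ((qn (ZT x y))\<^sup>2)" by (simp add: qn_def z k(3))
    hence "m = (qn (ZT x y))\<^sup>2" by (simp only: of_nat_eq_iff)
    ultimately show "\<exists>n. n \<noteq> 0 \<and> m = (qn n)\<^sup>2" by blast
  qed
  finally show ?thesis .
qed

theorem theorem3:
  shows "{add_index icosian_ring M | M. SSM (carrier icosian_ring) M} =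
           {m. \<exists>x y k :: int. k = x\<^sup>2 + x * y - y\<^sup>2 \<and> k \<noteq> 0 \<and> int m = k\<^sup>2} \<and>
         (\<forall>m>0. finite (icosian_SSMs m)) \<and>
         multiplicative (\<lambda>m. card (icosian_SSMs m)) \<and>
         (\<forall>s. Re s > 1 \<longrightarrow>
           icosian_SSM_term s summable_on {1..} \<and>
           icosian_SSM_series s = (icosian_zeta s)\<^sup>2 / dedekind_zeta Q_sqrt5 (4 * s) \<and>
           icosian_SSM_series s =
             (dedekind_zeta Q_sqrt5 (2 * s) * dedekind_zeta Q_sqrt5 (2 * s - 1))\<^sup>2
               / dedekind_zeta Q_sqrt5 (4 * s))"
proof (intro conjI allI impI)
  show "{add_index icosian_ring M | M. SSM (carrier icosian_ring) M} =
           {m. \<exists>x y k :: int. k = x\<^sup>2 + x * y - y\<^sup>2 \<and> k \<noteq> 0 \<and> int m = k\<^sup>2}"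
    by (rule SSM_indices)
  show "finite (icosian_SSMs m)" if "m > 0" for m
    using mulw_SS that by (auto simp: icosian_SSMs_eq mulw_def)
  show "multiplicative (\<lambda>m. card (icosian_SSMs m))"
    using mulw_SS by (simp add: multiplicative_def mulw_def card_icosian_SSMs)
  fix s :: complex assume s: "Re s > 1"
  have "icosian_SSM_term s = (\<lambda>m. of_nat (card {M \<in> SS. idx UNIV M = m}) * npow m s)"
    by (auto simp: icosian_SSM_term_def card_icosian_SSMs npow_def)
  thus "icosian_SSM_term s summable_on {1..}"
    and 1: "icosian_SSM_series s = (icosian_zeta s)\<^sup>2 / dedekind_zeta Q_sqrt5 (4 * s)"
    using SS_series_by_index[OF s]
    by (simp_all add: icosian_SSM_series_def icosian_zeta_eq dedekind_zeta_eq)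
  show "icosian_SSM_series s =
             (dedekind_zeta Q_sqrt5 (2 * s) * dedekind_zeta Q_sqrt5 (2 * s - 1))\<^sup>2
               / dedekind_zeta Q_sqrt5 (4 * s)"
    unfolding 1 by (simp add: icosian_zeta_eq dedekind_zeta_eq zetaI_product(2)[OF s])
qed

end
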